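(* Let $\mathcal{B}=\mathrm{ShST}(\lambda/\mu,n)$ (tableaux up to equivalence). For $1\le i\le n-1$ and $T\in\mathcal{B}$, let $(\varphi_i(T),\varepsilon_i(T)):=(x^{(i)},y^{(i)})$ be the endpoint of the $i$-th lattice walk of the reading word of $T$, and let $\mathrm{wt}(T)$ be the weight of $T$. Then: (a) for each $i$, any two of the operators $F_i,E_i,F_i',E_i'$ commute whenever both compositions are defined (e.g. $F_iF_i'(T)=F_i'F_i(T)$ whenever both sides are not $\varnothing$); (b) $(\mathcal{B},\{E_i,F_i\},\{\varepsilon_i,\varphi_i\},\mathrm{wt})$ and $(\mathcal{B},\{E_i',F_i'\},\{\varepsilon_i,\varphi_i\},\mathrm{wt})$ each satisfy the Kashiwara crystal axioms (K1) and (K2) for $\mathrm{GL}_n$.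
   Context: Kashiwara crystal axioms for $\mathrm{GL}_n$, for a set $\mathcal{B}$ with partial operators $e_i,f_i$, functions $\varepsilon_i,\varphi_i:\mathcal{B}\to\mathbb{Z}$ ($1\le i\le n-1$) and $\mathrm{wt}:\mathcal{B}\to\mathbb{Z}^n$: (K1) $e_i,f_i$ are partial inverses ($Y=e_i(X)$ iff $X=f_i(Y)$), and if $Y=e_i(X)$ then $(\varepsilon_i(Y),\varphi_i(Y))=(\varepsilon_i(X)-1,\varphi_i(X)+1)$ and $\mathrm{wt}(Y)=\mathrm{wt}(X)+\alpha_i$, where $\alpha_i$ has $1$ in position $i$, $-1$ in position $i+1$, and $0$ elsewhere; (K2) $\varphi_i(X)=\langle\mathrm{wt}(X),\alpha_i\rangle+\varepsilon_i(X)$ for all $i$ and $X$. Letters are ordered $1'<1<2'<2<\cdots$. Strings are equivalent if they differ only in whether, for some $i$, the first letter from $\{i',i\}$ is primed; words are equivalence classes. Weight $\mathrm{wt}(w)=(n_1,\dots,n_n)$ counts letters $i$ or $i'$. Standardization $\mathrm{std}(w)$ replaces letters by $1,\dots,N$ in increasing order of value, breaking ties among equal unprimed letters left to right and among equal primed letters right to left. $\mathrm{ShST}(\lambda/\mu,n)$: fillings of the shifted skew shape $\lambda/\mu$ ($\lambda,\mu$ strict partitions, row $r$ of a shifted diagram occupying columns $r,\dots,r+\lambda_r-1$) by letters from $\{1',1,\dots,n',n\}$, rows and columns weakly increasing, each unprimed letter at most once per column and each primed letter at most once per row; reading word = rows left to right, bottom row to top row; tableaux are equivalent if they have the same shape and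 equivalent reading words. Lattice walk of a word in $\{1',1,2',2\}$: start at $(0,0)$, one unit step per letter; at $(x,y)$ with $x>0,y>0$: $1'$ east, $1$ south, $2$ north, $2'$ west; when $x=0$ or $y=0$: $1,1'$ east and $2,2'$ north. The $i$-th lattice walk of $w$ is the walk of the subword of letters in $\{i',i,(i+1)',i+1\}$ with $i,i+1$ read as $1,2$. Operators on words in $\{1',1,2',2\}$: $E'(w)$ (resp. $F'(w)$) is the unique word with the same standardization and weight $\mathrm{wt}(w)+(1,-1)$ (resp. $-(1,-1)$), else $\varnothing$. For a representative $v$ and substring $u=v_k\cdots v_l$, with $(x,y)$ the walk position after $v_1\cdots v_{k-1}$: $u$ is $F$-critical of type 1F if $u=1(1')^m2'$ ($m\ge0$), ($y=0$ or ($y=1,x\ge1$)), transformed to $2'(1')^m2$; 2F if $u=1(2)^m1'$, ($x=0$ or ($x=1,y\ge1$)), transformed to $2'(2)^m1$; 3F if $u=1$, $y=0$, to $2$; 4F if $u=1'$, $x=0$, to $2'$; 5F if $u\in\{1,2'\}$, $x=1,y\ge1$ (undefined). $F(w)$ transforms the final $F$-critical substring over all representatives (largest starting index, then longest), and is $\varnothing$ if it has type 5F or none exists. $E$ is the same with $E$-critical types: 1E $u=2'(2)^m1$, ($x=0$ or ($x=1,y\ge1$)) $\mapsto1(2)^m1'$; 2E $u=2'(1')^m2$, ($y=0$ or ($y=1,x\ge1$)) $\mapsto1(1')^m2'$; 3E $u=2'$, $x=0$ $\mapsto1'$; 4E $u=2$, $y=0$ $\mapsto1$; 5E $u\in\{2',1\}$,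 $y=1,x\ge1$ (undefined). $E_i,F_i,E_i',F_i'$ act on the subword of letters in $\{i',i,(i+1)',i+1\}$ (reading $i,i+1$ as $1,2$), and on tableaux via reading words, keeping the shape. *)

theory Defs
  imports Main
begin

text \<open>A letter is a pair (index, primed): (i, True) is i', (i, False) is i.
  Order 1' < 1 < 2' < 2 < ... is given by the key lkey.\<close>
type_synonym letter = "nat \<times> bool"
type_synonym word = "letter list"

definition lkey :: "letter \<Rightarrow> nat" where
  "lkey a = 2 * fst a - (if snd a then 1 else 0)"

text \<open>Canonical representative of a word (equivalence class of strings):
  the first letter from {i', i} is made unprimed, for every i.\<close>
definition canon :: "word \<Rightarrow> word" where
  "canon v = map (\<lambda>j. (fst (v ! j), snd (v ! j) \<and> (\<exists>p<j. fst (v ! p) = fst (v ! j))))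
                 [0..<length v]"

definition wt :: "word \<Rightarrow> nat \<Rightarrow> int" where
  "wt w j = int (length (filter (\<lambda>a. fst a = j) w))"

definition std_tb :: "word \<Rightarrow> nat \<Rightarrow> int" where
  "std_tb v p = (if snd (v ! p) then - int p else int p)"

definition std_less :: "word \<Rightarrow> nat \<Rightarrow> nat \<Rightarrow> bool" where
  "std_less v p j \<longleftrightarrow> lkey (v ! p) < lkey (v ! j) \<or>
      (lkey (v ! p) = lkey (v ! j) \<and> std_tb v p < std_tb v j)"

definition std :: "word \<Rightarrow> nat list" where
  "std v = map (\<lambda>j. Suc (card {p. p < length v \<and> std_less v p j})) [0..<length v]"

definition wstep :: "nat \<times> nat \<Rightarrow> letter \<Rightarrow> nat \<times> nat" where
  "wstep pos a = (let x = fst pos; y = snd pos in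
     if x > 0 \<and> y > 0 then
       (if a = (1, True) then (x + 1, y)
        else if a = (1, False) then (x, y - 1)
        else if a = (2, False) then (x, y + 1)
        else (x - 1, y))
     else (if fst a = 1 then (x + 1, y) else (x, y + 1)))"

definition walk_end :: "word \<Rightarrow> nat \<times> nat" where
  "walk_end w = foldl wstep (0, 0) w"

text \<open>Result: None = not critical; Some None = type 5 (undefined);
  Some (Some u') = critical, transformed to u'.\<close>
definition fcrit :: "nat \<times> nat \<Rightarrow> word \<Rightarrow> word option option" where
  "fcrit pos u = (let x = fst pos; y = snd pos in
     if (\<exists>m. u = [(1, False)] @ replicate m (1, True) @ [(2, True)]) \<and> (y = 0 \<or> (y = 1 \<and> x \<ge> 1))
       then Some (Some ([(2, True)] @ replicate (length u - 2) (1, True) @ [(2, False)]))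
     else if (\<exists>m. u = [(1, False)] @ replicate m (2, False) @ [(1, True)]) \<and> (x = 0 \<or> (x = 1 \<and> y \<ge> 1))
       then Some (Some ([(2, True)] @ replicate (length u - 2) (2, False) @ [(1, False)]))
     else if u = [(1, False)] \<and> y = 0 then Some (Some [(2, False)])
     else if u = [(1, True)] \<and> x = 0 then Some (Some [(2, True)])
     else if (u = [(1, False)] \<or> u = [(2, True)]) \<and> x = 1 \<and> y \<ge> 1 then Some None
     else None)"

definition ecrit :: "nat \<times> nat \<Rightarrow> word \<Rightarrow> word option option" where
  "ecrit pos u = (let x = fst pos; y = snd pos in
     if (\<exists>m. u = [(2, True)] @ replicate m (2, False) @ [(1, False)]) \<and> (x = 0 \<or> (x = 1 \<and> y \<ge> 1))
       then Some (Some ([(1, False)] @ replicate (length u - 2) (2, False) @ [(1, True)]))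
     else if (\<exists>m. u = [(2, True)] @ replicate m (1, True) @ [(2, False)]) \<and> (y = 0 \<or> (y = 1 \<and> x \<ge> 1))
       then Some (Some ([(1, False)] @ replicate (length u - 2) (1, True) @ [(2, True)]))
     else if u = [(2, True)] \<and> x = 0 then Some (Some [(1, True)])
     else if u = [(2, False)] \<and> y = 0 then Some (Some [(1, False)])
     else if (u = [(2, True)] \<or> u = [(1, False)]) \<and> y = 1 \<and> x \<ge> 1 then Some None
     else None)"

text \<open>Candidates: (representative v, start k, end l (inclusive, 0-based), result r).\<close>
definition crit_cands :: "(nat \<times> nat \<Rightarrow> word \<Rightarrow> word option option) \<Rightarrow> word
      \<Rightarrow> (word \<times> nat \<times> nat \<times> word option) set" where
  "crit_cands C w = {(v, k, l, r). canon v = canon w \<and> k \<le> l \<and> l < length v \<and>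
      C (walk_end (take k v)) (take (Suc l - k) (drop k v)) = Some r}"

definition crit_op :: "(nat \<times> nat \<Rightarrow> word \<Rightarrow> word option option) \<Rightarrow> word \<Rightarrow> word option" where
  "crit_op C w = (let cands = crit_cands C w in
     if cands = {} then None else
     let k0 = Max {k. \<exists>v l r. (v, k, l, r) \<in> cands};
         l0 = Max {l. \<exists>v r. (v, k0, l, r) \<in> cands};
         vr = (SOME vr. (fst vr, k0, l0, snd vr) \<in> cands)
     in case snd vr of
          None \<Rightarrow> None
        | Some u' \<Rightarrow> Some (canon (take k0 (fst vr) @ u' @ drop (Suc l0) (fst vr))))"

definition Fop :: "word \<Rightarrow> word option" where "Fop = crit_op fcrit"
definition Eop :: "word \<Rightarrow> word option" where "Eop = crit_op ecrit"

definition L2 :: "letter set" where "L2 = {(1, True), (1, False), (2, True), (2, False)}"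

definition Fpop :: "word \<Rightarrow> word option" where
  "Fpop w = (let P = (\<lambda>c. canon c = c \<and> set c \<subseteq> L2 \<and> std c = std w \<and>
                      wt c 1 = wt w 1 - 1 \<and> wt c 2 = wt w 2 + 1)
             in if \<exists>!c. P c then Some (THE c. P c) else None)"

definition Epop :: "word \<Rightarrow> word option" where
  "Epop w = (let P = (\<lambda>c. canon c = c \<and> set c \<subseteq> L2 \<and> std c = std w \<and>
                      wt c 1 = wt w 1 + 1 \<and> wt c 2 = wt w 2 - 1)
             in if \<exists>!c. P c then Some (THE c. P c) else None)"

definition relabel :: "nat \<Rightarrow> letter \<Rightarrow> letter" where
  "relabel i a = (fst a + 1 - i, snd a)"

definition unrelabel :: "nat \<Rightarrow> letter \<Rightarrow> letter" where
  "unrelabel i a = (fst a + i - 1, snd a)"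

definition isub :: "nat \<Rightarrow> word \<Rightarrow> word" where
  "isub i w = map (relabel i) (filter (\<lambda>a. fst a = i \<or> fst a = Suc i) w)"

definition lift_op :: "(word \<Rightarrow> word option) \<Rightarrow> nat \<Rightarrow> word \<Rightarrow> word option" where
  "lift_op op i w = (let ps = filter (\<lambda>j. fst (w ! j) = i \<or> fst (w ! j) = Suc i) [0..<length w]
     in case op (map (\<lambda>j. relabel i (w ! j)) ps) of
          None \<Rightarrow> None
        | Some s' \<Rightarrow> Some (canon (foldl (\<lambda>v ja. v[fst ja := unrelabel i (snd ja)]) w (zip ps s'))))"

definition F_i :: "nat \<Rightarrow> word \<Rightarrow> word option" where "F_i = lift_op Fop"
definition E_i :: "nat \<Rightarrow> word \<Rightarrow> word option" where "E_i = lift_op Eop"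
definition Fp_i :: "nat \<Rightarrow> word \<Rightarrow> word option" where "Fp_i = lift_op Fpop"
definition Ep_i :: "nat \<Rightarrow> word \<Rightarrow> word option" where "Ep_i = lift_op Epop"

definition phi_i :: "nat \<Rightarrow> word \<Rightarrow> int" where
  "phi_i i w = int (fst (walk_end (isub i w)))"
definition eps_i :: "nat \<Rightarrow> word \<Rightarrow> int" where
  "eps_i i w = int (snd (walk_end (isub i w)))"

definition strict_partition :: "nat list \<Rightarrow> bool" where
  "strict_partition la \<longleftrightarrow> sorted_wrt (>) la \<and> (\<forall>x\<in>set la. x > 0)"

definition part :: "nat list \<Rightarrow> nat \<Rightarrow> nat" where
  "part la r = (if 1 \<le> r \<and> r \<le> length la then la ! (r - 1) else 0)"

definition part_contained :: "nat list \<Rightarrow> nat list \<Rightarrow> bool" where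
  "part_contained mu la \<longleftrightarrow> length mu \<le> length la \<and> (\<forall>r. part mu r \<le> part la r)"

text \<open>Columns of row r of the shifted skew shape la/mu (row r of a shifted diagram
  occupies columns r, ..., r + la_r - 1).\<close>
definition row_cols :: "nat list \<Rightarrow> nat list \<Rightarrow> nat \<Rightarrow> nat list" where
  "row_cols la mu r = [r + part mu r ..< r + part la r]"

definition cells :: "nat list \<Rightarrow> nat list \<Rightarrow> (nat \<times> nat) set" where
  "cells la mu = {(r, c). 1 \<le> r \<and> r \<le> length la \<and> c \<in> set (row_cols la mu r)}"

definition is_shst :: "nat list \<Rightarrow> nat list \<Rightarrow> nat \<Rightarrow> (nat \<times> nat \<Rightarrow> letter) \<Rightarrow> bool" where
  "is_shst la mu n t \<longleftrightarrow>
     (\<forall>p\<in>cells la mu. 1 \<le> fst (t p) \<and> fst (t p) \<le> n) \<and>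
     (\<forall>r c c'. (r, c) \<in> cells la mu \<and> (r, c') \<in> cells la mu \<and> c < c' \<longrightarrow>
         lkey (t (r, c)) \<le> lkey (t (r, c'))) \<and>
     (\<forall>r r' c. (r, c) \<in> cells la mu \<and> (r', c) \<in> cells la mu \<and> r < r' \<longrightarrow>
         lkey (t (r, c)) \<le> lkey (t (r', c))) \<and>
     (\<forall>r r' c. (r, c) \<in> cells la mu \<and> (r', c) \<in> cells la mu \<and> r \<noteq> r' \<and> \<not> snd (t (r, c)) \<longrightarrow>
         t (r, c) \<noteq> t (r', c)) \<and>
     (\<forall>r c c'. (r, c) \<in> cells la mu \<and> (r, c') \<in> cells la mu \<and> c \<noteq> c' \<and> snd (t (r, c)) \<longrightarrow>
         t (r, c) \<noteq> t (r, c'))"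

definition reading :: "nat list \<Rightarrow> nat list \<Rightarrow> (nat \<times> nat \<Rightarrow> letter) \<Rightarrow> word" where
  "reading la mu t = concat (map (\<lambda>r. map (\<lambda>c. t (r, c)) (row_cols la mu r)) (rev [1..<Suc (length la)]))"

text \<open>ShST(la/mu, n) up to equivalence: a tableau class of the fixed shape is
  identified with the canonical representative of its reading word.\<close>
definition ShST :: "nat list \<Rightarrow> nat list \<Rightarrow> nat \<Rightarrow> word set" where
  "ShST la mu n = {canon (reading la mu t) | t. is_shst la mu n t}"

definition alpha :: "nat \<Rightarrow> nat \<Rightarrow> int" where
  "alpha i j = (if j = i then 1 else if j = Suc i then -1 else 0)"

definition kashiwara_crystal :: "'b set \<Rightarrow> nat \<Rightarrow> (nat \<Rightarrow> 'b \<Rightarrow> 'b option) \<Rightarrow>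
     (nat \<Rightarrow> 'b \<Rightarrow> 'b option) \<Rightarrow> (nat \<Rightarrow> 'b \<Rightarrow> int) \<Rightarrow> (nat \<Rightarrow> 'b \<Rightarrow> int) \<Rightarrow>
     ('b \<Rightarrow> nat \<Rightarrow> int) \<Rightarrow> bool" where
  "kashiwara_crystal B n e f eps phi wtf \<longleftrightarrow>
     (\<forall>i. 1 \<le> i \<and> i < n \<longrightarrow>
        (\<forall>X\<in>B. \<forall>Y. (e i X = Some Y \<longrightarrow> Y \<in> B) \<and> (f i X = Some Y \<longrightarrow> Y \<in> B)) \<and>
        (\<forall>X\<in>B. \<forall>Y\<in>B. e i X = Some Y \<longleftrightarrow> f i Y = Some X) \<and>
        (\<forall>X\<in>B. \<forall>Y\<in>B. e i X = Some Y \<longrightarrow>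
            eps i Y = eps i X - 1 \<and> phi i Y = phi i X + 1 \<and>
            wtf Y = (\<lambda>j. wtf X j + alpha i j)) \<and>
        (\<forall>X\<in>B. phi i X = (wtf X i - wtf X (Suc i)) + eps i X))"

end

theory Submission
  imports Defs
begin

text \<open>The operators are described on representatives. F' changes an i all of whose successors
  are neutral, i.e. neither i nor (i+1)', into (i+1)'. F makes one of the replacements 1F-4F and copies the
  remaining letters, provided that every later i or (i+1)' is read at a point with x \<ge> 2 and y \<ge> 1.
  Both relations can be evaluated letter by letter from the left, hence are functional on equivalence classes.
  The key observation is that 1F sends w(i+1)' to F'(w)(i+1) when w ends on y = 0, and 2F sends wi' to F'(w)i when
  w ends on x = 1: so F and F' commute, by induction on the word. Exchanging i with (i+1)' and i' with i+1 reflects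
  the walk and turns F, F' into E, E'.

  The tableau conditions depend only on the standardization of the reading word, so F' and E' preserve them.
  For F and E a changed cell can only conflict with the cell below or above it, and such a conflict is excluded by
  comparing the height y of the walk with the number of cells of kind i+1 in the lower of the two rows.\<close>

section \<open>Canonical representatives and lattice walks\<close>

text \<open>\<open>crit_op\<close> maximises over all representatives at once, and no single
  representative serves all types: 4F may need the first letter of kind i primed, 1F may need it
  unprimed. Relations on representatives that grow at the right end replace the maximum. The
  constants in the \<open>step\<close> rule of \<open>F_rel\<close> come from the walk. If a word
  ends at (x, y), its image ends at (x-1, y+1), and only i and (i+1)' move differently on the axes;
  the two walks stay parallel when both points are off the axes, that is for x >= 2 and y >= 1. Type
  5F is the failure at x = 1. A critical substring and the \<open>step\<close> rule can compete for
  one class; then the word read so far has no letter of kind i+1 or only one of kind i, and F and F'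
  agree on it. E and E' are the converse relations, so they are partial inverses by construction,
  and all mixed commutations reduce to a single square and its reflection. On tableaux the obstacle
  is the main diagonal, where a cell may lack the neighbour below it on which the comparison of two
  rows relies.\<close>

definition nrm :: "word \<Rightarrow> letter \<Rightarrow> letter" where
  "nrm w a = (fst a, snd a \<and> fst a \<in> fst ` set w)"

lemma canon_Nil [simp]: "canon [] = []"
  by (simp add: canon_def)

abbreviation eqv :: "word \<Rightarrow> word \<Rightarrow> bool" (infix "\<sim>" 50) where
  "v \<sim> w \<equiv> canon v = canon w"

abbreviation off :: "nat \<Rightarrow> letter \<Rightarrow> bool" where
  "off i a \<equiv> fst a \<noteq> i \<and> fst a \<noteq> Suc i"

lemma length_canon [simp]: "length (canon w) = length w"
  by (simp add: canon_def)

text \<open>\<open>canon\<close> consults only earlier letters, so a word is normalised from left to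
  right and \<open>nrm w a\<close> is the contribution of \<open>a\<close> after \<open>w\<close>.
  This makes induction on the last letter the standard method below.\<close>

lemma canon_snoc [simp]: "canon (w @ [a]) = canon w @ [nrm w a]"
proof -
  have "(\<exists>p<length w. fst (w ! p) = fst a) \<longleftrightarrow> fst a \<in> fst ` set w"
    unfolding image_iff by (metis in_set_conv_nth)
  then have e: "(\<exists>p<length w. fst ((w @ [a]) ! p) = fst a) \<longleftrightarrow> fst a \<in> fst ` set w"
    by (simp add: nth_append cong: conj_cong)
  show ?thesis
  proof (rule nth_equalityI)
    fix j assume "j < length (canon (w @ [a]))"
    then have j: "j < Suc (length w)" by (simp add: canon_def)
    have l: "length (canon w) = length w" by (simp add: canon_def)
    show "canon (w @ [a]) ! j = (canon w @ [nrm w a]) ! j"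
    proof (cases "j < length w")
      case True
      then have "(\<exists>p<j. fst ((w @ [a]) ! p) = fst ((w @ [a]) ! j)) \<longleftrightarrow> (\<exists>p<j. fst (w ! p) = fst (w ! j))"
        by (simp add: nth_append cong: conj_cong)
      then show ?thesis using True l by (simp add: canon_def nth_append)
    next
      case False
      then have [simp]: "j = length w" using j by simp
      show ?thesis using l e by (simp add: canon_def nth_append nrm_def)
    qed
  qed (simp add: canon_def)
qed

lemma fst_nrm [simp]: "fst (nrm w a) = fst a"
  by (simp add: nrm_def)

lemma canon_eq_Nil [simp]: "canon w = [] \<longleftrightarrow> w = []"
  using length_canon[of w] by (metis length_0_conv)

lemma map_fst_canon [simp]: "map fst (canon w) = map fst w"
  by (induction w rule: rev_induct) auto

lemma fst_set_canon [simp]: "fst ` set (canon w) = fst ` set w"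
  by (metis list.set_map map_fst_canon)

lemma nrm_canon [simp]: "nrm (canon w) a = nrm w a"
  by (simp add: nrm_def)

lemma nrm_nrm [simp]: "nrm w (nrm w a) = nrm w a"
  by (simp add: nrm_def)

lemma canon_canon [simp]: "canon (canon w) = canon w"
  by (induction w rule: rev_induct) auto

lemma eqv_fst: "v \<sim> w \<Longrightarrow> map fst v = map fst w"
  by (metis map_fst_canon)

lemma eqv_fst_set: "v \<sim> w \<Longrightarrow> fst ` set v = fst ` set w"
  by (metis fst_set_canon)

lemma eqv_length: "v \<sim> w \<Longrightarrow> length v = length w"
  by (metis length_canon)

lemma eqv_nrm: "v \<sim> w \<Longrightarrow> nrm v a = nrm w a"
  by (metis nrm_canon)

lemma eqv_append: "v \<sim> w \<Longrightarrow> (v @ s) \<sim> (w @ s)"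
proof (induction s rule: rev_induct)
  case (snoc a s)
  then have "(v @ s) \<sim> (w @ s)" by simp
  then have "((v @ s) @ [a]) \<sim> ((w @ s) @ [a])"
    using eqv_nrm canon_snoc by metis
  then show ?case by simp
qed simp

lemma eqv_snocE:
  assumes "v \<sim> (w @ [a])"
  obtains v0 b where "v = v0 @ [b]" "v0 \<sim> w" "nrm v0 b = nrm w a"
proof -
  have "v \<noteq> []" using assms by auto
  then obtain v0 b where "v = v0 @ [b]" by (metis rev_exhaust)
  with assms that show thesis by auto
qed

lemma nrm_cases: "nrm w a = a \<or> (fst a \<notin> fst ` set w \<and> snd a \<and> nrm w a = (fst a, False))"
  by (cases a) (auto simp: nrm_def)

definition cnt :: "nat \<Rightarrow> word \<Rightarrow> nat" where
  "cnt k w = length (filter (\<lambda>a. fst a = k) w)"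

lemma cnt_Nil [simp]: "cnt k [] = 0" by (simp add: cnt_def)
lemma cnt_snoc [simp]: "cnt k (w @ [a]) = cnt k w + (if fst a = k then 1 else 0)"
  by (simp add: cnt_def)

lemma cnt_0: "cnt k w = 0 \<longleftrightarrow> k \<notin> fst ` set w"
  by (auto simp: cnt_def filter_empty_conv)

text \<open>The two regimes of the walk are merged: i' always goes east and i+1 always north, so
  only i and (i+1)' test whether the point is off the axes. Other kinds leave the point fixed, so
  the walk can be followed without extracting a subword.\<close>

definition istep :: "nat \<Rightarrow> nat \<times> nat \<Rightarrow> letter \<Rightarrow> nat \<times> nat" where
  "istep i p a = (let x = fst p; y = snd p in
     if a = (i, True) then (x + 1, y)
     else if a = (Suc i, False) then (x, y + 1)
     else if a = (i, False) then (if x > 0 \<and> y > 0 then (x, y - 1) else (x + 1, y))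
     else if a = (Suc i, True) then (if x > 0 \<and> y > 0 then (x - 1, y) else (x, y + 1))
     else (x, y))"

definition iwalk :: "nat \<Rightarrow> word \<Rightarrow> nat \<times> nat" where
  "iwalk i w = foldl (istep i) (0, 0) w"

definition wx :: "nat \<Rightarrow> word \<Rightarrow> nat" where "wx i w = fst (iwalk i w)"
definition wy :: "nat \<Rightarrow> word \<Rightarrow> nat" where "wy i w = snd (iwalk i w)"

lemma wxy_Nil [simp]: "wx i [] = 0" "wy i [] = 0"
  by (simp_all add: wx_def wy_def iwalk_def)

lemma iwalk_wxy: "iwalk i w = (wx i w, wy i w)"
  by (simp add: wx_def wy_def)

lemma iwalk_snoc: "iwalk i (w @ [a]) = istep i (iwalk i w) a"
  by (simp add: iwalk_def)

lemma wx_snoc: "wx i (w @ [a]) =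
   (if a = (i, True) then wx i w + 1
    else if a = (i, False) then (if wx i w > 0 \<and> wy i w > 0 then wx i w else wx i w + 1)
    else if a = (Suc i, True) then (if wx i w > 0 \<and> wy i w > 0 then wx i w - 1 else wx i w)
    else wx i w)"
  by (auto simp: wx_def wy_def iwalk_snoc istep_def Let_def)

lemma wy_snoc: "wy i (w @ [a]) =
   (if a = (Suc i, False) then wy i w + 1
    else if a = (i, False) then (if wx i w > 0 \<and> wy i w > 0 then wy i w - 1 else wy i w)
    else if a = (Suc i, True) then (if wx i w > 0 \<and> wy i w > 0 then wy i w else wy i w + 1)
    else wy i w)"
  by (auto simp: wx_def wy_def iwalk_snoc istep_def Let_def)

lemma isub_Nil [simp]: "isub i [] = []" by (simp add: isub_def)

lemma isub_snoc [simp]: "isub i (w @ [a]) = isub i w @ (if fst a = i \<or> fst a = Suc i then [relabel i a] else [])"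
  by (simp add: isub_def)

lemma walk_end_isub: "walk_end (isub i w) = iwalk i w"
proof (induction w rule: rev_induct)
  case (snoc a w)
  obtain k s where a: "a = (k, s)" by force
  show ?case using snoc
    by (cases s) (auto simp: a walk_end_def iwalk_snoc wstep_def istep_def Let_def relabel_def)
qed (simp add: walk_end_def iwalk_def)

lemma wx_0: "i \<notin> fst ` set w \<Longrightarrow> wx i w = 0"
  by (induction w rule: rev_induct) (auto simp: wx_snoc)

lemma wy_0: "Suc i \<notin> fst ` set w \<Longrightarrow> wy i w = 0"
  by (induction w rule: rev_induct) (auto simp: wy_snoc)

text \<open>The first relevant letter leaves the origin, and a west or south step starts off both
  axes, so one coordinate stays positive: the walk never comes back to the origin.\<close>

lemma wxy_pos_cnt: "cnt i w + cnt (Suc i) w > 0 \<Longrightarrow> wx i w + wy i w > 0"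
proof (induction w rule: rev_induct)
  case (snoc a w)
  obtain k s where a: "a = (k, s)" by force
  show ?case using snoc by (cases s; cases "k = i"; cases "k = Suc i") (auto simp: wx_snoc wy_snoc a)
qed simp

lemma wxy_pos: "i \<in> fst ` set w \<or> Suc i \<in> fst ` set w \<Longrightarrow> wx i w + wy i w > 0"
  using wxy_pos_cnt[of i w] cnt_0[of i w] cnt_0[of "Suc i" w] by linarith

text \<open>Representatives differ only at the first letter of a kind. Before the first letter of
  kind i one has x = 0, before the first of kind i+1 one has y = 0, and on an axis the primed and
  the unprimed letter take the same step.\<close>

lemma eqv_iwalk: "v \<sim> w \<Longrightarrow> iwalk i v = iwalk i w"
proof (induction w arbitrary: v rule: rev_induct)
  case (snoc a w)
  from snoc.prems obtain v0 b where v: "v = v0 @ [b]" "v0 \<sim> w" "nrm v0 b = nrm w a"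
    by (rule eqv_snocE)
  have IH: "iwalk i v0 = iwalk i w" using snoc.IH v by blast
  have nb: "nrm w b = nrm w a" using v eqv_nrm by metis
  show ?case
  proof (cases "fst a \<in> fst ` set w")
    case True
    then have "a = b" using nb by (cases a; cases b) (auto simp: nrm_def)
    then show ?thesis using IH v by (simp add: iwalk_snoc)
  next
    case False
    have f: "fst a = fst b" using nb by (metis fst_nrm)
    have "fst a = i \<Longrightarrow> wx i w = 0" "fst a = Suc i \<Longrightarrow> wy i w = 0"
      using wx_0[of i w] wy_0[of i w] False by metis+
    then have "istep i (iwalk i w) a = istep i (iwalk i w) b" 
      using f by (cases "fst a = i"; cases "fst a = Suc i") (auto simp: istep_def wx_def wy_def Let_def prod_eq_iff)
    then show ?thesis using IH v by (simp add: iwalk_snoc)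
  qed
qed simp

lemma eqv_wx: "v \<sim> w \<Longrightarrow> wx i v = wx i w"
  and eqv_wy: "v \<sim> w \<Longrightarrow> wy i v = wy i w"
  using eqv_iwalk[of v w i] by (simp_all add: wx_def wy_def)

inductive Fp_rel :: "nat \<Rightarrow> word \<Rightarrow> word \<Rightarrow> bool" for i where
  base: "Fp_rel i (p @ [(i, False)]) (p @ [(Suc i, True)])"
| step: "Fp_rel i w w' \<Longrightarrow> a \<noteq> (i, False) \<Longrightarrow> a \<noteq> (Suc i, True) \<Longrightarrow> Fp_rel i (w @ [a]) (w' @ [a])"

text \<open>The rules type1 and type2 cover 1F and 2F: at y = 0 (at x = 1) the letters changed by F' and by the
  critical substring coincide. The rules type3 and type4 are 3F and 4F.\<close>

inductive F_rel :: "nat \<Rightarrow> word \<Rightarrow> word \<Rightarrow> bool" for i where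
  type1: "Fp_rel i w w' \<Longrightarrow> wy i w = 0 \<Longrightarrow> F_rel i (w @ [(Suc i, True)]) (w' @ [(Suc i, False)])"
| type2: "Fp_rel i w w' \<Longrightarrow> wx i w = 1 \<Longrightarrow> F_rel i (w @ [(i, True)]) (w' @ [(i, False)])"
| type3: "wy i p = 0 \<Longrightarrow> F_rel i (p @ [(i, False)]) (p @ [(Suc i, False)])"
| type4: "wx i p = 0 \<Longrightarrow> F_rel i (p @ [(i, True)]) (p @ [(Suc i, True)])"
| step: "F_rel i w w' \<Longrightarrow> wx i w \<ge> 2 \<and> wy i w \<ge> 1 \<or> a \<noteq> (i, False) \<and> a \<noteq> (Suc i, True)
      \<Longrightarrow> F_rel i (w @ [a]) (w' @ [a])"

lemma eqv_cnt: "v \<sim> w \<Longrightarrow> cnt k v = cnt k w"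
proof -
  have "cnt k u = length (filter (\<lambda>a. a = k) (map fst u))" for u
    by (simp add: cnt_def filter_map o_def)
  then show "v \<sim> w \<Longrightarrow> cnt k v = cnt k w" using eqv_fst by metis
qed

text \<open>The replacement turns south into west, or east into north on an axis: a shift by (-1,
  +1) either way. The neutral letters i' and i+1 move the same way everywhere and transport the
  shift.\<close>

lemma Fp_rel_wxy: "Fp_rel i w w' \<Longrightarrow> wx i w = wx i w' + 1 \<and> wy i w' = wy i w + 1"
  by (induction rule: Fp_rel.induct) (auto simp: wx_snoc wy_snoc)

text \<open>Before the last letter the two points are (x, 0) and (x-1, 1) in \<open>type1\<close>,
  and (1, y) and (0, y+1) in \<open>type2\<close>; the two different last letters preserve the
  shift. In \<open>step\<close> both points are off the axes or the letter is neutral, so the steps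
  are parallel.\<close>

lemma F_rel_wxy: "F_rel i w w' \<Longrightarrow> wx i w = wx i w' + 1 \<and> wy i w' = wy i w + 1"
proof (induction rule: F_rel.induct)
  case (type1 w w') then show ?case using Fp_rel_wxy[OF type1(1)] by (auto simp: wx_snoc wy_snoc)
next
  case (type2 w w') then show ?case using Fp_rel_wxy[OF type2(1)] by (auto simp: wx_snoc wy_snoc)
qed (auto simp: wx_snoc wy_snoc)

lemma Fp_rel_cnt: "Fp_rel i w w' \<Longrightarrow> cnt i w = Suc (cnt i w') \<and> cnt (Suc i) w' = Suc (cnt (Suc i) w)
    \<and> (\<forall>k. k \<noteq> i \<longrightarrow> k \<noteq> Suc i \<longrightarrow> cnt k w = cnt k w')"
  by (induction rule: Fp_rel.induct) auto

lemma F_rel_cnt: "F_rel i w w' \<Longrightarrow> cnt i w = Suc (cnt i w') \<and> cnt (Suc i) w' = Suc (cnt (Suc i) w)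
    \<and> (\<forall>k. k \<noteq> i \<longrightarrow> k \<noteq> Suc i \<longrightarrow> cnt k w = cnt k w')"
proof (induction rule: F_rel.induct)
  case (type1 w w') then show ?case using Fp_rel_cnt[OF type1(1)] by auto
next
  case (type2 w w') then show ?case using Fp_rel_cnt[OF type2(1)] by auto
qed auto

lemma Fp_rel_length: "Fp_rel i w w' \<Longrightarrow> length w = length w'"
  by (induction rule: Fp_rel.induct) auto

section \<open>Letter-by-letter evaluation of F and F'\<close>

lemma nrm_False [simp]: "nrm w (k, False) = (k, False)"
  by (simp add: nrm_def)

lemma nrm_first: "k \<notin> fst ` set w \<Longrightarrow> nrm w (k, s) = (k, False)"
  by (simp add: nrm_def)

lemma nrm_nonfirst: "fst a \<in> fst ` set w \<Longrightarrow> nrm w a = a"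
  by (simp add: nrm_def)

lemma nrm_True: "nrm w a = (k, True) \<Longrightarrow> a = (k, True) \<and> k \<in> fst ` set w"
  by (cases a) (auto simp: nrm_def)

text \<open>The state consists of the word read so far and of representatives of its images under F' and F.\<close>

definition FFp_fun_step :: "nat \<Rightarrow> word \<times> word option \<times> word option \<Rightarrow> letter \<Rightarrow> word \<times> word option \<times> word option" where
  "FFp_fun_step i s a = (let w = fst s; h = fst (snd s); g = snd (snd s); b = nrm w a in
    (w @ [a],
     if b = (i, False) then Some (w @ [(Suc i, True)])
     else if b = (Suc i, True) then None else map_option (\<lambda>v. v @ [b]) h,
     if b = (i, False) then
       (if wy i w = 0 then Some (w @ [(Suc i, False)])
        else if wx i w = 0 \<and> i \<notin> fst ` set w then Some (w @ [(Suc i, True)])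
        else if wx i w \<ge> 2 then map_option (\<lambda>v. v @ [b]) g else None)
     else if b = (i, True) then
       (if wx i w = 0 then Some (w @ [(Suc i, True)])
        else if g \<noteq> None then map_option (\<lambda>v. v @ [b]) g
        else if wx i w = 1 then map_option (\<lambda>v. v @ [(i, False)]) h else None)
     else if b = (Suc i, True) then
       (if wy i w = 0 then map_option (\<lambda>v. v @ [(Suc i, False)]) h
        else if wx i w \<ge> 2 then map_option (\<lambda>v. v @ [b]) g else None)
     else map_option (\<lambda>v. v @ [b]) g))"

definition FFp_fun :: "nat \<Rightarrow> word \<Rightarrow> word \<times> word option \<times> word option" where
  "FFp_fun i w = foldl (FFp_fun_step i) ([], None, None) w"

definition Fp_fun :: "nat \<Rightarrow> word \<Rightarrow> word option" where "Fp_fun i w = fst (snd (FFp_fun i w))"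
definition F_fun :: "nat \<Rightarrow> word \<Rightarrow> word option" where "F_fun i w = snd (snd (FFp_fun i w))"

lemma Fp_fun_Nil [simp]: "Fp_fun i [] = None" and gf_Nil [simp]: "F_fun i [] = None"
  by (simp_all add: Fp_fun_def F_fun_def FFp_fun_def)

lemma FFp_fun_word: "fst (FFp_fun i w) = w"
  by (induction w rule: rev_induct) (auto simp: FFp_fun_def FFp_fun_step_def Let_def)

lemma Fp_fun_snoc: "Fp_fun i (w @ [a]) =
    (if nrm w a = (i, False) then Some (w @ [(Suc i, True)])
     else if nrm w a = (Suc i, True) then None else map_option (\<lambda>v. v @ [nrm w a]) (Fp_fun i w))"
proof -
  have "FFp_fun i (w @ [a]) = FFp_fun_step i (FFp_fun i w) a" by (simp add: FFp_fun_def)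
  then show ?thesis unfolding Fp_fun_def FFp_fun_step_def Let_def FFp_fun_word by simp
qed

text \<open>The tests resolve the overlaps of the rules. A first i (kind i absent from
  \<open>w\<close>) can also be read as i', which is type 4F. For i' the image carried along from
  \<open>w\<close> takes precedence over type 2F. A first (i+1)' is normalised to i+1 and falls
  under the last branch instead of 1F. That these choices lose nothing is the content of
  \<open>F_rel_F_fun\<close>.\<close>

lemma F_fun_snoc: "F_fun i (w @ [a]) =
    (if nrm w a = (i, False) then
       (if wy i w = 0 then Some (w @ [(Suc i, False)])
        else if wx i w = 0 \<and> i \<notin> fst ` set w then Some (w @ [(Suc i, True)])
        else if wx i w \<ge> 2 then map_option (\<lambda>v. v @ [nrm w a]) (F_fun i w) else None)
     else if nrm w a = (i, True) then
       (if wx i w = 0 then Some (w @ [(Suc i, True)])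
        else if F_fun i w \<noteq> None then map_option (\<lambda>v. v @ [nrm w a]) (F_fun i w)
        else if wx i w = 1 then map_option (\<lambda>v. v @ [(i, False)]) (Fp_fun i w) else None)
     else if nrm w a = (Suc i, True) then
       (if wy i w = 0 then map_option (\<lambda>v. v @ [(Suc i, False)]) (Fp_fun i w)
        else if wx i w \<ge> 2 then map_option (\<lambda>v. v @ [nrm w a]) (F_fun i w) else None)
     else map_option (\<lambda>v. v @ [nrm w a]) (F_fun i w))"
proof -
  have "FFp_fun i (w @ [a]) = FFp_fun_step i (FFp_fun i w) a" by (simp add: FFp_fun_def)
  then show ?thesis unfolding F_fun_def Fp_fun_def FFp_fun_step_def Let_def FFp_fun_word by simp
qed

lemma eqv_snoc_eq: "v \<sim> w \<Longrightarrow> (v @ [a]) \<sim> (w @ [a])"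
  by (rule eqv_append)

lemma Fp_fun_Fp_rel: "Fp_fun i w = Some h \<Longrightarrow> \<exists>v v'. v \<sim> w \<and> v' \<sim> h \<and> Fp_rel i v v'"
proof (induction w arbitrary: h rule: rev_induct)
  case (snoc a w)
  show ?case
  proof (cases "nrm w a = (i, False)")
    case True
    then have "(w @ [(i, False)]) \<sim> (w @ [a])" by simp
    moreover have "h = w @ [(Suc i, True)]" using snoc.prems True by (simp add: Fp_fun_snoc)
    ultimately show ?thesis using Fp_rel.base by blast
  next
    case False
    then have n: "nrm w a \<noteq> (Suc i, True)" and ex: "\<exists>h0. Fp_fun i w = Some h0 \<and> h = h0 @ [nrm w a]"
      using snoc.prems by (auto simp: Fp_fun_snoc split: if_splits)
    then obtain h0 where h: "Fp_fun i w = Some h0" "h = h0 @ [nrm w a]" by blast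
    from snoc.IH[OF h(1)] obtain v v' where v: "v \<sim> w" "v' \<sim> h0" "Fp_rel i v v'" by blast
    have "Fp_rel i (v @ [nrm w a]) (v' @ [nrm w a])" using v(3) False n by (rule Fp_rel.step)
    moreover have "(v @ [nrm w a]) \<sim> (w @ [a])" using v(1) eqv_nrm[OF v(1)] by simp
    moreover have "(v' @ [nrm w a]) \<sim> h" unfolding h(2) using v(2) by (rule eqv_snoc_eq)
    ultimately show ?thesis by blast
  qed
qed simp

text \<open>Some i has been changed in \<open>w\<close>, so kind i occurs there and a following i'
  keeps its prime; hence normalisation cannot turn a neutral letter into an i.\<close>

lemma Fp_rel_neutral_nrm:
  assumes "Fp_rel i w w'" "a \<noteq> (i, False)" "a \<noteq> (Suc i, True)"
  shows "nrm w a \<noteq> (i, False)" "nrm w a \<noteq> (Suc i, True)" "nrm w' (nrm w a) = nrm w' a"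
proof -
  note c = Fp_rel_cnt[OF assms(1)]
  have ci: "i \<in> fst ` set w" using c cnt_0[of i w] by auto
  show "nrm w a \<noteq> (i, False)" using assms(2) ci by (cases a) (auto simp: nrm_def)
  show "nrm w a \<noteq> (Suc i, True)" using assms(3) by (cases a) (auto simp: nrm_def)
  show "nrm w' (nrm w a) = nrm w' a"
  proof (cases "fst a = i \<or> fst a = Suc i")
    case True
    then show ?thesis using ci assms by (cases a; cases "snd a") (auto simp: nrm_def)
  next
    case False
    then have "cnt (fst a) w = cnt (fst a) w'" using c by auto
    then have "fst a \<in> fst ` set w \<longleftrightarrow> fst a \<in> fst ` set w'" using cnt_0 by metis
    then show ?thesis by (auto simp: nrm_def)
  qed
qed

lemma Fp_rel_Fp_fun: "Fp_rel i v v' \<Longrightarrow> \<exists>h. Fp_fun i v = Some h \<and> h \<sim> v'"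
proof (induction rule: Fp_rel.induct)
  case (base p) then show ?case by (simp add: Fp_fun_snoc)
next
  case (step w w' a)
  then obtain h where h: "Fp_fun i w = Some h" "h \<sim> w'" by blast
  have "Fp_fun i (w @ [a]) = Some (h @ [nrm w a])"
    using Fp_rel_neutral_nrm[OF step(1-3)] h by (simp add: Fp_fun_snoc)
  moreover have "(h @ [nrm w a]) \<sim> (w' @ [a])"
    using h Fp_rel_neutral_nrm(3)[OF step(1-3)] eqv_nrm[OF h(2)] by simp
  ultimately show ?case by blast
qed

lemma Fp_fun_cong:
  assumes "v \<sim> w" shows "map_option canon (Fp_fun i v) = map_option canon (Fp_fun i w)"
  using assms
proof (induction w arbitrary: v rule: rev_induct)
  case (snoc a w)
  from snoc.prems obtain v0 b where v: "v = v0 @ [b]" "v0 \<sim> w" "nrm v0 b = nrm w a"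
    by (rule eqv_snocE)
  have IH: "map_option canon (Fp_fun i v0) = map_option canon (Fp_fun i w)" using snoc.IH v by blast
  show ?case
    unfolding v(1) Fp_fun_snoc v(3) using IH v(2) eqv_nrm[OF v(2)]
    by (cases "Fp_fun i v0"; cases "Fp_fun i w") (auto dest: eqv_nrm)
qed simp

lemma F_fun_cong:
  assumes "v \<sim> w" shows "map_option canon (F_fun i v) = map_option canon (F_fun i w)"
  using assms
proof (induction w arbitrary: v rule: rev_induct)
  case (snoc a w)
  from snoc.prems obtain v0 b where v: "v = v0 @ [b]" "v0 \<sim> w" "nrm v0 b = nrm w a"
    by (rule eqv_snocE)
  have IH: "map_option canon (F_fun i v0) = map_option canon (F_fun i w)" using snoc.IH v by blast
  have h: "map_option canon (Fp_fun i v0) = map_option canon (Fp_fun i w)" using Fp_fun_cong v by blast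
  have e: "wx i v0 = wx i w" "wy i v0 = wy i w" "fst ` set v0 = fst ` set w"
    using v(2) eqv_wx eqv_wy eqv_fst_set by blast+
  have sn: "map_option canon (map_option (\<lambda>v. v @ [c]) o1) = map_option canon (map_option (\<lambda>v. v @ [c]) o2)"
    if "map_option canon o1 = map_option canon o2" for c o1 o2
    using that by (cases o1; cases o2) (auto dest: eqv_nrm)
  have c: "map_option canon (Some (v0 @ [c])) = map_option canon (Some (w @ [c]))" for c
    using eqv_nrm[OF v(2)] v(2) by simp
  have g: "F_fun i v0 \<noteq> None \<longleftrightarrow> F_fun i w \<noteq> None" using IH by (metis option.map_disc_iff)
  show ?case
    unfolding v(1) F_fun_snoc v(3) e g using sn[OF IH] sn[OF h] c by (auto simp del: option.map_sel)
qed simp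

lemma Fp_fun_facts:
  assumes "Fp_fun i w = Some h"
  shows "wx i w = wx i h + 1" "wy i h = wy i w + 1" "cnt i w = Suc (cnt i h)" "cnt (Suc i) h = Suc (cnt (Suc i) w)"
    "k \<noteq> i \<Longrightarrow> k \<noteq> Suc i \<Longrightarrow> cnt k w = cnt k h"
proof -
  obtain v v' where v: "v \<sim> w" "v' \<sim> h" "Fp_rel i v v'" using Fp_fun_Fp_rel[OF assms] by blast
  note e = eqv_wx[OF v(1)] eqv_wx[OF v(2)] eqv_wy[OF v(1)] eqv_wy[OF v(2)] eqv_cnt[OF v(1)] eqv_cnt[OF v(2)]
  show "wx i w = wx i h + 1" "wy i h = wy i w + 1" "cnt i w = Suc (cnt i h)" "cnt (Suc i) h = Suc (cnt (Suc i) w)"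
    "k \<noteq> i \<Longrightarrow> k \<noteq> Suc i \<Longrightarrow> cnt k w = cnt k h"
    using Fp_rel_wxy[OF v(3)] Fp_rel_cnt[OF v(3)] e by auto
qed

text \<open>Each branch of the recursion is matched with a rule of \<open>F_rel\<close>. The
  representative is built along with the word, since 4F at a first letter needs i' where the normal
  form has i.\<close>

lemma F_fun_F_rel: "F_fun i w = Some g \<Longrightarrow> \<exists>v v'. v \<sim> w \<and> v' \<sim> g \<and> F_rel i v v'"
proof (induction w arbitrary: g rule: rev_induct)
  case (snoc a w)
  let ?b = "nrm w a"
  have wb: "(w @ [?b]) \<sim> (w @ [a])" by simp
  \<comment> \<open>The branches that copy the normalised letter onto the image of \<open>w\<close>
    under F.\<close>
  have stp: ?case if g0: "F_fun i w = Some g0" "g = g0 @ [?b]"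
    and c: "wx i w \<ge> 2 \<and> wy i w \<ge> 1 \<or> ?b \<noteq> (i, False) \<and> ?b \<noteq> (Suc i, True)" for g0
  proof -
    from snoc.IH[OF g0(1)] obtain v v' where v: "v \<sim> w" "v' \<sim> g0" "F_rel i v v'" by blast
    have "F_rel i (v @ [?b]) (v' @ [?b])" using v(3) c eqv_wx[OF v(1)] eqv_wy[OF v(1)] by (auto intro: F_rel.step)
    moreover have "(v @ [?b]) \<sim> (w @ [a])" using eqv_snoc_eq[OF v(1)] wb by metis
    moreover have "(v' @ [?b]) \<sim> g" unfolding g0(2) using v(2) by (rule eqv_snoc_eq)
    ultimately show ?thesis by blast
  qed
  \<comment> \<open>The branches that close a critical substring of type 1F or 2F: a new last letter
    is put after the image of \<open>w\<close> under F'.\<close>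
  have hstp: ?case if h: "Fp_fun i w = Some h" "g = h @ [c']" "(w @ [c]) \<sim> (w @ [a])"
    "\<And>v v'. Fp_rel i v v' \<Longrightarrow> v \<sim> w \<Longrightarrow> F_rel i (v @ [c]) (v' @ [c'])" for h c c'
  proof -
    from Fp_fun_Fp_rel[OF h(1)] obtain v v' where v: "v \<sim> w" "v' \<sim> h" "Fp_rel i v v'" by blast
    have "F_rel i (v @ [c]) (v' @ [c'])" using h(4) v by blast
    moreover have "(v @ [c]) \<sim> (w @ [a])" using eqv_snoc_eq[OF v(1)] h(3) by metis
    moreover have "(v' @ [c']) \<sim> g" unfolding h(2) using v(2) by (rule eqv_snoc_eq)
    ultimately show ?thesis by blast
  qed
  consider "?b = (i, False)" | "?b = (i, True)" | "?b = (Suc i, True)"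
    | "?b \<noteq> (i, False)" "?b \<noteq> (i, True)" "?b \<noteq> (Suc i, True)" by blast
  then show ?case
  proof cases
    case 1
    consider "wy i w = 0" | "wy i w \<noteq> 0" "wx i w = 0" "i \<notin> fst ` set w" | "wy i w \<noteq> 0" "wx i w \<ge> 2"
      using snoc.prems 1 by (auto simp: F_fun_snoc split: if_splits)
    then show ?thesis
    proof cases
      case 1
      with snoc.prems \<open>?b = (i, False)\<close> have "g = w @ [(Suc i, False)]" by (simp add: F_fun_snoc)
      then show ?thesis using F_rel.type3[OF 1] wb \<open>?b = (i, False)\<close> by metis
    next
      case 2
      with snoc.prems \<open>?b = (i, False)\<close> have "g = w @ [(Suc i, True)]" by (simp add: F_fun_snoc)
      moreover have "(w @ [(i, True)]) \<sim> (w @ [a])"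
        using 2 \<open>?b = (i, False)\<close> by (simp add: nrm_first)
      ultimately show ?thesis using F_rel.type4[OF 2(2)] by metis
    next
      case 3
      then show ?thesis using snoc.prems 1 stp by (auto simp: F_fun_snoc)
    qed
  next
    case 2
    show ?thesis
    proof (cases "wx i w = 0")
      case True
      with snoc.prems 2 have "g = w @ [(Suc i, True)]" by (simp add: F_fun_snoc)
      then show ?thesis using F_rel.type4[OF True] wb 2 by metis
    next
      case False
      show ?thesis
      proof (cases "F_fun i w")
        case None
        then have x: "wx i w = 1" and h: "\<exists>h. Fp_fun i w = Some h \<and> g = h @ [(i, False)]"
          using snoc.prems 2 False by (auto simp: F_fun_snoc split: if_splits)
        then obtain h where "Fp_fun i w = Some h" "g = h @ [(i, False)]" by blast
        then show ?thesis
        proof (rule hstp[of h "(i, False)" "(i, True)"])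
          show "(w @ [(i, True)]) \<sim> (w @ [a])" using wb 2 by simp
          show "F_rel i (v @ [(i, True)]) (v' @ [(i, False)])" if "Fp_rel i v v'" "v \<sim> w" for v v'
            using F_rel.type2[OF that(1)] eqv_wx[OF that(2)] x by simp
        qed
      next
        case (Some g0)
        then show ?thesis using snoc.prems 2 False stp[of g0] by (simp add: F_fun_snoc)
      qed
    qed
  next
    case 3
    show ?thesis
    proof (cases "wy i w = 0")
      case True
      then have h: "\<exists>h. Fp_fun i w = Some h \<and> g = h @ [(Suc i, False)]"
        using snoc.prems 3 by (auto simp: F_fun_snoc split: if_splits)
      then obtain h where "Fp_fun i w = Some h" "g = h @ [(Suc i, False)]" by blast
      then show ?thesis
      proof (rule hstp[of h "(Suc i, False)" "(Suc i, True)"])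
        show "(w @ [(Suc i, True)]) \<sim> (w @ [a])" using wb 3 by simp
        show "F_rel i (v @ [(Suc i, True)]) (v' @ [(Suc i, False)])" if "Fp_rel i v v'" "v \<sim> w" for v v'
          using F_rel.type1[OF that(1)] eqv_wy[OF that(2)] True by simp
      qed
    next
      case False
      then show ?thesis using snoc.prems 3 stp by (auto simp: F_fun_snoc split: if_splits)
    qed
  next
    case 4
    then show ?thesis using snoc.prems stp by (auto simp: F_fun_snoc)
  qed
qed simp

lemma F_fun_facts:
  assumes "F_fun i w = Some h"
  shows "wx i w = wx i h + 1" "wy i h = wy i w + 1" "cnt i w = Suc (cnt i h)" "cnt (Suc i) h = Suc (cnt (Suc i) w)"
    "k \<noteq> i \<Longrightarrow> k \<noteq> Suc i \<Longrightarrow> cnt k w = cnt k h"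
proof -
  obtain v v' where v: "v \<sim> w" "v' \<sim> h" "F_rel i v v'" using F_fun_F_rel[OF assms] by blast
  note e = eqv_wx[OF v(1)] eqv_wx[OF v(2)] eqv_wy[OF v(1)] eqv_wy[OF v(2)] eqv_cnt[OF v(1)] eqv_cnt[OF v(2)]
  show "wx i w = wx i h + 1" "wy i h = wy i w + 1" "cnt i w = Suc (cnt i h)" "cnt (Suc i) h = Suc (cnt (Suc i) w)"
    "k \<noteq> i \<Longrightarrow> k \<noteq> Suc i \<Longrightarrow> cnt k w = cnt k h"
    using F_rel_wxy[OF v(3)] F_rel_cnt[OF v(3)] e by auto
qed

lemma nrm_split:
  obtains "nrm w a = (i, False)" | "nrm w a = (i, True)" "a = (i, True)" "i \<in> fst ` set w"
    | "nrm w a = (Suc i, False)" | "nrm w a = (Suc i, True)" "a = (Suc i, True)" "Suc i \<in> fst ` set w"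
    | "fst (nrm w a) \<noteq> i" "fst (nrm w a) \<noteq> Suc i" "\<And>s. nrm w a \<noteq> (i, s)" "\<And>s. nrm w a \<noteq> (Suc i, s)"
proof (cases "fst (nrm w a) = i \<or> fst (nrm w a) = Suc i")
  case True
  then show thesis using that(1-4) nrm_True[of w a i] nrm_True[of w a "Suc i"]
    by (metis prod.collapse)
next
  case False
  then show thesis using that(5) by (metis fst_conv)
qed

text \<open>Without kind i+1 the walk runs along y = 0. There F changes the last i into i+1 by 3F
  and F' changes it into (i+1)'; the results are equivalent because this is the first letter of kind
  i+1.\<close>

lemma F_fun_Fp_fun_no_Suc:
  assumes "Fp_fun i w = Some h" "Suc i \<notin> fst ` set w"
  shows "\<exists>g. F_fun i w = Some g \<and> g \<sim> h"
  using assms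
proof (induction w arbitrary: h rule: rev_induct)
  case (snoc a w)
  have ns: "Suc i \<notin> fst ` set w" "fst a \<noteq> Suc i" using snoc.prems by auto
  have y: "wy i w = 0" using ns by (simp add: wy_0)
  show ?case
  proof (cases w a i rule: nrm_split)
    case 1
    then show ?thesis using snoc.prems y ns by (auto simp: Fp_fun_snoc F_fun_snoc nrm_first)
  next
    case 2
    then have x: "wx i w > 0" using wxy_pos[of i w] y by simp
    obtain h0 where h0: "Fp_fun i w = Some h0" "h = h0 @ [nrm w a]" using snoc.prems 2 by (auto simp: Fp_fun_snoc)
    with snoc.IH ns obtain g where "F_fun i w = Some g" "g \<sim> h0" by blast
    then show ?thesis using 2 x h0 eqv_snoc_eq[of g h0] by (auto simp: F_fun_snoc)
  next
    case 3 then show ?thesis using ns by (metis fst_conv fst_nrm)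
  next
    case 4 then show ?thesis using ns by simp
  next
    case 5
    obtain h0 where h0: "Fp_fun i w = Some h0" "h = h0 @ [nrm w a]" using snoc.prems 5 by (auto simp: Fp_fun_snoc split: if_splits)
    with snoc.IH ns obtain g where "F_fun i w = Some g" "g \<sim> h0" by blast
    then show ?thesis using 5 h0 eqv_snoc_eq[of g h0] by (auto simp: F_fun_snoc)
  qed
qed simp

text \<open>The single letter of kind i is read at x = 0, so it may be taken as i' and changed to
  (i+1)' by 4F, as F' does; if also y = 0, the i+1 produced by 3F is equivalent to it. Since F' is
  defined, no (i+1)' survives normalisation afterwards, and the later letters are copied by
  both.\<close>

lemma F_fun_Fp_fun_one:
  assumes "Fp_fun i w = Some h" "cnt i w = 1"
  shows "\<exists>g. F_fun i w = Some g \<and> g \<sim> h"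
  using assms
proof (induction w arbitrary: h rule: rev_induct)
  case (snoc a w)
  show ?case
  proof (cases w a i rule: nrm_split)
    case 1
    then have "fst a = i" by (metis fst_conv fst_nrm)
    then have n: "i \<notin> fst ` set w" using snoc.prems cnt_0[of i w] by simp
    then have x: "wx i w = 0" by (rule wx_0)
    have "Suc i \<notin> fst ` set w" if "wy i w = 0" using that x wxy_pos[of i w] by auto
    then show ?thesis using snoc.prems x n 1 by (auto simp: Fp_fun_snoc F_fun_snoc nrm_first)
  next
    case 2
    then show ?thesis using snoc.prems cnt_0[of i w] by simp
  next
    case 3
    then have "fst a = Suc i" by (metis fst_conv fst_nrm)
    then have c: "cnt i w = 1" using snoc.prems by simp
    obtain h0 where h0: "Fp_fun i w = Some h0" "h = h0 @ [nrm w a]" using snoc.prems 3 by (auto simp: Fp_fun_snoc)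
    with snoc.IH c obtain g where "F_fun i w = Some g" "g \<sim> h0" by blast
    then show ?thesis using 3 h0 eqv_snoc_eq[of g h0] by (auto simp: F_fun_snoc)
  next
    case 4 then show ?thesis using snoc.prems by (simp add: Fp_fun_snoc)
  next
    case 5
    then have c: "cnt i w = 1" using snoc.prems by simp
    obtain h0 where h0: "Fp_fun i w = Some h0" "h = h0 @ [nrm w a]" using snoc.prems 5 by (auto simp: Fp_fun_snoc split: if_splits)
    with snoc.IH c obtain g where "F_fun i w = Some g" "g \<sim> h0" by blast
    then show ?thesis using 5 h0 eqv_snoc_eq[of g h0] by (auto simp: F_fun_snoc)
  qed
qed simp

text \<open>A further i' at the end gives x >= 2, because F' on the prefix already forces x >= 1.
  For a further i at the end F requires y = 0, where the step goes east to x >= 2, or x >= 2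
  beforehand. So at x = 1 copying and 2F can compete only for a single letter of kind i.\<close>

lemma one_if_wx_one:
  assumes "Fp_fun i w = Some h" "F_fun i w = Some g" "wx i w = 1"
  shows "cnt i w = 1"
  using assms
proof (induction w arbitrary: h g rule: rev_induct)
  case (snoc a w)
  show ?case
  proof (cases w a i rule: nrm_split)
    case 1
    then have fa: "fst a = i" by (metis fst_conv fst_nrm)
    show ?thesis
    proof (cases "i \<in> fst ` set w")
      case False then show ?thesis using fa cnt_0[of i w] by simp
    next
      case True
      then have "a = (i, False)" using 1 by (simp add: nrm_nonfirst fa)
      then show ?thesis using snoc.prems True wxy_pos[of i w] 1 by (auto simp: F_fun_snoc wx_snoc split: if_splits)
    qed
  next
    case 2
    then obtain h0 where "Fp_fun i w = Some h0" using snoc.prems by (auto simp: Fp_fun_snoc)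
    then show ?thesis using Fp_fun_facts(1)[of i w h0] snoc.prems 2 by (auto simp: wx_snoc)
  next
    case 3
    then have "fst a = Suc i" by (metis fst_conv fst_nrm)
    moreover obtain h0 g0 where "Fp_fun i w = Some h0" "F_fun i w = Some g0" using snoc.prems 3 by (auto simp: Fp_fun_snoc F_fun_snoc)
    moreover have "wx i w = 1"
      using eqv_wx[of "w @ [a]" "w @ [(Suc i, False)]" i] 3 snoc.prems by (simp add: wx_snoc)
    ultimately show ?thesis using snoc.IH by simp
  next
    case 4 then show ?thesis using snoc.prems by (simp add: Fp_fun_snoc)
  next
    case 5
    then have "fst a \<noteq> i" "fst a \<noteq> Suc i" by auto
    moreover obtain h0 g0 where "Fp_fun i w = Some h0" "F_fun i w = Some g0"
      using snoc.prems 5 by (auto simp: Fp_fun_snoc F_fun_snoc split: if_splits)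
    moreover have "wx i w = 1" using snoc.prems calculation by (auto simp: wx_snoc split: if_splits)
    ultimately show ?thesis using snoc.IH by simp
  qed
qed simp

text \<open>A rule may hold for a representative other than the normal one, and then the recursion
  takes a different branch. In these cases the prefix has no letter of kind i+1 or a single letter
  of kind i, and both branches give equivalent words.\<close>

lemma F_rel_F_fun: "F_rel i v v' \<Longrightarrow> \<exists>g. F_fun i v = Some g \<and> g \<sim> v'"
proof (induction rule: F_rel.induct)
  case (type1 w w')
  obtain h where h: "Fp_fun i w = Some h" "h \<sim> w'" using Fp_rel_Fp_fun[OF type1(1)] by blast
  show ?case
  proof (cases "Suc i \<in> fst ` set w")
    case True
    then show ?thesis using h type1 eqv_snoc_eq[OF h(2)] by (simp add: F_fun_snoc nrm_nonfirst)
  next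
    case False
    then obtain g where "F_fun i w = Some g" "g \<sim> h" using F_fun_Fp_fun_no_Suc[OF h(1)] by blast
    then show ?thesis using False h by (simp add: F_fun_snoc nrm_first)
  qed
next
  case (type2 w w')
  obtain h where h: "Fp_fun i w = Some h" "h \<sim> w'" using Fp_rel_Fp_fun[OF type2(1)] by blast
  have "i \<in> fst ` set w" using type2 wx_0 by fastforce
  then have n: "nrm w (i, True) = (i, True)" by (simp add: nrm_nonfirst)
  show ?case
  proof (cases "F_fun i w")
    case None
    then show ?thesis using h type2 n by (simp add: F_fun_snoc)
  next
    \<comment> \<open>Copying and 2F compete here. With a single letter of kind i, both images of
      \<open>w\<close> agree and contain no letter of kind i, so i' and i are equivalent after
      them.\<close>
    case (Some g)
    have c: "cnt i w = 1" using one_if_wx_one[OF h(1) Some type2(2)] .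
    then have e: "g \<sim> h" using F_fun_Fp_fun_one[OF h(1) c] Some by auto
    have "cnt i g = 0" using F_fun_facts(3)[OF Some] c by simp
    then have "i \<notin> fst ` set g" using cnt_0 by blast
    then have "(g @ [(i, True)]) \<sim> (w' @ [(i, False)])" using e h by (simp add: nrm_first)
    then show ?thesis using n type2 Some by (simp add: F_fun_snoc)
  qed
next
  case (type3 p) then show ?case by (simp add: F_fun_snoc)
next
  case (type4 p)
  show ?case
  proof (cases "i \<in> fst ` set p")
    case True then show ?thesis using type4 by (simp add: F_fun_snoc nrm_nonfirst)
  next
    case False
    have "Suc i \<notin> fst ` set p" if "wy i p = 0" using that type4 wxy_pos[of i p] by auto
    then show ?thesis using type4 False by (simp add: F_fun_snoc nrm_first)
  qed
next
  case (step w w' a)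
  then obtain g where g: "F_fun i w = Some g" "g \<sim> w'" by blast
  note c = F_fun_facts[OF g(1)] and x = F_fun_facts(1)[OF g(1)]
  have ci: "i \<in> fst ` set w" using c(3) cnt_0[of i w] by auto
  have bcond: "wx i w \<ge> 2 \<and> wy i w \<ge> 1 \<or> nrm w a \<noteq> (i, False) \<and> nrm w a \<noteq> (Suc i, True)"
    using step(2) ci by (cases a) (auto simp: nrm_def)
  have "F_fun i (w @ [a]) = Some (g @ [nrm w a])"
    using bcond g x by (auto simp: F_fun_snoc)
  moreover have "nrm g (nrm w a) = nrm g a"
  proof (cases "fst a = i \<or> fst a = Suc i")
    case True
    have "Suc i \<in> fst ` set w" if "wy i w \<ge> 1" using that wy_0[of i w] by fastforce
    then show ?thesis using True ci step(2) by (cases a; cases "snd a") (auto simp: nrm_def)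
  next
    case False
    then have "cnt (fst a) w = cnt (fst a) g" using c(5) by auto
    then have "fst a \<in> fst ` set w \<longleftrightarrow> fst a \<in> fst ` set g" using cnt_0 by metis
    then show ?thesis by (auto simp: nrm_def)
  qed
  ultimately show ?case using g eqv_nrm[OF g(2)] by simp
qed

section \<open>Commutation and reflection\<close>

lemma wx_cnt: "Suc i \<notin> fst ` set w \<Longrightarrow> wx i w = cnt i w"
proof (induction w rule: rev_induct)
  case (snoc a w)
  then have "wy i w = 0" by (simp add: wy_0)
  then show ?case using snoc by (cases a) (auto simp: wx_snoc)
qed simp

lemma Fp_fun_Fp_fun_wx_one:
  assumes "Fp_fun i w = Some h" "Fp_fun i h = Some h'" "wx i w = 1"
  shows "cnt i h = 0"
  using assms
proof (induction w arbitrary: h h' rule: rev_induct)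
  case (snoc a w)
  show ?case
  proof (cases w a i rule: nrm_split)
    case 1
    then have h: "h = w @ [(Suc i, True)]" using snoc.prems by (simp add: Fp_fun_snoc)
    then have n: "Suc i \<notin> fst ` set w" using snoc.prems(2) by (auto simp: Fp_fun_snoc nrm_def split: if_splits)
    have "wx i (w @ [a]) = cnt i (w @ [(i, False)])"
      using eqv_wx[of "w @ [a]" "w @ [(i, False)]" i] 1 n wx_cnt[of i "w @ [(i, False)]"] by simp
    then show ?thesis using snoc.prems h by simp
  next
    case 2
    then obtain h0 where "Fp_fun i w = Some h0" using snoc.prems by (auto simp: Fp_fun_snoc)
    then show ?thesis using Fp_fun_facts(1)[of i w h0] snoc.prems 2 by (auto simp: wx_snoc)
  next
    case 3
    then have fa: "fst a = Suc i" by (metis fst_conv fst_nrm)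
    obtain h0 where h0: "Fp_fun i w = Some h0" "h = h0 @ [(Suc i, False)]" using snoc.prems 3 by (auto simp: Fp_fun_snoc)
    then obtain h1 where "Fp_fun i h0 = Some h1" using snoc.prems by (auto simp: Fp_fun_snoc)
    moreover have "wx i w = 1"
      using eqv_wx[of "w @ [a]" "w @ [(Suc i, False)]" i] 3 snoc.prems by (simp add: wx_snoc)
    ultimately show ?thesis using snoc.IH h0 by simp
  next
    case 4 then show ?thesis using snoc.prems by (simp add: Fp_fun_snoc)
  next
    case 5
    then have fa: "fst a \<noteq> i" "fst a \<noteq> Suc i" by auto
    obtain h0 where h0: "Fp_fun i w = Some h0" "h = h0 @ [nrm w a]" using snoc.prems 5 by (auto simp: Fp_fun_snoc)
    have nn: "nrm v (nrm w a) \<noteq> (i, s)" "nrm v (nrm w a) \<noteq> (Suc i, s)" for v s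
      using fa by (metis fst_conv fst_nrm)+
    then obtain h1 where "Fp_fun i h0 = Some h1" using snoc.prems h0 by (auto simp: Fp_fun_snoc)
    moreover have "wx i w = 1" using snoc.prems fa by (auto simp: wx_snoc split: if_splits)
    ultimately show ?thesis using snoc.IH h0 fa by simp
  qed
qed simp

text \<open>If the last letter is i, the (i+1)' that replaces it must be the first of kind i+1, or
  F' could not be applied again; then the walk has stayed on y = 0 and x counts the letters of kind
  i. If the last letter is i', then x = 1 before it and the prefix loses its only letter of kind i.
  The lemma excludes a type 2F step in the commutation proof.\<close>

lemma Fp_fun_Fp_fun_wx_two:
  assumes "Fp_fun i w = Some h" "Fp_fun i h = Some h'" "wx i w = 2"
  shows "cnt i h = 1"
  using assms
proof (induction w arbitrary: h h' rule: rev_induct)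
  case (snoc a w)
  show ?case
  proof (cases w a i rule: nrm_split)
    case 1
    then have h: "h = w @ [(Suc i, True)]" using snoc.prems by (simp add: Fp_fun_snoc)
    then have n: "Suc i \<notin> fst ` set w" using snoc.prems(2) by (auto simp: Fp_fun_snoc nrm_def split: if_splits)
    have "wx i (w @ [a]) = cnt i (w @ [(i, False)])"
      using eqv_wx[of "w @ [a]" "w @ [(i, False)]" i] 1 n wx_cnt[of i "w @ [(i, False)]"] by simp
    then show ?thesis using snoc.prems h by simp
  next
    case 2
    then obtain h0 where h0: "Fp_fun i w = Some h0" "h = h0 @ [(i, True)]" using snoc.prems by (auto simp: Fp_fun_snoc)
    have x: "wx i w = 1" using snoc.prems 2 by (simp add: wx_snoc)
    have "cnt i h0 = 0"
    proof (cases "i \<in> fst ` set h0")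
      case True
      then obtain h1 where "Fp_fun i h0 = Some h1" using snoc.prems h0 by (auto simp: Fp_fun_snoc nrm_nonfirst)
      then show ?thesis using Fp_fun_Fp_fun_wx_one h0 x by blast
    qed (simp add: cnt_0)
    then show ?thesis using h0 by simp
  next
    case 3
    then have fa: "fst a = Suc i" by (metis fst_conv fst_nrm)
    obtain h0 where h0: "Fp_fun i w = Some h0" "h = h0 @ [(Suc i, False)]" using snoc.prems 3 by (auto simp: Fp_fun_snoc)
    then obtain h1 where "Fp_fun i h0 = Some h1" using snoc.prems by (auto simp: Fp_fun_snoc)
    moreover have "wx i w = 2"
      using eqv_wx[of "w @ [a]" "w @ [(Suc i, False)]" i] 3 snoc.prems by (simp add: wx_snoc)
    ultimately show ?thesis using snoc.IH h0 by simp
  next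
    case 4 then show ?thesis using snoc.prems by (simp add: Fp_fun_snoc)
  next
    case 5
    then have fa: "fst a \<noteq> i" "fst a \<noteq> Suc i" by auto
    obtain h0 where h0: "Fp_fun i w = Some h0" "h = h0 @ [nrm w a]" using snoc.prems 5 by (auto simp: Fp_fun_snoc)
    have nn: "nrm v (nrm w a) \<noteq> (i, s)" "nrm v (nrm w a) \<noteq> (Suc i, s)" for v s
      using fa by (metis fst_conv fst_nrm)+
    then obtain h1 where "Fp_fun i h0 = Some h1" using snoc.prems h0 by (auto simp: Fp_fun_snoc)
    moreover have "wx i w = 2" using snoc.prems fa by (auto simp: wx_snoc split: if_splits)
    ultimately show ?thesis using snoc.IH h0 fa by simp
  qed
qed simp

lemma cnt_first: "cnt k v = cnt k w \<Longrightarrow> nrm v (k, s) = nrm w (k, s)"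
  using cnt_0[of k v] cnt_0[of k w] by (simp add: nrm_def)

lemma Fp_fun_defined: "i \<in> fst ` set w \<Longrightarrow> Suc i \<notin> fst ` set w \<Longrightarrow> \<exists>h. Fp_fun i w = Some h"
proof (induction w rule: rev_induct)
  case (snoc a w)
  then show ?case by (cases w a i rule: nrm_split) (auto simp: Fp_fun_snoc dest: arg_cong[where f = fst])
qed simp

text \<open>Where F acts by a critical substring, its image is built from F' of the prefix, so the
  square closes at once; otherwise both operators act on the prefix. Only three sides of the square
  are assumed and the fourth is part of the conclusion, so the square can later be entered from
  several corners.\<close>

lemma Fp_fun_F_fun_comm:
  assumes "Fp_fun i w = Some b" "F_fun i w = Some a" "F_fun i b = Some c"
  shows "\<exists>d. Fp_fun i a = Some d \<and> d \<sim> c"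
  using assms
proof (induction w arbitrary: a b c rule: rev_induct)
  case (snoc l w)
  show ?case
  proof (cases w l i rule: nrm_split)
    case 1
    then have b: "b = w @ [(Suc i, True)]" using snoc.prems by (simp add: Fp_fun_snoc)
    show ?thesis
    proof (cases "wy i w = 0")
      case True
      then have a: "a = w @ [(Suc i, False)]" using snoc.prems 1 by (simp add: F_fun_snoc)
      show ?thesis
      proof (cases "Suc i \<in> fst ` set w")
        case True
        \<comment> \<open>F on \<open>b\<close> is of type 1F: it changes \<open>w\<close> by F' and
          appends i+1, as F' on \<open>a\<close> does.\<close>
        then obtain h where "Fp_fun i w = Some h" "c = h @ [(Suc i, False)]"
          using snoc.prems b \<open>wy i w = 0\<close> by (auto simp: F_fun_snoc nrm_nonfirst)
        then show ?thesis using a by (simp add: Fp_fun_snoc)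
      next
        case False
        \<comment> \<open>Now (i+1)' is the first of its kind in \<open>b\<close>, so it is copied
          as i+1; without kind i+1 in \<open>w\<close>, the images of \<open>w\<close> under F and
          F' are equivalent.\<close>
        then obtain g where g: "F_fun i w = Some g" "c = g @ [(Suc i, False)]"
          using snoc.prems b by (auto simp: F_fun_snoc nrm_first)
        then obtain v v' where "v \<sim> w" "F_rel i v v'" using F_fun_F_rel by blast
        then have "cnt i w > 0" using F_rel_cnt eqv_cnt by (metis zero_less_Suc)
        then have "i \<in> fst ` set w" using cnt_0[of i w] by auto
        then obtain h where h: "Fp_fun i w = Some h" using Fp_fun_defined False by blast
        then have "h \<sim> g" using F_fun_Fp_fun_no_Suc[OF h False] g by auto
        then have "(h @ [(Suc i, False)]) \<sim> c" unfolding g(2) by (rule eqv_snoc_eq)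
        then show ?thesis using a h by (simp add: Fp_fun_snoc)
      qed
    next
      case False
      then have n2: "Suc i \<in> fst ` set w" using wy_0[of i w] by metis
      show ?thesis
      proof (cases "wx i w \<ge> 2")
        case True
        then obtain a0 where a0: "F_fun i w = Some a0" "a = a0 @ [(i, False)]"
          using snoc.prems 1 False by (auto simp: F_fun_snoc)
        have "c = a0 @ [(Suc i, True)]"
          using snoc.prems b a0 False True n2 by (simp add: F_fun_snoc nrm_nonfirst)
        then show ?thesis using a0 by (simp add: Fp_fun_snoc)
      next
        case nt: False
        then show ?thesis using snoc.prems 1 b False n2 by (auto simp: F_fun_snoc nrm_nonfirst split: if_splits)
      qed
    qed
  next
    case 2
    then obtain b0 where b0: "Fp_fun i w = Some b0" "b = b0 @ [(i, True)]" using snoc.prems by (auto simp: Fp_fun_snoc)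
    note fb = Fp_fun_facts[OF b0(1)]
    show ?thesis
    proof (cases "F_fun i w")
      case None
      then have x: "wx i w = 1" "a = b0 @ [(i, False)]"
        using snoc.prems 2 b0 fb(1) by (auto simp: F_fun_snoc split: if_splits)
      then have d: "Fp_fun i a = Some (b0 @ [(Suc i, True)])" by (simp add: Fp_fun_snoc)
      \<comment> \<open>F on \<open>w\<close> followed by i' was of type 2F. Here \<open>b0\<close>
        ends at x = 0, so F on \<open>b\<close> is of type 4F and changes its last i' to
        (i+1)'.\<close>
      have "wx i b0 = 0" using fb x by simp
      then have "c = b0 @ [(Suc i, True)]" using snoc.prems b0 fb(2) nrm_cases[of b0 "(i, True)"]
        by (auto simp: F_fun_snoc)
      then show ?thesis using d by simp
    next
      case (Some a0)
      then have a: "a = a0 @ [(i, True)]" using snoc.prems 2 b0 fb(1) by (simp add: F_fun_snoc)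
      note fa = F_fun_facts[OF Some]
      have ab: "cnt i a0 = cnt i b0" using fa fb by simp
      show ?thesis
      proof (cases "cnt i b0 = 0")
        case True
        then have "a0 \<sim> b0" using F_fun_Fp_fun_one[OF b0(1)] fb Some by auto
        moreover have "i \<notin> fst ` set a0" "i \<notin> fst ` set b0" using True ab cnt_0 by metis+
        then have "Fp_fun i a = Some (a0 @ [(Suc i, True)])" "c = b0 @ [(Suc i, True)]"
          using a snoc.prems b0 fb(2) wx_0[of i b0] by (auto simp: Fp_fun_snoc F_fun_snoc nrm_first)
        ultimately show ?thesis using eqv_snoc_eq[of a0 b0] by metis
      next
        case False
        then have i: "i \<in> fst ` set a0" "i \<in> fst ` set b0" using ab cnt_0 by metis+
        have xb: "wx i b0 > 0" using one_if_wx_one[OF b0(1) Some] fb False by (cases "wx i b0") auto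
        show ?thesis
        proof (cases "F_fun i b0")
          case None
          \<comment> \<open>Type 2F on \<open>b\<close> cannot occur: at x = 1 only a single letter
            of kind i would be left in \<open>b0\<close>, and then F on \<open>b0\<close> would be
            defined.\<close>
          then obtain d where d: "wx i b0 = 1" "Fp_fun i b0 = Some d"
            using snoc.prems b0 xb i by (auto simp: F_fun_snoc nrm_nonfirst split: if_splits)
          then have "cnt i b0 = 1" using Fp_fun_Fp_fun_wx_two[OF b0(1)] fb by simp
          then show ?thesis using F_fun_Fp_fun_one d None by force
        next
          case s: (Some c0)
          then have c: "c = c0 @ [(i, True)]" using snoc.prems b0 xb i by (simp add: F_fun_snoc nrm_nonfirst)
          obtain d0 where d: "Fp_fun i a0 = Some d0" "d0 \<sim> c0" using snoc.IH[OF b0(1) Some s] by blast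
          then have "Fp_fun i a = Some (d0 @ [(i, True)])" using a i by (simp add: Fp_fun_snoc nrm_nonfirst)
          then show ?thesis using c d eqv_snoc_eq by blast
        qed
      qed
    qed
  next
    case 3
    then obtain b0 a0 where b0: "Fp_fun i w = Some b0" "b = b0 @ [(Suc i, False)]" "F_fun i w = Some a0" "a = a0 @ [(Suc i, False)]"
      using snoc.prems by (auto simp: Fp_fun_snoc F_fun_snoc)
    then obtain c0 where c0: "F_fun i b0 = Some c0" "c = c0 @ [(Suc i, False)]" using snoc.prems by (auto simp: F_fun_snoc)
    then obtain d0 where d: "Fp_fun i a0 = Some d0" "d0 \<sim> c0" using snoc.IH[OF b0(1,3)] by blast
    then have "Fp_fun i a = Some (d0 @ [(Suc i, False)])" using b0 by (simp add: Fp_fun_snoc)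
    then show ?thesis using c0 d eqv_snoc_eq by blast
  next
    case 4 then show ?thesis using snoc.prems by (simp add: Fp_fun_snoc)
  next
    case 5
    let ?b = "nrm w l"
    obtain b0 a0 where b0: "Fp_fun i w = Some b0" "b = b0 @ [?b]" "F_fun i w = Some a0" "a = a0 @ [?b]"
      using snoc.prems 5 by (auto simp: Fp_fun_snoc F_fun_snoc)
    have k: "fst ?b \<noteq> i" "fst ?b \<noteq> Suc i" using 5 by auto
    have nn: "nrm v ?b \<noteq> (i, s)" "nrm v ?b \<noteq> (Suc i, s)" for v s
      using k by (metis fst_conv fst_nrm)+
    obtain c0 where c0: "F_fun i b0 = Some c0" "c = c0 @ [nrm b0 ?b]" using snoc.prems(3) b0 nn by (auto simp: F_fun_snoc)
    then obtain d0 where d: "Fp_fun i a0 = Some d0" "d0 \<sim> c0" using snoc.IH[OF b0(1,3)] by blast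
    then have h: "Fp_fun i a = Some (d0 @ [nrm a0 ?b])" using b0 nn by (simp add: Fp_fun_snoc)
    have "cnt (fst ?b) a0 = cnt (fst ?b) b0" using Fp_fun_facts(5)[OF b0(1)] F_fun_facts(5)[OF b0(3)] k by metis
    then have "nrm a0 ?b = nrm b0 ?b" using cnt_first[of "fst ?b" a0 b0 "snd ?b"] by (metis prod.collapse)
    then show ?thesis using h c0 d eqv_snoc_eq[of d0 c0] by auto
  qed
qed simp

section \<open>The operators as relations between classes\<close>

definition Fp_cls :: "nat \<Rightarrow> word \<Rightarrow> word \<Rightarrow> bool" where
  "Fp_cls i w c \<longleftrightarrow> (\<exists>v v'. v \<sim> w \<and> v' \<sim> c \<and> Fp_rel i v v')"
definition F_cls :: "nat \<Rightarrow> word \<Rightarrow> word \<Rightarrow> bool" where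
  "F_cls i w c \<longleftrightarrow> (\<exists>v v'. v \<sim> w \<and> v' \<sim> c \<and> F_rel i v v')"

lemma Fp_cls_iff: "Fp_cls i w c \<longleftrightarrow> map_option canon (Fp_fun i w) = Some (canon c)"
proof
  assume "Fp_cls i w c"
  then obtain v v' where v: "v \<sim> w" "v' \<sim> c" "Fp_rel i v v'" by (auto simp: Fp_cls_def)
  then show "map_option canon (Fp_fun i w) = Some (canon c)" using Fp_rel_Fp_fun[OF v(3)] Fp_fun_cong[OF v(1), of i] v(2) by (metis option.map(2))
next
  assume "map_option canon (Fp_fun i w) = Some (canon c)"
  then show "Fp_cls i w c" using Fp_fun_Fp_rel unfolding Fp_cls_def by force
qed

lemma F_cls_iff: "F_cls i w c \<longleftrightarrow> map_option canon (F_fun i w) = Some (canon c)"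
proof
  assume "F_cls i w c"
  then obtain v v' where v: "v \<sim> w" "v' \<sim> c" "F_rel i v v'" by (auto simp: F_cls_def)
  then show "map_option canon (F_fun i w) = Some (canon c)" using F_rel_F_fun[OF v(3)] F_fun_cong[OF v(1), of i] v(2) by (metis option.map(2))
next
  assume "map_option canon (F_fun i w) = Some (canon c)"
  then show "F_cls i w c" using F_fun_F_rel unfolding F_cls_def by force
qed

lemma Fp_cls_unique: "Fp_cls i w c \<Longrightarrow> Fp_cls i w d \<Longrightarrow> c \<sim> d" by (auto simp: Fp_cls_iff)
lemma F_cls_unique: "F_cls i w c \<Longrightarrow> F_cls i w d \<Longrightarrow> c \<sim> d" by (auto simp: F_cls_iff)

text \<open>Three sides of a square give the fourth. Read from different corners, and together with
  its reflected form, this covers the pairs FF', EE', FE' and EF'.\<close>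

lemma Fp_cls_F_cls_comm:
  assumes "Fp_cls i w b" "F_cls i w a" "F_cls i b c" shows "Fp_cls i a c"
proof -
  obtain b' a' where b: "Fp_fun i w = Some b'" "b' \<sim> b" "F_fun i w = Some a'" "a' \<sim> a"
    using assms by (auto simp: Fp_cls_iff F_cls_iff)
  moreover obtain c' where c: "F_fun i b' = Some c'" "c' \<sim> c"
    using F_fun_cong[OF b(2), of i] assms(3) by (auto simp: F_cls_iff)
  ultimately show ?thesis using Fp_fun_F_fun_comm[of i w b' a' c'] Fp_fun_cong[OF b(4), of i] unfolding Fp_cls_iff by (metis option.map(2))
qed

section \<open>The reflection that exchanges the two axes\<close>

definition flip1 :: "nat \<Rightarrow> letter \<Rightarrow> letter" where
  "flip1 i a = (if fst a = i then (Suc i, \<not> snd a) else if fst a = Suc i then (i, \<not> snd a) else a)"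

abbreviation flip :: "nat \<Rightarrow> word \<Rightarrow> word" where "flip i \<equiv> map (flip1 i)"

lemma flip1_flip1 [simp]: "flip1 i (flip1 i a) = a"
  by (cases a) (auto simp: flip1_def)

lemma flip1_comp [simp]: "flip1 i \<circ> flip1 i = id"
  by (simp add: fun_eq_iff)

lemma flip_flip [simp]: "flip i (flip i w) = w"
  by (induction w) auto

lemma flip1_eq: "flip1 i (i, s) = (Suc i, \<not> s)" "flip1 i (Suc i, s) = (i, \<not> s)"
  by (auto simp: flip1_def)

lemma flip1_iff: "flip1 i a = (i, s) \<longleftrightarrow> a = (Suc i, \<not> s)" "flip1 i a = (Suc i, s) \<longleftrightarrow> a = (i, \<not> s)"
  by (cases a; auto simp: flip1_def)+

lemma fst_flip1: "fst (flip1 i a) = (if fst a = i then Suc i else if fst a = Suc i then i else fst a)"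
  by (auto simp: flip1_def)

text \<open>The reflection permutes the kinds, so it preserves which letters are first of their
  kind; only there is a prime free, and toggling primes keeps it so.\<close>

lemma eqv_flip: "v \<sim> w \<Longrightarrow> (flip i v) \<sim> (flip i w)"
proof (induction w arbitrary: v rule: rev_induct)
  case (snoc a w)
  from snoc.prems obtain v0 b where v: "v = v0 @ [b]" "v0 \<sim> w" "nrm v0 b = nrm w a"
    by (rule eqv_snocE)
  have IH: "(flip i v0) \<sim> (flip i w)" using snoc.IH v by blast
  have nb: "nrm w b = nrm w a" using v eqv_nrm by metis
  have "nrm (flip i w) (flip1 i b) = nrm (flip i w) (flip1 i a)"
  proof (cases "fst a \<in> fst ` set w")
    case True
    then have "a = b" using nb by (cases a; cases b) (auto simp: nrm_def)
    then show ?thesis by simp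
  next
    case False
    have f: "fst a = fst b" using nb by (metis fst_nrm)
    have n: "fst (flip1 i a) \<notin> fst ` set (flip i w)" 
    proof
      assume "fst (flip1 i a) \<in> fst ` set (flip i w)"
      then obtain c where "c \<in> set w" "fst (flip1 i a) = fst (flip1 i c)" by auto
      then have "fst a = fst c" by (simp add: fst_flip1 split: if_splits)
      then show False using False \<open>c \<in> set w\<close> by auto
    qed
    have "fst (flip1 i b) = fst (flip1 i a)" using f by (simp add: fst_flip1)
    then show ?thesis unfolding nrm_def by (simp only: n simp_thms)
  qed
  then show ?case using v(1) IH eqv_nrm[OF IH] by simp
qed simp

lemma eqv_flip_iff: "(flip i v) \<sim> (flip i w) \<longleftrightarrow> v \<sim> w"
  by (metis eqv_flip flip_flip)

lemma wxy_flip: "wx i (flip i w) = wy i w \<and> wy i (flip i w) = wx i w"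
  by (induction w rule: rev_induct) (auto simp: wx_snoc wy_snoc flip1_iff)

lemma Fp_rel_flip: "Fp_rel i w w' \<Longrightarrow> Fp_rel i (flip i w') (flip i w)"
proof (induction rule: Fp_rel.induct)
  case (base p) then show ?case using Fp_rel.base[of i "flip i p"] by (simp add: flip1_eq)
next
  case (step w w' a)
  then show ?case using Fp_rel.step[of i "flip i w'" "flip i w" "flip1 i a"] by (simp add: flip1_iff)
qed

text \<open>Reflection exchanges 1F with 2F and 3F with 4F, read backwards. The condition of
  \<open>step\<close> is symmetric: x >= 2 and y >= 1 for the word mean y' >= 2 and x' >= 1 for its
  image, which ends at (x', y') = (x-1, y+1).\<close>

lemma F_rel_flip: "F_rel i w w' \<Longrightarrow> F_rel i (flip i w') (flip i w)"
proof (induction rule: F_rel.induct)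
  case (type1 w w')
  then show ?case using F_rel.type2[OF Fp_rel_flip[OF type1(1)]] Fp_rel_wxy[OF type1(1)] wxy_flip by (simp add: flip1_eq)
next
  case (type2 w w')
  then show ?case using F_rel.type1[OF Fp_rel_flip[OF type2(1)]] Fp_rel_wxy[OF type2(1)] wxy_flip by (simp add: flip1_eq)
next
  case (type3 p) then show ?case using F_rel.type4[of i "flip i p"] wxy_flip by (simp add: flip1_eq)
next
  case (type4 p) then show ?case using F_rel.type3[of i "flip i p"] wxy_flip by (simp add: flip1_eq)
next
  case (step w w' a)
  have "wx i (flip i w') \<ge> 2 \<and> wy i (flip i w') \<ge> 1 \<or> flip1 i a \<noteq> (i, False) \<and> flip1 i a \<noteq> (Suc i, True)"
    using step(2) F_rel_wxy[OF step(1)] wxy_flip[of i w'] by (auto simp: flip1_iff)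
  then show ?case using F_rel.step[OF step(3)] by simp
qed

lemma Fp_cls_flip: "Fp_cls i w c \<Longrightarrow> Fp_cls i (flip i c) (flip i w)"
  unfolding Fp_cls_def by (metis Fp_rel_flip eqv_flip)
lemma F_cls_flip: "F_cls i w c \<Longrightarrow> F_cls i (flip i c) (flip i w)"
  unfolding F_cls_def by (metis F_rel_flip eqv_flip)

lemma Fp_cls_unique': "Fp_cls i c w \<Longrightarrow> Fp_cls i d w \<Longrightarrow> c \<sim> d"
  using Fp_cls_unique Fp_cls_flip eqv_flip_iff by blast
lemma F_cls_unique': "F_cls i c w \<Longrightarrow> F_cls i d w \<Longrightarrow> c \<sim> d"
  using F_cls_unique F_cls_flip eqv_flip_iff by blast

lemma Fp_cls_F_cls_comm':
  assumes "Fp_cls i b w" "F_cls i a w" "F_cls i c b" shows "Fp_cls i c a"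
  using Fp_cls_F_cls_comm[OF Fp_cls_flip[OF assms(1)] F_cls_flip[OF assms(2)] F_cls_flip[OF assms(3)]] Fp_cls_flip[of i "flip i a" "flip i c"]
  by simp

section \<open>Final critical substrings\<close>

lemma isub_L2: "set w \<subseteq> L2 \<Longrightarrow> isub 1 w = w"
  by (induction w rule: rev_induct) (auto simp: L2_def relabel_def)

lemma walk_end_L2: "set w \<subseteq> L2 \<Longrightarrow> walk_end w = iwalk 1 w"
  using walk_end_isub[of 1 w] isub_L2[of w] by simp

lemma L2_fst: "a \<in> L2 \<longleftrightarrow> fst a \<in> {1, 2}"
  by (cases a; cases "snd a") (auto simp: L2_def)

lemma eqv_L2: "v \<sim> w \<Longrightarrow> set w \<subseteq> L2 \<Longrightarrow> set v \<subseteq> L2"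
  using eqv_fst_set[of v w] unfolding subset_iff L2_fst by (metis image_iff)

text \<open>A relational form of \<open>fcrit\<close> without type 5F: \<open>fcrit\<close> recovers
  the exponent m from the length of the substring, here it is explicit.\<close>

definition F_crit :: "nat \<times> nat \<Rightarrow> word \<Rightarrow> word \<Rightarrow> bool" where
  "F_crit p u u' \<longleftrightarrow>
     (\<exists>m. u = [(1, False)] @ replicate m (1, True) @ [(2, True)] \<and>
          u' = [(2, True)] @ replicate m (1, True) @ [(2, False)] \<and> (snd p = 0 \<or> (snd p = 1 \<and> fst p \<ge> 1)))
   \<or> (\<exists>m. u = [(1, False)] @ replicate m (2, False) @ [(1, True)] \<and>
          u' = [(2, True)] @ replicate m (2, False) @ [(1, False)] \<and> (fst p = 0 \<or> (fst p = 1 \<and> snd p \<ge> 1)))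
   \<or> u = [(1, False)] \<and> u' = [(2, False)] \<and> snd p = 0
   \<or> u = [(1, True)] \<and> u' = [(2, True)] \<and> fst p = 0"

lemma F_critE:
  assumes "F_crit p u u'"
  obtains (1) m where "u = [(1, False)] @ replicate m (1, True) @ [(2, True)]"
          "u' = [(2, True)] @ replicate m (1, True) @ [(2, False)]" "snd p = 0 \<or> (snd p = 1 \<and> fst p \<ge> 1)"
   | (2) m where "u = [(1, False)] @ replicate m (2, False) @ [(1, True)]"
          "u' = [(2, True)] @ replicate m (2, False) @ [(1, False)]" "fst p = 0 \<or> (fst p = 1 \<and> snd p \<ge> 1)"
   | (3) "u = [(1, False)]" "u' = [(2, False)]" "snd p = 0"
   | (4) "u = [(1, True)]" "u' = [(2, True)]" "fst p = 0"
  using assms unfolding F_crit_def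
  apply (elim disjE)
  subgoal by (elim exE conjE) (rule 1)
  subgoal by (elim exE conjE) (rule 2)
  subgoal by (elim conjE) (rule 3)
  subgoal by (elim conjE) (rule 4)
  done

lemma rep_eq_last: "replicate m a @ [b] = replicate k c @ [d] \<Longrightarrow> b = d"
  by (metis last_snoc)

lemma fcrit_Some: "fcrit p u = Some (Some u') \<longleftrightarrow> F_crit p u u'"
proof -
  have d: "[(1::nat, False)] @ replicate m (1, True) @ [(2, True)] \<noteq> [(1, False)] @ replicate k (2, False) @ [(1, True)]" for m k
    using rep_eq_last[of m "(1::nat, True)" "(2, True)" k "(2, False)" "(1, True)"] by auto
  consider (a) m where "u = [(1, False)] @ replicate m (1, True) @ [(2, True)]" "snd p = 0 \<or> (snd p = 1 \<and> fst p \<ge> 1)"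
   | (b) m where "u = [(1, False)] @ replicate m (2, False) @ [(1, True)]" "fst p = 0 \<or> (fst p = 1 \<and> snd p \<ge> 1)"
   | (c) "\<not> ((\<exists>m. u = [(1, False)] @ replicate m (1, True) @ [(2, True)]) \<and> (snd p = 0 \<or> (snd p = 1 \<and> fst p \<ge> 1)))"
     "\<not> ((\<exists>m. u = [(1, False)] @ replicate m (2, False) @ [(1, True)]) \<and> (fst p = 0 \<or> (fst p = 1 \<and> snd p \<ge> 1)))"
    by blast
  then show ?thesis
  proof cases
    case a
    have n: "u \<noteq> [(1, False)] @ replicate k (2, False) @ [(1, True)]" "u \<noteq> [(1, False)]" "u \<noteq> [(1, True)]" for k
      using d a(1) by auto
    have e: "(\<exists>m. u = [(1, False)] @ replicate m (1, True) @ [(2, True)])" using a by blast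
    have l: "length u - 2 = m" using a by simp
    have "u = [(1, False)] @ replicate k (1, True) @ [(2, True)] \<Longrightarrow> k = m" for k
      using l by simp
    then show ?thesis unfolding fcrit_def F_crit_def Let_def using n e l a by (simp del: append_Cons append_Nil) blast
  next
    case b
    have n: "u \<noteq> [(1, False)] @ replicate k (1, True) @ [(2, True)]" "u \<noteq> [(1, False)]" "u \<noteq> [(1, True)]" for k
      using d[of k m] b(1) by auto
    have e: "(\<exists>m. u = [(1, False)] @ replicate m (2, False) @ [(1, True)])" using b by blast
    have l: "length u - 2 = m" using b by simp
    have "u = [(1, False)] @ replicate k (2, False) @ [(1, True)] \<Longrightarrow> k = m" for k
      using l by simp
    then show ?thesis unfolding fcrit_def F_crit_def Let_def using n e l b by (simp del: append_Cons append_Nil) blast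
  next
    case c
    have f: "fcrit p u = (if u = [(1, False)] \<and> snd p = 0 then Some (Some [(2, False)])
     else if u = [(1, True)] \<and> fst p = 0 then Some (Some [(2, True)])
     else if (u = [(1, False)] \<or> u = [(2, True)]) \<and> fst p = 1 \<and> snd p \<ge> 1 then Some None
     else None)" unfolding fcrit_def Let_def using c by (simp only: if_False)
    have "F_crit p u u' \<longleftrightarrow> u = [(1, False)] \<and> u' = [(2, False)] \<and> snd p = 0 \<or> u = [(1, True)] \<and> u' = [(2, True)] \<and> fst p = 0"
      unfolding F_crit_def using c by blast
    then show ?thesis unfolding f by (simp split: if_split) auto
  qed
qed

lemma fcrit_None: "fcrit p u = Some None \<longleftrightarrow> (u = [(1, False)] \<or> u = [(2, True)]) \<and> fst p = 1 \<and> snd p \<ge> 1"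
proof
  assume a: "fcrit p u = Some None"
  show "(u = [(1, False)] \<or> u = [(2, True)]) \<and> fst p = 1 \<and> snd p \<ge> 1"
    using a unfolding fcrit_def Let_def
    by (simp only: option.inject option.distinct split: if_split_asm)
next
  assume a: "(u = [(1, False)] \<or> u = [(2, True)]) \<and> fst p = 1 \<and> snd p \<ge> 1"
  then have "\<not> (\<exists>m. u = [(1, False)] @ replicate m (1, True) @ [(2, True)])"
    "\<not> (\<exists>m. u = [(1, False)] @ replicate m (2, False) @ [(1, True)])" by auto
  then show "fcrit p u = Some None" unfolding fcrit_def Let_def using a by auto
qed

text \<open>The types 1E to 5E are, in this order, the reflections of 1F to 5F, with x and y
  exchanged.\<close>

lemma ecrit_fcrit: "ecrit p u = map_option (map_option (flip 1)) (fcrit (snd p, fst p) (flip 1 u))"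
proof -
  have e: "(\<exists>m. flip 1 u = [(1, False)] @ replicate m (2, False) @ [(1, True)])
      \<longleftrightarrow> (\<exists>m. u = [(2, True)] @ replicate m (1, True) @ [(2, False)])"
    "(\<exists>m. flip 1 u = [(1, False)] @ replicate m (1, True) @ [(2, True)])
      \<longleftrightarrow> (\<exists>m. u = [(2, True)] @ replicate m (2, False) @ [(1, False)])"
    "flip 1 u = [(1, False)] \<longleftrightarrow> u = [(2, True)]" "flip 1 u = [(1, True)] \<longleftrightarrow> u = [(2, False)]"
    "flip 1 u = [(2, True)] \<longleftrightarrow> u = [(1, False)]"
  proof -
    have s: "flip 1 u = z \<longleftrightarrow> u = flip 1 z" for z by (metis flip_flip)
    show "(\<exists>m. flip 1 u = [(1, False)] @ replicate m (2, False) @ [(1, True)])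
      \<longleftrightarrow> (\<exists>m. u = [(2, True)] @ replicate m (1, True) @ [(2, False)])"
    "(\<exists>m. flip 1 u = [(1, False)] @ replicate m (1, True) @ [(2, True)])
      \<longleftrightarrow> (\<exists>m. u = [(2, True)] @ replicate m (2, False) @ [(1, False)])"
    "flip 1 u = [(1, False)] \<longleftrightarrow> u = [(2, True)]" "flip 1 u = [(1, True)] \<longleftrightarrow> u = [(2, False)]"
    "flip 1 u = [(2, True)] \<longleftrightarrow> u = [(1, False)]"
      unfolding s by (simp_all add: flip1_def numeral_2_eq_2)
  qed
  show ?thesis
    unfolding ecrit_def fcrit_def Let_def e fst_conv snd_conv length_map
    by (auto simp: flip1_def)
qed

definition max_cand :: "(nat \<times> nat \<Rightarrow> word \<Rightarrow> word option option) \<Rightarrow> word \<Rightarrow> word \<Rightarrow> nat \<Rightarrow> nat \<Rightarrow> word option \<Rightarrow> bool" where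
  "max_cand C w v k l r \<longleftrightarrow> (v, k, l, r) \<in> crit_cands C w \<and>
     (\<forall>v' k' l' r'. (v', k', l', r') \<in> crit_cands C w \<longrightarrow> k' < k \<or> (k' = k \<and> l' \<le> l))"

text \<open>The maxima are taken over finite nonempty sets, so they are attained and
  \<open>SOME\<close> picks a genuine candidate. Which representative it picks stays open; that the
  result does not depend on it follows later from uniqueness of the image class.\<close>

lemma crit_op_max_cand:
  "crit_cands C w = {} \<and> crit_op C w = None \<or>
   (\<exists>v k l r. max_cand C w v k l r \<and>
      crit_op C w = map_option (\<lambda>u'. canon (take k v @ u' @ drop (Suc l) v)) r)"
proof (cases "crit_cands C w = {}")
  case True then show ?thesis by (simp add: crit_op_def)
next
  case False
  let ?c = "crit_cands C w"
  let ?K = "{k. \<exists>v l r. (v, k, l, r) \<in> ?c}"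
  define k0 where "k0 = Max ?K"
  let ?L = "{l. \<exists>v r. (v, k0, l, r) \<in> ?c}"
  define l0 where "l0 = Max ?L"
  define vr where "vr = (SOME vr. (fst vr, k0, l0, snd vr) \<in> ?c)"
  have b: "k < length w \<and> l < length w" if "(v, k, l, r) \<in> ?c" for v k l r
    using that eqv_length[of v w] by (auto simp: crit_cands_def)
  have "?K \<subseteq> {..<length w}" "?L \<subseteq> {..<length w}" using b by auto
  then have fin: "finite ?K" "finite ?L" using finite_subset by blast+
  have neK: "?K \<noteq> {}" using False by auto
  have k0: "k0 \<in> ?K" unfolding k0_def using fin(1) neK by (rule Max_in)
  then have neL: "?L \<noteq> {}" by auto
  have l0: "l0 \<in> ?L" unfolding l0_def using fin(2) neL by (rule Max_in)
  then have "\<exists>vr. (fst vr, k0, l0, snd vr) \<in> ?c" by auto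
  then have vr: "(fst vr, k0, l0, snd vr) \<in> ?c" unfolding vr_def by (rule someI_ex)
  have "max_cand C w (fst vr) k0 l0 (snd vr)"
    unfolding max_cand_def
  proof (intro conjI allI impI)
    show "(fst vr, k0, l0, snd vr) \<in> ?c" by (rule vr)
    fix v' k' l' r' assume a: "(v', k', l', r') \<in> ?c"
    then have "k' \<le> k0" unfolding k0_def using fin(1) by (intro Max_ge) auto
    moreover have "l' \<le> l0" if "k' = k0" unfolding l0_def using a that fin(2) by (intro Max_ge) auto
    ultimately show "k' < k0 \<or> (k' = k0 \<and> l' \<le> l0)" by linarith
  qed
  moreover have "crit_op C w = map_option (\<lambda>u'. canon (take k0 (fst vr) @ u' @ drop (Suc l0) (fst vr))) (snd vr)"
    unfolding crit_op_def Let_def using False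
    by (simp add: k0_def[symmetric] l0_def[symmetric] vr_def[symmetric] split: option.split)
  ultimately show ?thesis by blast
qed

lemma cand_split:
  assumes "(p @ u @ q) \<sim> w" "u \<noteq> []" "set w \<subseteq> L2" "C (iwalk 1 p) u = Some r"
  shows "(p @ u @ q, length p, length p + length u - 1, r) \<in> crit_cands C w"
proof -
  have "set (p @ u @ q) \<subseteq> L2" using assms eqv_L2 by blast
  then have "walk_end p = iwalk 1 p" by (simp add: walk_end_L2)
  moreover have "length u > 0" using assms by simp
  moreover from this have "Suc (length p + length u - 1) - length p = length u" by linarith
  moreover have "length p \<le> length p + length u - 1" "length p + length u - 1 < length (p @ u @ q)"
    using \<open>length u > 0\<close> unfolding length_append by linarith+
  ultimately show ?thesis using assms by (simp add: crit_cands_def)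
qed

lemma cand_splitE:
  assumes "(v, k, l, r) \<in> crit_cands C w" "set w \<subseteq> L2"
  obtains p u q where "v = p @ u @ q" "v \<sim> w" "u \<noteq> []" "length p = k" "Suc l = k + length u"
    "C (iwalk 1 p) u = Some r" "q = drop (Suc l) v"
proof -
  have a: "v \<sim> w" "k \<le> l" "l < length v" "C (walk_end (take k v)) (take (Suc l - k) (drop k v)) = Some r"
    using assms by (auto simp: crit_cands_def)
  have "set v \<subseteq> L2" using a assms eqv_L2 by blast
  then have "set (take k v) \<subseteq> L2" using set_take_subset by fast
  then have "walk_end (take k v) = iwalk 1 (take k v)" by (rule walk_end_L2)
  moreover have "v = take k v @ take (Suc l - k) (drop k v) @ drop (Suc l) v"
  proof -
    have "drop (Suc l - k) (drop k v) = drop (Suc l) v" using a by simp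
    then show ?thesis by (metis append_take_drop_id)
  qed
  moreover have "length (take (Suc l - k) (drop k v)) = Suc l - k" using a by simp
  moreover have "take (Suc l - k) (drop k v) \<noteq> []" using calculation(3) a by (metis Suc_diff_le list.size(3) nat.distinct(1))
  ultimately show thesis using that[of "take k v" "take (Suc l - k) (drop k v)" "drop (Suc l) v"] a by simp
qed

lemma Fp_rel_replicate: "a \<noteq> (i, False) \<Longrightarrow> a \<noteq> (Suc i, True) \<Longrightarrow>
    Fp_rel i (p @ [(i, False)] @ replicate m a) (p @ [(Suc i, True)] @ replicate m a)"
proof (induction m)
  case 0 then show ?case using Fp_rel.base by simp
next
  case (Suc m)
  from Fp_rel.step[OF Suc.IH[OF Suc.prems] Suc.prems] show ?case by (simp add: replicate_append_same)
qed

lemma wxy_rep1: "wx i (w @ replicate m (i, True)) = wx i w + m \<and> wy i (w @ replicate m (i, True)) = wy i w"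
proof (induction m)
  case (Suc m)
  have "w @ replicate (Suc m) (i, True) = (w @ replicate m (i, True)) @ [(i, True)]"
    by (simp add: replicate_append_same)
  then show ?case using Suc by (simp only: wx_snoc wy_snoc) auto
qed simp

lemma wxy_rep2: "wx i (w @ replicate m (Suc i, False)) = wx i w \<and> wy i (w @ replicate m (Suc i, False)) = wy i w + m"
proof (induction m)
  case (Suc m)
  have "w @ replicate (Suc m) (Suc i, False) = (w @ replicate m (Suc i, False)) @ [(Suc i, False)]"
    by (simp add: replicate_append_same)
  then show ?case using Suc by (simp only: wx_snoc wy_snoc) auto
qed simp

text \<open>In 1F the leading 1 is read on y = 0 or goes south from y = 1, so the walk is on y = 0
  along the letters 1' and \<open>type1\<close> applies. In 2F the walk is at x = 1 after the
  leading 1, and the letters 2 keep it there.\<close>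

lemma F_crit_F_rel: assumes "F_crit (iwalk 1 p) u u'" shows "F_rel 1 (p @ u) (p @ u')"
proof -
  consider (a) m where "u = [(1, False)] @ replicate m (1, True) @ [(2, True)]"
          "u' = [(2, True)] @ replicate m (1, True) @ [(2, False)]" "wy 1 p = 0 \<or> (wy 1 p = 1 \<and> wx 1 p \<ge> 1)"
   | (b) m where "u = [(1, False)] @ replicate m (2, False) @ [(1, True)]"
          "u' = [(2, True)] @ replicate m (2, False) @ [(1, False)]" "wx 1 p = 0 \<or> (wx 1 p = 1 \<and> wy 1 p \<ge> 1)"
   | (c) "u = [(1, False)]" "u' = [(2, False)]" "wy 1 p = 0"
   | (d) "u = [(1, True)]" "u' = [(2, True)]" "wx 1 p = 0"
    using assms by (elim F_critE) (auto simp: iwalk_wxy)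
  then show ?thesis
  proof cases
    case a
    have "wy 1 ((p @ [(1, False)]) @ replicate m (1, True)) = 0"
      using a(3) wxy_rep1[of 1 "p @ [(1, False)]" m] by (auto simp: wy_snoc)
    then show ?thesis using F_rel.type1[OF Fp_rel_replicate[of "(1, True)" 1 p m]] a by (simp add: numeral_2_eq_2)
  next
    case b
    have "wx 1 ((p @ [(1, False)]) @ replicate m (2, False)) = 1"
      using b(3) wxy_rep2[of 1 "p @ [(1, False)]" m] by (auto simp: wx_snoc numeral_2_eq_2)
    then show ?thesis using F_rel.type2[OF Fp_rel_replicate[of "(2, False)" 1 p m]] b by (simp add: numeral_2_eq_2)
  next
    case c then show ?thesis using F_rel.type3[of 1 p] by (simp add: numeral_2_eq_2)
  next
    case d then show ?thesis using F_rel.type4[of 1 p] by (simp add: numeral_2_eq_2)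
  qed
qed

text \<open>The converse for 1F: neutral letters never lower y, so a 2 after the changed 1 would
  keep the walk off y = 0 and only letters 1' can follow.\<close>

lemma Fp_rel_wy_0:
  assumes "Fp_rel 1 w w'" "wy 1 w = 0" "set w \<subseteq> L2"
  shows "\<exists>p m. w = p @ [(1, False)] @ replicate m (1, True) \<and> w' = p @ [(2, True)] @ replicate m (1, True)
     \<and> (wy 1 p = 0 \<or> (wy 1 p = 1 \<and> wx 1 p \<ge> 1))"
  using assms
proof (induction rule: Fp_rel.induct)
  case (base p)
  then have "wy 1 p = 0 \<or> (wy 1 p = 1 \<and> wx 1 p \<ge> 1)" by (auto simp: wy_snoc split: if_splits)
  then show ?case by (intro exI[of _ p] exI[of _ 0]) (simp add: numeral_2_eq_2)
next
  case (step w w' a)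
  then have "a = (1, True)" by (auto simp: L2_def wy_snoc)
  then obtain p m where "w = p @ [(1, False)] @ replicate m (1, True)" "w' = p @ [(2, True)] @ replicate m (1, True)"
     "wy 1 p = 0 \<or> (wy 1 p = 1 \<and> wx 1 p \<ge> 1)" using step by (auto simp: wy_snoc)
  then show ?case using \<open>a = (1, True)\<close>
    by (intro exI[of _ p] exI[of _ "Suc m"]) (simp add: replicate_append_same)
qed

text \<open>The converse for 2F: every prefix containing the changed 1 has x >= 1, so a later 1'
  would reach x >= 2, and no neutral letter lowers x. Only letters 2 can follow.\<close>

lemma Fp_rel_wx_1:
  assumes "Fp_rel 1 w w'" "wx 1 w = 1" "set w \<subseteq> L2"
  shows "\<exists>p m. w = p @ [(1, False)] @ replicate m (2, False) \<and> w' = p @ [(2, True)] @ replicate m (2, False)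
     \<and> (wx 1 p = 0 \<or> (wx 1 p = 1 \<and> wy 1 p \<ge> 1))"
  using assms
proof (induction rule: Fp_rel.induct)
  case (base p)
  then have "wx 1 p = 0 \<or> (wx 1 p = 1 \<and> wy 1 p \<ge> 1)" by (auto simp: wx_snoc split: if_splits)
  then show ?case by (intro exI[of _ p] exI[of _ 0]) (simp add: numeral_2_eq_2)
next
  case (step w w' a)
  then have "a = (2, False)" using Fp_rel_wxy[OF step(1)] by (auto simp: L2_def wx_snoc)
  then obtain p m where "w = p @ [(1, False)] @ replicate m (2, False)" "w' = p @ [(2, True)] @ replicate m (2, False)"
     "wx 1 p = 0 \<or> (wx 1 p = 1 \<and> wy 1 p \<ge> 1)" using step by (auto simp: wx_snoc)
  then show ?case using \<open>a = (2, False)\<close>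
    by (intro exI[of _ p] exI[of _ "Suc m"]) (simp add: replicate_append_same)
qed

lemma F_rel_decomp:
  assumes "F_rel 1 w w'" "set w \<subseteq> L2"
  shows "\<exists>p u u' q. w = p @ u @ q \<and> F_crit (iwalk 1 p) u u' \<and>
    (\<forall>q1 a q2. q = q1 @ a # q2 \<longrightarrow> wx 1 (p @ u @ q1) \<ge> 2 \<and> wy 1 (p @ u @ q1) \<ge> 1 \<or> a \<noteq> (1, False) \<and> a \<noteq> (2, True))"
  using assms
proof (induction rule: F_rel.induct)
  case (type1 w w')
  then obtain p m where w: "w = p @ [(1, False)] @ replicate m (1, True)" "wy 1 p = 0 \<or> (wy 1 p = 1 \<and> wx 1 p \<ge> 1)"
    using Fp_rel_wy_0[OF type1(1)] by auto
  have "F_crit (iwalk 1 p) ([(1, False)] @ replicate m (1, True) @ [(2, True)]) ([(2, True)] @ replicate m (1, True) @ [(2, False)])"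
    unfolding F_crit_def iwalk_wxy fst_conv snd_conv using w(2) by blast
  then show ?case using w(1)
    by (intro exI[of _ p] exI[of _ "[(1, False)] @ replicate m (1, True) @ [(2, True)]"] exI[of _ "[(2, True)] @ replicate m (1, True) @ [(2, False)]"] exI[of _ "[]"])
      (simp add: numeral_2_eq_2)
next
  case (type2 w w')
  then obtain p m where w: "w = p @ [(1, False)] @ replicate m (2, False)" "wx 1 p = 0 \<or> (wx 1 p = 1 \<and> wy 1 p \<ge> 1)"
    using Fp_rel_wx_1[OF type2(1)] by auto
  have "F_crit (iwalk 1 p) ([(1, False)] @ replicate m (2, False) @ [(1, True)]) ([(2, True)] @ replicate m (2, False) @ [(1, False)])"
    unfolding F_crit_def iwalk_wxy fst_conv snd_conv using w(2) by blast
  then show ?case using w(1)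
    by (intro exI[of _ p] exI[of _ "[(1, False)] @ replicate m (2, False) @ [(1, True)]"] exI[of _ "[(2, True)] @ replicate m (2, False) @ [(1, False)]"] exI[of _ "[]"])
      simp
next
  case (type3 p)
  then show ?case
    by (intro exI[of _ p] exI[of _ "[(1, False)]"] exI[of _ "[(2, False)]"] exI[of _ "[]"]) (simp add: F_crit_def iwalk_wxy)
next
  case (type4 p)
  then show ?case
    by (intro exI[of _ p] exI[of _ "[(1, True)]"] exI[of _ "[(2, True)]"] exI[of _ "[]"]) (simp add: F_crit_def iwalk_wxy)
next
  case (step w w' a)
  then obtain p u u' q where w: "w = p @ u @ q" "F_crit (iwalk 1 p) u u'"
    and c: "\<forall>q1 a q2. q = q1 @ a # q2 \<longrightarrow> wx 1 (p @ u @ q1) \<ge> 2 \<and> wy 1 (p @ u @ q1) \<ge> 1 \<or> a \<noteq> (1, False) \<and> a \<noteq> (2, True)"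
    by auto
  have "wx 1 (p @ u @ q1) \<ge> 2 \<and> wy 1 (p @ u @ q1) \<ge> 1 \<or> b \<noteq> (1, False) \<and> b \<noteq> (2, True)"
    if e: "q @ [a] = q1 @ b # q2" for q1 b q2
  proof (cases q2 rule: rev_cases)
    case Nil
    then show ?thesis using e step(2) w(1) by (simp add: numeral_2_eq_2)
  next
    case (snoc q3 z)
    then have "q = q1 @ b # q3" using e by (metis append_Cons append_assoc butlast_snoc)
    then show ?thesis using c by blast
  qed
  then show ?case using w by (intro exI[of _ p] exI[of _ u] exI[of _ u'] exI[of _ "q @ [a]"]) simp
qed

lemma canon_take: "canon (take k w) = take k (canon w)"
proof -
  have "take (length a) (canon (a @ b)) = canon a" for a b
    by (induction b rule: rev_induct) (simp_all flip: append_assoc)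
  from this[of "take k w" "drop k w"] show ?thesis
    by (metis append_take_drop_id length_canon length_take min.commute take_take take_all_iff linorder_linear min_def)
qed

lemma eqv_take: "v \<sim> w \<Longrightarrow> (take k v) \<sim> (take k w)"
  by (simp add: canon_take)

lemma eqv_nth:
  assumes "v \<sim> w" "k < length v" "fst (v ! k) \<in> fst ` set (take k v)"
  shows "v ! k = w ! k"
proof -
  have k: "k < length w" using assms eqv_length by metis
  have "(take (Suc k) v) \<sim> (take (Suc k) w)" using assms(1) by (rule eqv_take)
  then have "(take k v) \<sim> (take k w)" "nrm (take k v) (v ! k) = nrm (take k w) (w ! k)"
    using assms(2) k by (simp_all add: take_Suc_conv_app_nth)
  then have e: "nrm (take k v) (v ! k) = nrm (take k v) (w ! k)" using eqv_nrm by metis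
  then have "fst (v ! k) = fst (w ! k)" by (metis fst_nrm)
  then show ?thesis using e assms(3) by (simp add: nrm_nonfirst)
qed

text \<open>A walk that reaches the positive x-axis ends with a 1 followed by letters 1'; in a word
  of letters 1' alone the first one is replaced by 1. So a 2' read next completes a 1F substring in
  some representative. The last conjunct speaks of \<open>w\<close> itself, since the replacement
  affects position \<open>length p\<close> only.\<close>

lemma axis_run:
  assumes "set w \<subseteq> L2" "wx 1 w \<ge> 1" "wy 1 w = 0"
  shows "\<exists>p m. w \<sim> (p @ [(1, False)] @ replicate m (1, True)) \<and> (wy 1 p = 0 \<or> (wy 1 p = 1 \<and> wx 1 p \<ge> 1))
     \<and> (\<forall>k. length p < k \<longrightarrow> k < length w \<longrightarrow> w ! k = (1, True))"
  using assms
proof (induction w rule: rev_induct)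
  case (snoc a w)
  have "a = (1, False) \<or> a = (1, True)"
    using snoc.prems by (auto simp: L2_def wy_snoc split: if_splits)
  then show ?case
  proof
    assume a: "a = (1, False)"
    then have "wy 1 w = 0 \<or> (wy 1 w = 1 \<and> wx 1 w \<ge> 1)" using snoc.prems by (auto simp: wy_snoc split: if_splits)
    then show ?thesis using a by (intro exI[of _ w] exI[of _ 0]) auto
  next
    assume a: "a = (1, True)"
    then have y: "wy 1 w = 0" using snoc.prems by (simp add: wy_snoc)
    show ?thesis
    proof (cases "wx 1 w = 0")
      case True
      have "w = []"
      proof (rule ccontr)
        assume "w \<noteq> []"
        then obtain b w2 where "w = b # w2" by (cases w) auto
        then have "1 \<in> fst ` set w \<or> Suc 1 \<in> fst ` set w" using snoc.prems by (auto simp: L2_def)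
        then show False using wxy_pos[of 1 w] True y by simp
      qed
      then show ?thesis using a by (intro exI[of _ "[]"] exI[of _ 0]) (simp add: canon_snoc[of "[]", simplified] nrm_def)
    next
      case False
      then obtain p m where w: "w \<sim> (p @ [(1, False)] @ replicate m (1, True))"
        "wy 1 p = 0 \<or> (wy 1 p = 1 \<and> wx 1 p \<ge> 1)" "\<forall>k. length p < k \<longrightarrow> k < length w \<longrightarrow> w ! k = (1, True)"
        using snoc.IH snoc.prems y by auto
      from eqv_append[OF w(1), of "[a]"] have "(w @ [a]) \<sim> (p @ [(1, False)] @ replicate (Suc m) (1, True))"
        using a by (simp add: replicate_append_same)
      moreover have "\<forall>k. length p < k \<longrightarrow> k < length (w @ [a]) \<longrightarrow> (w @ [a]) ! k = (1, True)"
        using w(3) a by (auto simp: nth_append less_Suc_eq)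
      ultimately show ?thesis using w(2) by blast
    qed
  qed
qed simp

lemma fst_walk_pos: "wx i (p @ [(i, False)]) \<ge> 1"
  by (auto simp: wx_snoc)

text \<open>Maximality supplies the side condition of \<open>step\<close> for every later letter: a
  1 or 2' violating it would be critical itself or finish a later critical substring. The delicate
  case is a 2' on y = 0, whose 1F substring starts further left and perhaps in another
  representative.\<close>

lemma max_cand_F_rel:
  assumes L: "set w \<subseteq> L2" and m: "max_cand fcrit w v k l (Some u')"
  shows "F_rel 1 v (take k v @ u' @ drop (Suc l) v)"
proof -
  from m have c: "(v, k, l, Some u') \<in> crit_cands fcrit w" by (simp add: max_cand_def)
  have mx: "k' < k \<or> (k' = k \<and> l' \<le> l)" if "(v', k', l', r') \<in> crit_cands fcrit w" for v' k' l' r'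
    using m that unfolding max_cand_def by blast
  from c L obtain p u q where v: "v = p @ u @ q" "v \<sim> w" "u \<noteq> []" "length p = k" "Suc l = k + length u"
    "fcrit (iwalk 1 p) u = Some (Some u')" "q = drop (Suc l) v" by (rule cand_splitE)
  have F_crit: "F_crit (iwalk 1 p) u u'" using v fcrit_Some by blast
  have Lv: "set v \<subseteq> L2" using v L eqv_L2 by blast
  have lu: "length u > 0" using v by simp
  have "n \<le> length q \<Longrightarrow> F_rel 1 (p @ u @ take n q) (p @ u' @ take n q)" for n
  proof (induction n)
    case 0 then show ?case using F_crit_F_rel[OF F_crit] by simp
  next
    case (Suc n)
    let ?W = "p @ u @ take n q" and ?a = "q ! n" and ?r = "drop (Suc n) q"
    have IH: "F_rel 1 ?W (p @ u' @ take n q)" using Suc by simp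
    have q: "take (Suc n) q = take n q @ [?a]" using Suc by (simp add: take_Suc_conv_app_nth)
    have vW: "v = ?W @ [?a] @ ?r" using v(1) Suc by (metis append_assoc append_take_drop_id q)
    have x: "wx 1 ?W \<ge> 1" using F_rel_wxy[OF IH] by simp
    have lW: "length ?W \<ge> k + length u" using v by simp
    have nocand: "fcrit (iwalk 1 ?W) [?a] \<noteq> Some r" for r
    proof
      assume "fcrit (iwalk 1 ?W) [?a] = Some r"
      moreover have "(?W @ [?a] @ ?r) \<sim> w" using vW v(2) by metis
      ultimately have "(?W @ [?a] @ ?r, length ?W, length ?W + length [?a] - 1, r) \<in> crit_cands fcrit w"
        using L by (intro cand_split) auto
      from mx[OF this] show False using lW lu by linarith
    qed
    have "wx 1 ?W \<ge> 2 \<and> wy 1 ?W \<ge> 1 \<or> ?a \<noteq> (1, False) \<and> ?a \<noteq> (2, True)"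
    proof (rule ccontr)
      assume n: "\<not> ?thesis"
      then have a: "?a = (1, False) \<or> ?a = (2, True)" and z: "wx 1 ?W = 1 \<or> wy 1 ?W = 0" using x by auto
      \<comment> \<open>Otherwise x = 1 and y >= 1, and the letter is critical of type 5F.\<close>
      have "wy 1 ?W = 0"
      proof (rule ccontr)
        assume "wy 1 ?W \<noteq> 0"
        then have "fcrit (iwalk 1 ?W) [?a] = Some None" unfolding fcrit_None iwalk_wxy using z a by auto
        then show False using nocand[of None] by simp
      qed
      \<comment> \<open>A 1 on y = 0 is critical of type 3F.\<close>
      have "?a = (2, True)"
      proof (rule ccontr)
        assume "?a \<noteq> (2, True)"
        then have "F_crit (iwalk 1 ?W) [?a] [(2, False)]" using a \<open>wy 1 ?W = 0\<close> unfolding F_crit_def iwalk_wxy by auto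
        then show False using nocand[of "Some [(2, False)]"] fcrit_Some by simp
      qed
      have LW: "set ?W \<subseteq> L2" using Lv by (subst (asm) vW) auto
      \<comment> \<open>The 1F substring closed by this 2' ends after \<open>l\<close>, so by
        maximality it starts strictly before \<open>k\<close>. Then position \<open>k\<close>
        carries 1', the final critical substring has type 4F, and x = 0 where it starts.\<close>
      obtain p1 m where p1: "?W \<sim> (p1 @ [(1, False)] @ replicate m (1, True))"
        "wy 1 p1 = 0 \<or> (wy 1 p1 = 1 \<and> wx 1 p1 \<ge> 1)" "\<forall>k. length p1 < k \<longrightarrow> k < length ?W \<longrightarrow> ?W ! k = (1, True)"
        using axis_run[OF LW x \<open>wy 1 ?W = 0\<close>] by blast
      let ?u1 = "[(1, False)] @ replicate m (1, True) @ [(2, True)] :: word"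
      have "(p1 @ ?u1 @ ?r) \<sim> w"
        using eqv_append[OF p1(1), of "[?a] @ ?r"] \<open>?a = (2, True)\<close> vW v(2) by (metis append_assoc)
      moreover have "fcrit (iwalk 1 p1) ?u1 = Some (Some ([(2, True)] @ replicate m (1, True) @ [(2, False)]))"
        unfolding fcrit_Some F_crit_def iwalk_wxy fst_conv snd_conv using p1(2) by blast
      ultimately have "(p1 @ ?u1 @ ?r, length p1, length p1 + length ?u1 - 1,
           Some ([(2, True)] @ replicate m (1, True) @ [(2, False)])) \<in> crit_cands fcrit w"
        using L by (intro cand_split) auto
      from mx[OF this] have lt: "length p1 < k \<or> length p1 = k \<and> length p1 + m + 1 \<le> l" by simp
      have "length ?W = length p1 + m + 1" using eqv_length[OF p1(1)] by simp
      then have k1: "length p1 < k" using lt lW v(5) by linarith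
      have "k < length ?W" using lW lu by linarith
      then have "?W ! k = (1, True)" using p1(3) k1 by blast
      moreover have "?W ! k = u ! 0" using v(4) lu by (simp add: nth_append)
      ultimately have "u ! 0 = (1, True)" by simp
      with F_crit have "wx 1 p = 0" by (elim F_critE) (simp_all add: iwalk_wxy)
      \<comment> \<open>But the prefix up to \<open>k\<close> contains the leading 1 of that 1F
        substring, followed by letters 1' only, so x >= 1.\<close>
      have "p \<sim> (take k (p1 @ [(1, False)] @ replicate m (1, True)))"
        using eqv_take[OF p1(1), of k] v(4) by simp
      also have "take k (p1 @ [(1, False)] @ replicate m (1, True)) = (p1 @ [(1, False)]) @ replicate (min (k - length p1 - 1) m) (1, True)"
        using k1 by (cases "k - length p1") auto
      finally have "wx 1 p = wx 1 ((p1 @ [(1, False)]) @ replicate (min (k - length p1 - 1) m) (1, True))"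
        by (rule eqv_wx)
      then show False using \<open>wx 1 p = 0\<close> wxy_rep1[of 1 "p1 @ [(1, False)]"] fst_walk_pos[of 1 p1] by simp
    qed
    from F_rel.step[OF IH, of ?a] this show ?case by (simp add: q numeral_2_eq_2)
  qed
  from this[of "length q"] show ?thesis using v by (metis append_eq_conv_conj append_take_drop_id order_refl take_all)
qed

lemma F_rel_cand:
  assumes "F_rel 1 x x'" "x \<sim> w" "set w \<subseteq> L2"
  obtains p u u' q where "x = p @ u @ q" "F_crit (iwalk 1 p) u u'"
     "(x, length p, length p + length u - 1, Some u') \<in> crit_cands fcrit w" "u \<noteq> []"
     "\<forall>q1 a q2. q = q1 @ a # q2 \<longrightarrow> wx 1 (p @ u @ q1) \<ge> 2 \<and> wy 1 (p @ u @ q1) \<ge> 1 \<or> a \<noteq> (1, False) \<and> a \<noteq> (2, True)"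
proof -
  have "set x \<subseteq> L2" using assms eqv_L2 by blast
  then obtain p u u' q where x: "x = p @ u @ q" "F_crit (iwalk 1 p) u u'"
    "\<forall>q1 a q2. q = q1 @ a # q2 \<longrightarrow> wx 1 (p @ u @ q1) \<ge> 2 \<and> wy 1 (p @ u @ q1) \<ge> 1 \<or> a \<noteq> (1, False) \<and> a \<noteq> (2, True)"
    using F_rel_decomp[OF assms(1)] by blast
  have u: "u \<noteq> []" using x(2) by (elim F_critE) auto
  have "(p @ u @ q, length p, length p + length u - 1, Some u') \<in> crit_cands fcrit w"
    using u x assms by (intro cand_split) (auto simp: fcrit_Some)
  then show thesis using that x u by blast
qed

text \<open>A letter of type 5F is read off the axes, so both kinds occur before it and it is the
  same in all representatives. If F were defined through some representative, the critical substring
  there would start no later, and the 5F letter, read at x = 1, could neither follow it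
  (\<open>step\<close> asks for x >= 2) nor lie inside it.\<close>

lemma max_cand_None:
  assumes L: "set w \<subseteq> L2" and m: "max_cand fcrit w v k l None" and g: "F_rel 1 x x'" "x \<sim> w"
  shows False
proof -
  from m have c: "(v, k, l, None) \<in> crit_cands fcrit w" by (simp add: max_cand_def)
  have mx: "k' < k \<or> (k' = k \<and> l' \<le> l)" if "(v', k', l', r') \<in> crit_cands fcrit w" for v' k' l' r'
    using m that unfolding max_cand_def by blast
  from c L obtain pv uv qv where v: "v = pv @ uv @ qv" "v \<sim> w" "uv \<noteq> []" "length pv = k" "Suc l = k + length uv"
    "fcrit (iwalk 1 pv) uv = Some None" by (rule cand_splitE)
  have uv: "uv = [(1, False)] \<or> uv = [(2, True)]" and xy: "wx 1 pv = 1" "wy 1 pv \<ge> 1"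
    using v(6) unfolding fcrit_None iwalk_wxy by auto
  have l: "l = k" using uv v(5) by auto
  have vk: "v ! k = (1, False) \<or> v ! k = (2, True)" using uv v by auto
  have tk: "take k v = pv" using v by simp
  have "1 \<in> fst ` set pv" "2 \<in> fst ` set pv"
    using xy wx_0[of 1 pv] wy_0[of 1 pv] by (auto simp: numeral_2_eq_2)
  then have "fst (v ! k) \<in> fst ` set (take k v)" using vk tk by (metis fst_conv)
  moreover have vx: "v \<sim> x" using v g by simp
  moreover have "k < length v" using v by simp
  ultimately have xk: "x ! k = v ! k" using eqv_nth[of v x k] by simp
  have "(take k x) \<sim> pv" using eqv_take[OF vx, of k] tk by simp
  from eqv_wx[OF this, of 1] eqv_wy[OF this, of 1] have xyx: "wx 1 (take k x) = 1" "wy 1 (take k x) \<ge> 1" using xy by simp_all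
  have kx: "k < length x" using \<open>k < length v\<close> eqv_length[OF vx] by simp
  obtain p u u' q where x: "x = p @ u @ q" "F_crit (iwalk 1 p) u u'"
     "(x, length p, length p + length u - 1, Some u') \<in> crit_cands fcrit w" "u \<noteq> []"
     and istep: "\<forall>q1 a q2. q = q1 @ a # q2 \<longrightarrow> wx 1 (p @ u @ q1) \<ge> 2 \<and> wy 1 (p @ u @ q1) \<ge> 1 \<or> a \<noteq> (1, False) \<and> a \<noteq> (2, True)"
    by (rule F_rel_cand[OF g L])
  have lu: "length u > 0" using x by simp
  from mx[OF x(3)] have le: "length p < k \<or> length p = k \<and> length u = 1" using l lu by linarith
  show False
  proof (cases "k \<ge> length p + length u")
    case True
    define n where "n = k - length p - length u"
    have n: "n < length q" "k = length p + length u + n" using True kx x(1) by (auto simp: n_def)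
    then have q: "q = take n q @ q ! n # drop (Suc n) q" by (simp add: id_take_nth_drop)
    have "take k x = p @ u @ take n q" "x ! k = q ! n" using x(1) n by (simp_all add: nth_append)
    then show False using istep[rule_format, OF q] xyx xk vk by auto
  next
    case False
    define n where "n = k - length p"
    have n: "k = length p + n" "n < length u" using le False by (auto simp: n_def)
    have tkx: "take k x = p @ take n u" "x ! k = u ! n" using x(1) n by (simp_all add: nth_append)
    from x(2) show False
    proof (cases rule: F_critE)
      case (1 m)
      have n0: "n \<noteq> 0" using le n 1 by auto
      \<comment> \<open>Inside 1F, a 1 or 2' after the leading letter can only be the closing 2',
        and that is read on y = 0.\<close>
      have "n = Suc m"
      proof (rule ccontr)
        assume "n \<noteq> Suc m"
        then have "u ! n = (1, True)" using n0 n(2) 1(1) by (cases n) (auto simp: nth_append)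
        then show False using tkx xk vk by auto
      qed
      then have "take k x = (p @ [(1, False)]) @ replicate m (1, True)" using tkx 1 by simp
      then have "wy 1 (take k x) = 0" using wxy_rep1[of 1 "p @ [(1, False)]" m] 1(3) by (auto simp: iwalk_wxy wy_snoc)
      then show False using xyx by simp
    next
      case (2 m)
      have n0: "n \<noteq> 0" using le n 2 by auto
      then have "u ! n = (2, False) \<or> u ! n = (1, True)" using n(2) 2(1) by (cases n) (auto simp: nth_append)
      then show False using tkx xk vk by auto
    next
      case 3
      then show False using n xyx tkx by (auto simp: iwalk_wxy)
    next
      case 4
      then show False using n xyx tkx by (auto simp: iwalk_wxy)
    qed
  qed
qed

text \<open>Uniqueness of the image class makes the value independent of the representative chosen
  by \<open>SOME\<close>.\<close>

lemma Fop_iff: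
  assumes L: "set w \<subseteq> L2"
  shows "Fop w = Some c \<longleftrightarrow> canon c = c \<and> F_cls 1 w c"
proof
  assume "Fop w = Some c"
  then obtain v k l u' where m: "max_cand fcrit w v k l (Some u')" "c = canon (take k v @ u' @ drop (Suc l) v)"
    using crit_op_max_cand[of fcrit w] unfolding Fop_def by fastforce
  then have "v \<sim> w" by (auto simp: max_cand_def crit_cands_def)
  then show "canon c = c \<and> F_cls 1 w c" using max_cand_F_rel[OF L m(1)] m(2) unfolding F_cls_def by force
next
  assume c: "canon c = c \<and> F_cls 1 w c"
  then obtain x x' where x: "x \<sim> w" "x' \<sim> c" "F_rel 1 x x'" by (auto simp: F_cls_def)
  have "crit_cands fcrit w \<noteq> {}" using F_rel_cand[OF x(3,1) L] by blast
  then obtain v k l r where m: "max_cand fcrit w v k l r" "Fop w = map_option (\<lambda>u'. canon (take k v @ u' @ drop (Suc l) v)) r"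
    using crit_op_max_cand[of fcrit w] unfolding Fop_def by blast
  then obtain u' where r: "r = Some u'" using max_cand_None[OF L _ x(3,1)] by (cases r) auto
  have "v \<sim> w" using m by (auto simp: max_cand_def crit_cands_def)
  then have "F_cls 1 w (take k v @ u' @ drop (Suc l) v)" using max_cand_F_rel[OF L] m(1) r unfolding F_cls_def by blast
  then have "(take k v @ u' @ drop (Suc l) v) \<sim> c" using c F_cls_unique by blast
  then show "Fop w = Some c" using m(2) r c by simp
qed

lemma flip_L2: "set w \<subseteq> L2 \<Longrightarrow> set (flip 1 w) \<subseteq> L2"
  by (auto simp: L2_def flip1_def)

lemma ecand_iff:
  assumes L: "set w \<subseteq> L2"
  shows "(v, k, l, r) \<in> crit_cands ecrit w \<longleftrightarrow> (flip 1 v, k, l, map_option (flip 1) r) \<in> crit_cands fcrit (flip 1 w)"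
proof (cases "v \<sim> w")
  case True
  have Lv: "set v \<subseteq> L2" using True L eqv_L2 by blast
  then have Lt: "set (take k v) \<subseteq> L2" using set_take_subset by fast
  have w: "walk_end (take k v) = iwalk 1 (take k v)" using Lt by (rule walk_end_L2)
  have "walk_end (flip 1 (take k v)) = iwalk 1 (flip 1 (take k v))"
    using walk_end_L2[OF flip_L2[OF Lt]] .
  also have "\<dots> = (snd (iwalk 1 (take k v)), fst (iwalk 1 (take k v)))" using wxy_flip[of 1 "take k v"] by (simp add: iwalk_wxy)
  finally have w2: "walk_end (flip 1 (take k v)) = (snd (iwalk 1 (take k v)), fst (iwalk 1 (take k v)))" .
  have "map_option (map_option (flip 1)) z = Some r \<longleftrightarrow> z = Some (map_option (flip 1) r)" for z
  proof -
    have "map_option (flip 1) (map_option (flip 1) y) = y" for y by (simp add: option.map_comp o_def option.map_ident)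
    then have "map_option (flip 1) y = r \<longleftrightarrow> y = map_option (flip 1) r" for y by metis
    then show ?thesis by (cases z) (simp_all only: option.map option.inject option.distinct)
  qed
  then have z: "map_option (map_option (flip 1)) z = Some r \<longleftrightarrow> z = Some (map_option (flip 1) r)" for z .
  show ?thesis unfolding crit_cands_def ecrit_fcrit mem_Collect_eq prod.case take_map drop_map w w2 eqv_flip_iff length_map z ..
next
  case False
  then show ?thesis unfolding crit_cands_def by (simp add: eqv_flip_iff)
qed

lemma E_max_cand:
  assumes L: "set w \<subseteq> L2" and m: "max_cand ecrit w v k l r"
  shows "max_cand fcrit (flip 1 w) (flip 1 v) k l (map_option (flip 1) r)"
proof -
  have inv: "map_option (flip 1) (map_option (flip 1) y) = y" for y by (simp add: option.map_comp o_def option.map_ident)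
  have "(flip 1 (flip 1 v'), k', l', map_option (flip 1) (map_option (flip 1) r')) \<in> crit_cands fcrit (flip 1 w)
     \<longleftrightarrow> (flip 1 v', k', l', map_option (flip 1) r') \<in> crit_cands ecrit w" for v' k' l' r'
    using ecand_iff[OF L] by blast
  then have "(v', k', l', r') \<in> crit_cands fcrit (flip 1 w)
     \<longleftrightarrow> (flip 1 v', k', l', map_option (flip 1) r') \<in> crit_cands ecrit w" for v' k' l' r'
    unfolding inv flip_flip .
  then show ?thesis using m ecand_iff[OF L] unfolding max_cand_def by blast
qed

text \<open>E is computed by F on the reflected word, and reflecting back reverses the relation of
  F; so E is its converse.\<close>

lemma Eop_iff:
  assumes L: "set w \<subseteq> L2"
  shows "Eop w = Some c \<longleftrightarrow> canon c = c \<and> F_cls 1 c w"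
proof
  assume "Eop w = Some c"
  then obtain v k l u' where m: "max_cand ecrit w v k l (Some u')" "c = canon (take k v @ u' @ drop (Suc l) v)"
    using crit_op_max_cand[of ecrit w] unfolding Eop_def by fastforce
  then have "v \<sim> w" by (auto simp: max_cand_def crit_cands_def)
  then have "(flip 1 v) \<sim> (flip 1 w)" by (rule eqv_flip)
  moreover have "F_rel 1 (flip 1 v) (flip 1 (take k v @ u' @ drop (Suc l) v))"
    using max_cand_F_rel[OF flip_L2[OF L], of "flip 1 v" k l "flip 1 u'"] E_max_cand[OF L m(1)] by (simp add: take_map drop_map)
  moreover have "(flip 1 (take k v @ u' @ drop (Suc l) v)) \<sim> (flip 1 c)"
    unfolding m(2) by (rule eqv_flip) simp
  ultimately have "F_cls 1 (flip 1 w) (flip 1 c)" unfolding F_cls_def by blast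
  then show "canon c = c \<and> F_cls 1 c w" using F_cls_flip[of 1 "flip 1 w" "flip 1 c"] m(2) by simp
next
  assume c: "canon c = c \<and> F_cls 1 c w"
  then have "F_cls 1 (flip 1 w) (flip 1 c)" using F_cls_flip by blast
  then obtain x x' where x: "x \<sim> (flip 1 w)" "x' \<sim> (flip 1 c)" "F_rel 1 x x'" by (auto simp: F_cls_def)
  obtain xk xl xr where "(x, xk, xl, xr) \<in> crit_cands fcrit (flip 1 w)"
    using F_rel_cand[OF x(3,1) flip_L2[OF L]] by blast
  then have "(flip 1 x, xk, xl, map_option (flip 1) xr) \<in> crit_cands ecrit w"
    unfolding ecand_iff[OF L] by (simp add: option.map_comp o_def option.map_ident)
  then have "crit_cands ecrit w \<noteq> {}" by blast
  then obtain v k l r where m: "max_cand ecrit w v k l r" "Eop w = map_option (\<lambda>u'. canon (take k v @ u' @ drop (Suc l) v)) r"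
    using crit_op_max_cand[of ecrit w] unfolding Eop_def by blast
  then obtain u' where r: "r = Some u'" using max_cand_None[OF flip_L2[OF L] _ x(3,1)] E_max_cand[OF L m(1)] by (cases r) auto
  have "v \<sim> w" using m by (auto simp: max_cand_def crit_cands_def)
  then have ev: "(flip 1 v) \<sim> (flip 1 w)" by (rule eqv_flip)
  have "F_rel 1 (flip 1 v) (flip 1 (take k v @ u' @ drop (Suc l) v))"
    using max_cand_F_rel[OF flip_L2[OF L], of "flip 1 v" k l "flip 1 u'"] E_max_cand[OF L m(1)] r by (simp add: take_map drop_map)
  then have "F_cls 1 (flip 1 w) (flip 1 (take k v @ u' @ drop (Suc l) v))" using ev unfolding F_cls_def by blast
  then have "(flip 1 (take k v @ u' @ drop (Suc l) v)) \<sim> (flip 1 c)"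
    using \<open>F_cls 1 (flip 1 w) (flip 1 c)\<close> F_cls_unique by blast
  then have "(take k v @ u' @ drop (Suc l) v) \<sim> c" unfolding eqv_flip_iff .
  then show "Eop w = Some c" using m(2) r c by simp
qed

section \<open>Standardization\<close>

text \<open>For p < j: the standardization gives position p a smaller value than position j. This involves the prime
  of a letter only if an earlier letter has the same kind, so it does not depend on the representative.\<close>

definition std_lt :: "word \<Rightarrow> nat \<Rightarrow> nat \<Rightarrow> bool" where
  "std_lt v p j \<longleftrightarrow> fst (v ! p) < fst (v ! j) \<or> fst (v ! p) = fst (v ! j) \<and> \<not> snd (v ! j)"

text \<open>For kind 0 truncated subtraction gives the primed and the unprimed letter the same
  \<open>lkey\<close>; from kind 1 on, the keys are distinct.\<close>

definition positive :: "word \<Rightarrow> bool" where "positive w \<longleftrightarrow> (\<forall>a\<in>set w. fst a \<ge> 1)"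

lemma lkey_less: "fst a \<ge> 1 \<Longrightarrow> lkey a < lkey b \<longleftrightarrow> fst a < fst b \<or> fst a = fst b \<and> snd a \<and> \<not> snd b"
  unfolding lkey_def by (cases "snd a"; cases "snd b"; simp; linarith)

lemma lkey_eq: "fst a \<ge> 1 \<Longrightarrow> fst b \<ge> 1 \<Longrightarrow> lkey a = lkey b \<longleftrightarrow> a = b"
  unfolding lkey_def prod_eq_iff by (cases "snd a"; cases "snd b"; simp; presburger)

text \<open>Ties go left to right between unprimed and right to left between primed letters. So
  within a kind the later letter alone decides: an unprimed one ranks above everything of its kind
  to its left, a primed one below.\<close>

lemma std_less_std_lt:
  assumes "positive v" "p < j" "j < length v"
  shows "std_less v p j \<longleftrightarrow> std_lt v p j" "std_less v j p \<longleftrightarrow> \<not> std_lt v p j"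
proof -
  have a: "fst (v ! p) \<ge> 1" "fst (v ! j) \<ge> 1" using assms by (auto simp: positive_def)
  note l = lkey_less[OF a(1), of "v ! j"] lkey_less[OF a(2), of "v ! p"] lkey_eq[OF a] lkey_eq[OF a(2,1)]
  show "std_less v p j \<longleftrightarrow> std_lt v p j"
    unfolding std_less_def std_lt_def l std_tb_def using assms(2) by (cases "v ! p"; cases "v ! j") auto
  show "std_less v j p \<longleftrightarrow> \<not> std_lt v p j"
    unfolding std_less_def std_lt_def l std_tb_def using assms(2) by (cases "v ! p"; cases "v ! j") auto
qed

lemma std_less_trans: "std_less v p j \<Longrightarrow> std_less v j k \<Longrightarrow> std_less v p k"
  by (auto simp: std_less_def)

lemma std_less_irrefl: "\<not> std_less v p p"
  by (simp add: std_less_def)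

lemma std_less_total: "positive v \<Longrightarrow> p < length v \<Longrightarrow> j < length v \<Longrightarrow> p \<noteq> j \<Longrightarrow> std_less v p j \<longleftrightarrow> \<not> std_less v j p"
  using std_less_std_lt[of v p j] std_less_std_lt[of v j p] by (cases "p < j") auto

lemma length_std [simp]: "length (std v) = length v" by (simp add: std_def)

lemma std_nth_less:
  assumes "positive v" "p < length v" "j < length v"
  shows "std v ! p < std v ! j \<longleftrightarrow> std_less v p j"
proof -
  let ?S = "\<lambda>j. {p. p < length v \<and> std_less v p j}"
  have lt: "card (?S p) < card (?S j)" if "p < length v" "std_less v p j" for p j
  proof (rule psubset_card_mono)
    show "finite (?S j)" by simp
    show "?S p \<subset> ?S j" using that std_less_trans[of v _ p j] std_less_irrefl[of v p] by blast
  qed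
  have "std v ! p = Suc (card (?S p))" "std v ! j = Suc (card (?S j))" using assms by (simp_all add: std_def)
  moreover have "card (?S p) < card (?S j) \<longleftrightarrow> std_less v p j"
    using lt[of p j] lt[of j p] std_less_total[of v p j] assms by (cases "p = j") (auto simp: std_less_irrefl)
  ultimately show ?thesis by simp
qed

lemma std_less_eq:
  assumes "positive v" "positive c" "length v = length c" "\<And>p j. p < j \<Longrightarrow> j < length v \<Longrightarrow> std_lt v p j \<longleftrightarrow> std_lt c p j"
    and "p < length v" "j < length v"
  shows "std_less v p j \<longleftrightarrow> std_less c p j"
  using std_less_std_lt[of v p j] std_less_std_lt[of v j p] std_less_std_lt[of c p j] std_less_std_lt[of c j p] assms(4)[of p j] assms(4)[of j p]
    std_less_irrefl[of v p] std_less_irrefl[of c p] assms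
  by (cases p j rule: linorder_cases) auto

lemma std_eq_iff:
  assumes "positive v" "positive c"
  shows "std v = std c \<longleftrightarrow> length v = length c \<and> (\<forall>p j. p < j \<longrightarrow> j < length v \<longrightarrow> std_lt v p j = std_lt c p j)"
proof
  assume e: "std v = std c"
  then have l: "length v = length c" by (metis length_std)
  have "std_lt v p j = std_lt c p j" if "p < j" "j < length v" for p j
    using std_nth_less[of v p j] std_nth_less[of c p j] std_less_std_lt[of v p j] std_less_std_lt[of c p j] assms that e l by auto
  then show "length v = length c \<and> (\<forall>p j. p < j \<longrightarrow> j < length v \<longrightarrow> std_lt v p j = std_lt c p j)" using l by blast
next
  assume a: "length v = length c \<and> (\<forall>p j. p < j \<longrightarrow> j < length v \<longrightarrow> std_lt v p j = std_lt c p j)"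
  then have "{p. p < length v \<and> std_less v p j} = {p. p < length c \<and> std_less c p j}" if "j < length v" for j
    using std_less_eq[OF assms] that by auto
  then show "std v = std c" unfolding std_def using a by (intro nth_equalityI) auto
qed

lemma canon_nth: "j < length w \<Longrightarrow> canon w ! j = (fst (w ! j), snd (w ! j) \<and> (\<exists>p<j. fst (w ! p) = fst (w ! j)))"
  by (simp add: canon_def)

lemma canon_eqI:
  assumes "length v = length w" "\<And>j. j < length w \<Longrightarrow> fst (v ! j) = fst (w ! j)"
    "\<And>p j. p < j \<Longrightarrow> j < length w \<Longrightarrow> fst (w ! p) = fst (w ! j) \<Longrightarrow> snd (v ! j) = snd (w ! j)"
  shows "v \<sim> w"
proof (rule nth_equalityI)
  fix j assume "j < length (canon v)"
  then have j: "j < length w" using assms by simp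
  have "(\<exists>p<j. fst (v ! p) = fst (v ! j)) \<longleftrightarrow> (\<exists>p<j. fst (w ! p) = fst (w ! j))"
    using assms(2) j by (metis order.strict_trans)
  then show "canon v ! j = canon w ! j" using assms j by (auto simp: canon_nth)
qed (use assms in simp)

lemma eqv_fst_nth: "v \<sim> w \<Longrightarrow> j < length w \<Longrightarrow> fst (v ! j) = fst (w ! j)"
  using canon_nth[of j v] canon_nth[of j w] eqv_length[of v w] by simp

lemma eqv_snd_nth: "v \<sim> w \<Longrightarrow> j < length w \<Longrightarrow> p < j \<Longrightarrow> fst (w ! p) = fst (w ! j) \<Longrightarrow> snd (v ! j) = snd (w ! j)"
  using canon_nth[of j v] canon_nth[of j w] eqv_length[of v w] eqv_fst_nth[of v w j] eqv_fst_nth[of v w p] by auto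

lemma eqv_std_lt:
  assumes "v \<sim> w" "p < j" "j < length w" shows "std_lt v p j = std_lt w p j"
  unfolding std_lt_def using assms eqv_fst_nth[of v w p] eqv_fst_nth[of v w j] eqv_snd_nth[of v w j p] by auto

lemma eqv_positive: "v \<sim> w \<Longrightarrow> positive w \<Longrightarrow> positive v"
  using eqv_fst_set[of v w] unfolding positive_def by (metis image_iff)

lemma eqv_std: "v \<sim> w \<Longrightarrow> positive w \<Longrightarrow> std v = std w"
  using std_eq_iff[of v w] eqv_positive[of v w] eqv_std_lt[of v w] eqv_length[of v w] by auto

lemma Fp_rel_nth: "Fp_rel i w w' \<Longrightarrow> \<exists>k<length w. w ! k = (i, False) \<and> w' = w[k := (Suc i, True)] \<and>
     (\<forall>j. k < j \<longrightarrow> j < length w \<longrightarrow> w ! j \<noteq> (i, False) \<and> w ! j \<noteq> (Suc i, True))"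
proof (induction rule: Fp_rel.induct)
  case (base p) then show ?case by (intro exI[of _ "length p"]) auto
next
  case (step w w' a)
  then obtain k where k: "k < length w" "w ! k = (i, False)" "w' = w[k := (Suc i, True)]"
     "\<forall>j. k < j \<longrightarrow> j < length w \<longrightarrow> w ! j \<noteq> (i, False) \<and> w ! j \<noteq> (Suc i, True)" by blast
  then show ?case using step(2,3)
    by (intro exI[of _ k]) (auto simp: nth_append list_update_append less_Suc_eq)
qed

lemma Fp_rel_if_neutral:
  assumes "\<forall>a\<in>set q. a \<noteq> (i, False) \<and> a \<noteq> (Suc i, True)"
  shows "Fp_rel i (p @ (i, False) # q) (p @ (Suc i, True) # q)"
  using assms
proof (induction q rule: rev_induct)
  case Nil then show ?case using Fp_rel.base by simp
next
  case (snoc a q)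
  then have "Fp_rel i ((p @ (i, False) # q) @ [a]) ((p @ (Suc i, True) # q) @ [a])" by (intro Fp_rel.step) auto
  then show ?case by simp
qed

text \<open>Later letters of kind i are primed and later letters of kind i+1 are unprimed. So the
  changed position ranks highest of kind i before the change and lowest of kind i+1 after it, and no
  comparison is altered.\<close>

lemma Fp_rel_std_lt:
  assumes "Fp_rel i w w'" "p < j" "j < length w"
  shows "std_lt w p j = std_lt w' p j"
proof -
  obtain k where k: "k < length w" "w ! k = (i, False)" "w' = w[k := (Suc i, True)]"
     "\<forall>j. k < j \<longrightarrow> j < length w \<longrightarrow> w ! j \<noteq> (i, False) \<and> w ! j \<noteq> (Suc i, True)" using Fp_rel_nth[OF assms(1)] by blast
  consider "k = j" | "k = p" | "k \<noteq> j" "k \<noteq> p" by blast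
  then show ?thesis
  proof cases
    case 1 then show ?thesis using k assms by (auto simp: std_lt_def)
  next
    case 2
    obtain b s where "w ! j = (b, s)" by force
    then show ?thesis using 2 k(1-3) k(4)[rule_format, of j] assms by (cases s) (auto simp: std_lt_def)
  next
    case 3 then show ?thesis using k by (auto simp: std_lt_def)
  qed
qed

lemma L2_positive: "set w \<subseteq> L2 \<Longrightarrow> positive w"
  by (auto simp: positive_def L2_def)

lemma Fp_rel_L2: "Fp_rel 1 w w' \<Longrightarrow> set w \<subseteq> L2 \<longleftrightarrow> set w' \<subseteq> L2"
  by (induction rule: Fp_rel.induct) (auto simp: L2_def numeral_2_eq_2)

lemma cnt_card: "cnt k w = card {j. j < length w \<and> fst (w ! j) = k}"
  by (simp add: cnt_def length_filter_conv_card)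

text \<open>The positions of kind 1 form an initial segment in the order of ranks, in
  \<open>w\<close> and in \<open>c\<close> alike. Equal standardizations make the two segments
  nested, so they differ in one position \<open>k\<close>, the top of kind 1 in \<open>w\<close> and
  the bottom of kind 2 in \<open>c\<close>. It remains to see that F' changes this position.\<close>

lemma std_Fp_cls:
  assumes Lw: "set w \<subseteq> L2" and Lc: "set c \<subseteq> L2" and std: "std c = std w" and cn: "cnt 1 w = Suc (cnt 1 c)"
  shows "Fp_cls 1 w c"
proof -
  let ?n = "length w"
  have pw: "positive w" "positive c" using Lw Lc L2_positive by auto
  have len: "length c = ?n" using std by (metis length_std)
  have std_lt: "std_lt c p j = std_lt w p j" if "p < j" "j < ?n" for p j
    using std_eq_iff[OF pw(2,1)] std len that by auto
  have sl: "std_less c p j = std_less w p j" if "p < ?n" "j < ?n" for p j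
    using std_less_eq[OF pw(2,1) len] std_lt that len by auto
  have kind: "fst (w ! j) = 1 \<or> fst (w ! j) = 2" "fst (c ! j) = 1 \<or> fst (c ! j) = 2" if "j < ?n" for j
  proof -
    have "w ! j \<in> L2" "c ! j \<in> L2" using Lw Lc that len nth_mem[of j w] nth_mem[of j c] by auto
    then show "fst (w ! j) = 1 \<or> fst (w ! j) = 2" "fst (c ! j) = 1 \<or> fst (c ! j) = 2" by (auto simp: L2_def)
  qed
  define A where "A = (\<lambda>v :: word. {j. j < ?n \<and> fst (v ! j) = 1})"
  have down: "p \<in> A v" if "positive v" "length v = ?n" "j \<in> A v" "p < ?n" "std_less v p j" for v p j
  proof -
    have "fst (v ! p) \<ge> 1" "fst (v ! j) = 1" using that by (auto simp: positive_def A_def)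
    then have "fst (v ! p) = 1" using that(5) lkey_less[of "v ! p" "v ! j"] lkey_eq[of "v ! p" "v ! j"]
      by (auto simp: std_less_def)
    then show ?thesis using that by (simp add: A_def)
  qed
  have fin: "finite (A w)" "finite (A c)" by (simp_all add: A_def)
  have card: "card (A w) = Suc (card (A c))" using cn len by (simp add: cnt_card A_def)
  have sub: "A c \<subseteq> A w"
  proof (rule ccontr)
    assume "\<not> ?thesis"
    then obtain a where a: "a \<in> A c" "a \<notin> A w" by blast
    have "\<not> A w \<subseteq> A c" using card card_mono[OF fin(2), of "A w"] by auto
    then obtain b where b: "b \<in> A w" "b \<notin> A c" by blast
    have "a < ?n" "b < ?n" "a \<noteq> b" using a b by (auto simp: A_def)
    then show False using std_less_total[OF pw(1), of a b] down[OF pw(1) refl b(1), of a] down[OF pw(2) len a(1), of b] sl a b by auto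
  qed
  then have "card (A w - A c) = 1" using card card_Diff_subset[OF fin(2) sub] by simp
  then obtain k where k: "A w - A c = {k}" by (auto simp: card_1_singleton_iff)
  then have kA: "k \<in> A w" "k \<notin> A c" "k < ?n" by (auto simp: A_def)
  have same: "j \<in> A w \<longleftrightarrow> j \<in> A c" if "j \<noteq> k" for j using k sub that by blast
  have bef: "std_less w j k" if "j \<in> A c" for j
  proof -
    have "j < ?n" "j \<noteq> k" using that kA by (auto simp: A_def)
    then show ?thesis using std_less_total[OF pw(1), of j k] down[OF pw(2) len that, of k] sl kA by auto
  qed
  have aft: "std_less w k j" if "j \<notin> A w" "j < ?n" for j
    using std_less_total[OF pw(1), of j k] down[OF pw(1) refl kA(1), of j] that kA by auto
  have fk: "fst (w ! k) = 1" "fst (c ! k) = 2" using kA kind(2)[of k] by (auto simp: A_def)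
  have kindeq: "fst (w ! j) = fst (c ! j)" if "j \<noteq> k" "j < ?n" for j
    using same[OF that(1)] kind[OF that(2)] that by (auto simp: A_def)
  let ?v = "canon w" and ?v' = "(canon w)[k := (2, True)]"
  \<comment> \<open>An earlier 1 ranks below \<open>k\<close>, which forces the letter at
    \<open>k\<close> to be unprimed; if there is no earlier 1, \<open>canon\<close> removes the
    prime.\<close>
  have "\<not> snd (w ! k)" if "p < k" "fst (w ! p) = 1" for p
  proof -
    have "p \<in> A c" using that kA same[of p] by (auto simp: A_def)
    then have "std_lt w p k" using bef std_less_std_lt[OF pw(1) that(1)] kA by auto
    then show ?thesis using that fk by (auto simp: std_lt_def)
  qed
  then have vk: "?v ! k = (1, False)" using kA fk by (auto simp: canon_nth)
  \<comment> \<open>A 2' that survives in \<open>?v\<close> has some 2 or 2' to its left in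
    \<open>w\<close>. In \<open>c\<close> it follows \<open>k\<close> of the same kind, hence is
    unprimed and ranks above that letter; the comparison carries back to \<open>w\<close>, where it
    says that the letter is unprimed.\<close>
  have neut2: "?v ! j \<noteq> (2, True)" if "k < j" "j < ?n" for j
  proof
    assume "?v ! j = (2, True)"
    then obtain p where p: "snd (w ! j)" "fst (w ! j) = 2" "p < j" "fst (w ! p) = 2"
      using canon_nth[OF \<open>j < ?n\<close>] by auto
    have "j \<notin> A w" using p by (simp add: A_def)
    then have "std_lt w k j" using aft[of j] std_less_std_lt[OF pw(1) that] that by simp
    then have "std_lt c k j" using std_lt that by simp
    moreover have "fst (c ! j) = 2" using kindeq[of j] that p by simp
    ultimately have "\<not> snd (c ! j)" using fk by (simp add: std_lt_def)
    moreover have "p \<noteq> k" using p fk by auto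
    then have "fst (c ! p) = 2" using kindeq[of p] p that by simp
    ultimately have "std_lt c p j" using \<open>fst (c ! j) = 2\<close> by (simp add: std_lt_def)
    then have "std_lt w p j" using std_lt p that by simp
    then show False using p by (simp add: std_lt_def)
  qed
  have neut1: "?v ! j \<noteq> (1, False)" if "k < j" "j < ?n" for j
  proof
    assume a: "?v ! j = (1, False)"
    then have f: "fst (w ! j) = 1" using that by (simp add: canon_nth)
    then have ns: "\<not> snd (w ! j)" using a that fk by (auto simp: canon_nth)
    have "j \<in> A c" using f same[of j] that by (auto simp: A_def)
    then have "\<not> std_lt w k j" using bef std_less_std_lt[OF pw(1) that] by simp
    then show False using fk f ns by (simp add: std_lt_def)
  qed
  have "Fp_rel 1 (take k ?v @ (1, False) # drop (Suc k) ?v) (take k ?v @ (Suc 1, True) # drop (Suc k) ?v)"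
  proof (rule Fp_rel_if_neutral, rule ballI)
    fix a assume "a \<in> set (drop (Suc k) ?v)"
    then obtain m where "m < ?n - Suc k" "a = ?v ! (Suc k + m)" by (auto simp: in_set_conv_nth)
    then show "a \<noteq> (1, False) \<and> a \<noteq> (Suc 1, True)" using neut1[of "Suc k + m"] neut2[of "Suc k + m"]
      by (auto simp: numeral_2_eq_2)
  qed
  moreover have "take k ?v @ (1, False) # drop (Suc k) ?v = ?v"
    using id_take_nth_drop[of k ?v] vk kA by simp
  moreover have "take k ?v @ (Suc 1, True) # drop (Suc k) ?v = ?v'"
    using kA by (simp add: upd_conv_take_nth_drop numeral_2_eq_2)
  ultimately have "Fp_rel 1 ?v ?v'" by simp
  moreover have "?v' \<sim> c"
  proof (rule canon_eqI)
    show "length ?v' = length c" using len by simp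
    show f: "fst (?v' ! j) = fst (c ! j)" if "j < length c" for j
      using that len kA fk kindeq[of j] by (cases "j = k") (auto simp: canon_nth)
    fix p j assume pj: "p < j" "j < length c" "fst (c ! p) = fst (c ! j)"
    then have jn: "j < ?n" "p < ?n" using len by auto
    consider "j = k" | "p = k" | "j \<noteq> k" "p \<noteq> k" by blast
    then show "snd (?v' ! j) = snd (c ! j)"
    proof cases
      case 1
      then have "p \<notin> A w" using pj fk same[of p] by (auto simp: A_def)
      then have "std_less w k p" using aft jn by blast
      then have "\<not> std_lt w p k" using std_less_std_lt[OF pw(1), of p k] pj 1 kA by auto
      then have "\<not> std_lt c p k" using std_lt pj 1 kA by auto
      then show ?thesis using 1 pj kA by (auto simp: std_lt_def)
    next
      case 2
      then have fj: "fst (c ! j) = 2" "fst (w ! j) = 2" using pj fk kindeq[of j] jn by auto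
      have "j \<notin> A w" using fj by (simp add: A_def)
      then have "std_lt w k j" using aft[of j] std_less_std_lt[OF pw(1), of k j] pj 2 jn by auto
      then have "std_lt c k j" using std_lt pj 2 jn by simp
      then have "\<not> snd (c ! j)" using fj fk by (simp add: std_lt_def)
      moreover have "\<not> snd (?v ! j)" using neut2[of j] fj pj 2 jn by (auto simp: canon_nth)
      ultimately show ?thesis using pj 2 by simp
    next
      case 3
      then have "fst (w ! p) = fst (w ! j)" using kindeq pj jn by auto
      then have "snd (c ! j) = snd (w ! j)" using std_lt[OF pj(1) jn(1)] pj by (simp add: std_lt_def)
      then show ?thesis using 3 jn pj \<open>fst (w ! p) = fst (w ! j)\<close> by (auto simp: canon_nth)
    qed
  qed
  ultimately show ?thesis unfolding Fp_cls_def by (metis canon_canon)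
qed

text \<open>F' stays within the two kinds, so knowing one of the words to lie in \<open>L2\<close>
  gives the other; the disjunction lets the lemma serve F' and E'.\<close>

lemma Fp_cls_std:
  assumes "Fp_cls 1 w c" "set w \<subseteq> L2 \<or> set c \<subseteq> L2"
  shows "set w \<subseteq> L2" "set c \<subseteq> L2" "std c = std w" "cnt 1 w = Suc (cnt 1 c)" "cnt 2 c = Suc (cnt 2 w)"
proof -
  obtain v v' where v: "v \<sim> w" "v' \<sim> c" "Fp_rel 1 v v'" using assms(1) by (auto simp: Fp_cls_def)
  have "set v \<subseteq> L2 \<or> set v' \<subseteq> L2" using assms(2) v eqv_L2 by blast
  then have L: "set v \<subseteq> L2" "set v' \<subseteq> L2" using Fp_rel_L2[OF v(3)] by auto
  then show Lw: "set w \<subseteq> L2" and Lc: "set c \<subseteq> L2" using v eqv_L2 by metis+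
  have "std v' = std v"
    using std_eq_iff[OF L2_positive[OF L(2)] L2_positive[OF L(1)]] Fp_rel_std_lt[OF v(3)] Fp_rel_length[OF v(3)] by auto
  then show "std c = std w" using eqv_std[OF v(1) L2_positive[OF Lw]] eqv_std[OF v(2) L2_positive[OF Lc]] by simp
  show "cnt 1 w = Suc (cnt 1 c)" "cnt 2 c = Suc (cnt 2 w)"
    using Fp_rel_cnt[OF v(3)] eqv_cnt[OF v(1)] eqv_cnt[OF v(2)] by (simp_all add: numeral_2_eq_2)
qed

lemma wt_cnt: "wt w j = int (cnt j w)"
  by (simp add: wt_def cnt_def)

lemma unique_option:
  assumes "\<And>c d. P c \<Longrightarrow> P d \<Longrightarrow> c = d"
  shows "((if \<exists>!c. P c then Some (THE c. P c) else None) = Some x) = P x"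
proof (cases "\<exists>c. P c")
  case True
  then obtain c where c: "P c" ..
  then have "\<exists>!c. P c" "(THE c. P c) = c" using assms by blast+
  then show ?thesis using c assms by auto
qed auto

lemma Fpop_iff:
  assumes L: "set w \<subseteq> L2"
  shows "Fpop w = Some c \<longleftrightarrow> canon c = c \<and> Fp_cls 1 w c"
proof -
  have P: "canon c = c \<and> set c \<subseteq> L2 \<and> std c = std w \<and> wt c 1 = wt w 1 - 1 \<and> wt c 2 = wt w 2 + 1
      \<longleftrightarrow> canon c = c \<and> Fp_cls 1 w c" for c
  proof (intro iffI conjI; elim conjE)
    assume "set c \<subseteq> L2" "std c = std w" "wt c 1 = wt w 1 - 1"
    moreover from this have "cnt 1 w = Suc (cnt 1 c)" by (simp add: wt_cnt)
    ultimately show "Fp_cls 1 w c" using std_Fp_cls[OF L] by blast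
  next
    assume "Fp_cls 1 w c"
    note f = Fp_cls_std[OF this disjI1[OF L]]
    show "set c \<subseteq> L2" "std c = std w" "wt c 1 = wt w 1 - 1" "wt c 2 = wt w 2 + 1"
      using f by (simp_all add: wt_cnt)
  qed
  have "((if \<exists>!c. canon c = c \<and> Fp_cls 1 w c then Some (THE c. canon c = c \<and> Fp_cls 1 w c) else None) = Some c) = (canon c = c \<and> Fp_cls 1 w c)"
    by (rule unique_option) (metis Fp_cls_unique)
  then show ?thesis unfolding Fpop_def Let_def P .
qed

lemma Epop_iff:
  assumes L: "set w \<subseteq> L2"
  shows "Epop w = Some c \<longleftrightarrow> canon c = c \<and> Fp_cls 1 c w"
proof -
  have P: "canon c = c \<and> set c \<subseteq> L2 \<and> std c = std w \<and> wt c 1 = wt w 1 + 1 \<and> wt c 2 = wt w 2 - 1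
      \<longleftrightarrow> canon c = c \<and> Fp_cls 1 c w" for c
  proof (intro iffI conjI; elim conjE)
    assume "set c \<subseteq> L2" "std c = std w" "wt c 1 = wt w 1 + 1"
    moreover from this have "cnt 1 c = Suc (cnt 1 w)" by (simp add: wt_cnt)
    ultimately show "Fp_cls 1 c w" using std_Fp_cls[OF _ L] by metis
  next
    assume "Fp_cls 1 c w"
    note f = Fp_cls_std[OF this disjI2[OF L]]
    show "set c \<subseteq> L2" "std c = std w" "wt c 1 = wt w 1 + 1" "wt c 2 = wt w 2 - 1"
      using f by (simp_all add: wt_cnt)
  qed
  have "((if \<exists>!c. canon c = c \<and> Fp_cls 1 c w then Some (THE c. canon c = c \<and> Fp_cls 1 c w) else None) = Some c) = (canon c = c \<and> Fp_cls 1 c w)"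
    by (rule unique_option) (metis Fp_cls_unique')
  then show ?thesis unfolding Epop_def Let_def P .
qed

section \<open>Restriction to the letters of kind i and i+1\<close>

text \<open>The complement of \<open>isub\<close>: letters of kinds i and i+1 are blanked but keep
  their places, so \<open>mask i w\<close> and \<open>isub i w\<close> together determine
  \<open>w\<close>.\<close>

definition mask :: "nat \<Rightarrow> word \<Rightarrow> letter option list" where
  "mask i w = map (\<lambda>a. if fst a = i \<or> fst a = Suc i then None else Some a) w"

lemma mask_snoc [simp]: "mask i (w @ [a]) = mask i w @ [if fst a = i \<or> fst a = Suc i then None else Some a]"
  by (simp add: mask_def)

lemma mask_length: "mask i x = mask i y \<Longrightarrow> length x = length y"
  unfolding mask_def by (rule map_eq_imp_length_eq)

lemma mask_isub_eq:
  assumes "mask i x = mask i y" "isub i x = isub i y"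
  shows "x = y"
  using mask_length[OF assms(1)] assms
proof (induction x y rule: rev_induct2)
  case (4 a x b y)
  then show ?case by (auto simp: relabel_def prod_eq_iff split: if_splits)
qed simp_all

lemma mask_kind:
  assumes "k \<noteq> i" "k \<noteq> Suc i" shows "k \<in> fst ` set w \<longleftrightarrow> (\<exists>s. Some (k, s) \<in> set (mask i w))"
  using assms by (force simp: mask_def image_iff)

text \<open>Whether a letter is the first of its kind depends on letters of that kind alone, so
  normalisation outside the two kinds does not see what is blanked.\<close>

lemma mask_canon: "mask i x = mask i y \<Longrightarrow> mask i (canon x) = mask i (canon y)"
proof (induction y arbitrary: x rule: rev_induct)
  case Nil then show ?case by (simp add: mask_def)
next
  case (snoc b y)
  then have "length x = Suc (length y)" using mask_length[of i x "y @ [b]"] by simp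
  then have "x \<noteq> []" by auto
  then obtain x0 a where x: "x = x0 @ [a]" by (metis rev_exhaust)
  with snoc.prems have e: "mask i x0 = mask i y"
    "(if fst a = i \<or> fst a = Suc i then None else Some a) = (if fst b = i \<or> fst b = Suc i then None else Some b)"
    by simp_all
  have "nrm x0 a = nrm y b" if "fst a \<noteq> i" "fst a \<noteq> Suc i"
  proof -
    have "a = b" using e(2) that by (auto split: if_splits)
    moreover have "fst a \<in> fst ` set x0 \<longleftrightarrow> fst a \<in> fst ` set y" using mask_kind[OF that] e(1) by simp
    ultimately show ?thesis by (simp add: nrm_def)
  qed
  moreover have "(fst a = i \<or> fst a = Suc i) \<longleftrightarrow> (fst b = i \<or> fst b = Suc i)" using e(2) by (auto split: if_splits)
  moreover note TrueI
  note AB = calculation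
  have n: "(if fst a = i \<or> fst a = Suc i then None else Some (nrm x0 a)) = (if fst b = i \<or> fst b = Suc i then None else Some (nrm y b))"
  proof (cases "fst a = i \<or> fst a = Suc i")
    case True
    then have "fst b = i \<or> fst b = Suc i" using AB(2) by blast
    then show ?thesis using True by (simp only: if_True)
  next
    case False
    then have "\<not> (fst b = i \<or> fst b = Suc i)" "nrm x0 a = nrm y b" using AB by blast+
    then show ?thesis using False by (simp only: if_False)
  qed
  show ?case unfolding x canon_snoc mask_snoc fst_nrm n snoc.IH[OF e(1)] ..
qed

lemma relabel_fst_eq: "fst a = i \<or> fst a = Suc i \<Longrightarrow> fst b = i \<or> fst b = Suc i \<Longrightarrow>
    fst (relabel i a) = fst (relabel i b) \<longleftrightarrow> fst a = fst b"
  by (elim disjE) (simp_all add: relabel_def)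

lemma isub_canon: "isub i (canon w) = canon (isub i w)"
proof (induction w rule: rev_induct)
  case (snoc a w)
  have "relabel i (nrm w a) = nrm (isub i w) (relabel i a)" if a: "fst a = i \<or> fst a = Suc i"
  proof -
    have "fst (relabel i a) \<in> fst ` set (isub i w) \<longleftrightarrow> fst a \<in> fst ` set w"
    proof
      assume "fst (relabel i a) \<in> fst ` set (isub i w)"
      then obtain b where b: "b \<in> set w" "fst b = i \<or> fst b = Suc i" "fst (relabel i a) = fst (relabel i b)"
        by (auto simp: isub_def)
      then show "fst a \<in> fst ` set w" using relabel_fst_eq[OF a b(2)] by auto
    next
      assume "fst a \<in> fst ` set w"
      then obtain b where b: "b \<in> set w" "fst a = fst b" by auto
      then have "relabel i b \<in> set (isub i w)" using a by (auto simp: isub_def)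
      moreover have "fst (relabel i a) = fst (relabel i b)" using b by (simp add: relabel_def)
      ultimately show "fst (relabel i a) \<in> fst ` set (isub i w)" by (metis image_eqI)
    qed
    then show ?thesis by (simp add: nrm_def relabel_def)
  qed
  then show ?case using snoc by auto
qed simp

lemma isub_in_L2: "set (isub i w) \<subseteq> L2"
  by (auto simp: isub_def relabel_def L2_def)

lemma canon_eq_mask:
  assumes "mask i x = mask i y" "(isub i x) \<sim> (isub i y)" shows "x \<sim> y"
  using mask_isub_eq[OF mask_canon[OF assms(1)]] assms(2) by (simp add: isub_canon)

lemma length_isub: "length (isub i w) = length (filter (\<lambda>a. a = None) (mask i w))"
proof -
  have "filter (\<lambda>a. a = None) (mask i w) = map (\<lambda>a. None) (filter (\<lambda>a. fst a = i \<or> fst a = Suc i) w)"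
    by (induction w) (auto simp: mask_def)
  then show ?thesis by (simp add: isub_def)
qed

definition place :: "nat \<Rightarrow> word \<Rightarrow> word \<Rightarrow> word" where
  "place i w s = (let ps = filter (\<lambda>j. fst (w ! j) = i \<or> fst (w ! j) = Suc i) [0..<length w] in
     foldl (\<lambda>v ja. v[fst ja := unrelabel i (snd ja)]) w (zip ps s))"

lemma isub_positions: "map (\<lambda>j. relabel i (w ! j)) (filter (\<lambda>j. fst (w ! j) = i \<or> fst (w ! j) = Suc i) [0..<length w]) = isub i w"
proof -
  have "filter (\<lambda>a. fst a = i \<or> fst a = Suc i) (map ((!) w) [0..<length w])
      = map ((!) w) (filter (\<lambda>j. fst (w ! j) = i \<or> fst (w ! j) = Suc i) [0..<length w])"
    by (simp add: filter_map o_def)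
  then show ?thesis by (simp add: isub_def map_nth)
qed

lemma lift_op_place: "lift_op op i w = map_option (\<lambda>s. canon (place i w s)) (op (isub i w))"
  unfolding lift_op_def Let_def isub_positions place_def by (simp split: option.split)

lemma foldl_upd:
  assumes "length s = length ps" "distinct ps" "\<forall>j\<in>set ps. j < length w"
  shows "let u = foldl (\<lambda>v ja. v[fst ja := f (snd ja)]) w (zip ps s) in
     length u = length w \<and> (\<forall>m<length ps. u ! (ps ! m) = f (s ! m)) \<and> (\<forall>j<length w. j \<notin> set ps \<longrightarrow> u ! j = w ! j)"
  using assms
proof (induction s ps arbitrary: w rule: list_induct2)
  case (Cons a s p ps)
  have IH: "let u = foldl (\<lambda>v ja. v[fst ja := f (snd ja)]) (w[p := f a]) (zip ps s) in
     length u = length (w[p := f a]) \<and> (\<forall>m<length ps. u ! (ps ! m) = f (s ! m)) \<and> (\<forall>j<length (w[p := f a]). j \<notin> set ps \<longrightarrow> u ! j = w[p := f a] ! j)"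
    by (intro Cons.IH) (use Cons.prems in auto)
  then show ?case using Cons.prems unfolding Let_def
    by (auto simp: nth_Cons split: nat.split)
qed (simp add: Let_def)

lemma place_spec:
  assumes "length s = length (isub i w)" "set s \<subseteq> L2"
  shows "mask i (place i w s) = mask i w" "isub i (place i w s) = s"
proof -
  let ?ps = "filter (\<lambda>j. fst (w ! j) = i \<or> fst (w ! j) = Suc i) [0..<length w]"
  let ?u = "place i w s"
  have l: "length s = length ?ps" using assms(1) unfolding isub_positions[of i w, symmetric] by simp
  have d: "distinct ?ps" "\<forall>j\<in>set ?ps. j < length w" by auto
  note f = foldl_upd[OF l d, of "unrelabel i", unfolded Let_def]
  have u: "length ?u = length w" "\<And>m. m < length ?ps \<Longrightarrow> ?u ! (?ps ! m) = unrelabel i (s ! m)"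
    "\<And>j. j < length w \<Longrightarrow> j \<notin> set ?ps \<Longrightarrow> ?u ! j = w ! j"
    using f unfolding place_def Let_def by blast+
  have on: "fst (?u ! (?ps ! m)) = i \<or> fst (?u ! (?ps ! m)) = Suc i" "relabel i (?u ! (?ps ! m)) = s ! m"
    if "m < length ?ps" for m
  proof -
    have "s ! m \<in> L2" using assms(2) that l by auto
    then show "fst (?u ! (?ps ! m)) = i \<or> fst (?u ! (?ps ! m)) = Suc i" "relabel i (?u ! (?ps ! m)) = s ! m"
      using u(2)[OF that] by (auto simp: L2_def unrelabel_def relabel_def)
  qed
  have on_iff: "fst (?u ! j) = i \<or> fst (?u ! j) = Suc i \<longleftrightarrow> fst (w ! j) = i \<or> fst (w ! j) = Suc i" if "j < length w" for j
  proof (cases "j \<in> set ?ps")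
    case True
    then obtain m where "m < length ?ps" "?ps ! m = j" unfolding in_set_conv_nth by blast
    then have "fst (?u ! j) = i \<or> fst (?u ! j) = Suc i" using on(1)[of m] by simp
    moreover have "fst (w ! j) = i \<or> fst (w ! j) = Suc i" using True by simp
    ultimately show ?thesis by blast
  next
    case False
    then show ?thesis using u(3) that by simp
  qed
  show "mask i ?u = mask i w"
  proof (rule nth_equalityI)
    fix j assume "j < length (mask i ?u)"
    then have j: "j < length w" using u by (simp add: mask_def)
    show "mask i ?u ! j = mask i w ! j"
      using on_iff[OF j] u(3)[OF j] u(1) j by (auto simp: mask_def)
  qed (simp add: mask_def u)
  have ps: "filter (\<lambda>j. fst (?u ! j) = i \<or> fst (?u ! j) = Suc i) [0..<length ?u] = ?ps"
    unfolding u(1) by (rule filter_cong) (use on_iff in auto)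
  have "isub i ?u = map (\<lambda>j. relabel i (?u ! j)) ?ps"
    using isub_positions[of i ?u] ps by simp
  also have "\<dots> = s" using on(2) l by (intro nth_equalityI) auto
  finally show "isub i ?u = s" .
qed

text \<open>Transfers the description of an operator on words in 1 and 2 to the index i. By
  \<open>e1\<close> the relation is seen by the subword and leaves the other letters alone; by
  \<open>e2\<close> a change of the subword lifts to the whole word. The relation is a parameter
  because E and E' need it reversed.\<close>

lemma lift_iff:
  assumes op: "\<And>s c. set s \<subseteq> L2 \<Longrightarrow> op s = Some c \<longleftrightarrow> canon c = c \<and> (\<exists>v v'. v \<sim> s \<and> v' \<sim> c \<and> R (1::nat) v v')"
    and e1: "\<And>v v'. R i v v' \<Longrightarrow> R 1 (isub i v) (isub i v') \<and> mask i v = mask i v'"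
    and e2: "\<And>v s. R 1 (isub i v) s \<Longrightarrow> \<exists>v'. R i v v' \<and> isub i v' = s"
  shows "lift_op op i w = Some c \<longleftrightarrow> canon c = c \<and> (\<exists>v v'. v \<sim> w \<and> v' \<sim> c \<and> R i v v')"
proof
  assume "lift_op op i w = Some c"
  then obtain s where s: "op (isub i w) = Some s" "c = canon (place i w s)" by (auto simp: lift_op_place)
  then obtain u u' where u: "canon s = s" "u \<sim> (isub i w)" "u' \<sim> s" "R 1 u u'"
    using op[OF isub_in_L2[of i w]] by auto
  have "length u = length (isub i w)" "set u \<subseteq> L2" using u(2) eqv_length eqv_L2 isub_in_L2 by blast+
  note x = place_spec[OF this]
  \<comment> \<open>Writing the representative \<open>u\<close> of the subword back into
    \<open>w\<close> gives a representative of \<open>w\<close>.\<close>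
  have cx: "(place i w u) \<sim> w" using canon_eq_mask[OF x(1)] x(2) u(2) by simp
  obtain x' where x': "R i (place i w u) x'" "isub i x' = u'" using e2[of "place i w u" u'] x(2) u(4) by auto
  have sx: "mask i x' = mask i w" using e1[OF x'(1)] x(1) by simp
  have "length s = length (isub i w)" using eqv_length[OF u(3)] x'(2) sx length_isub[of i x'] length_isub[of i w] by simp
  moreover have "set s \<subseteq> L2" using eqv_L2[OF u(3)[symmetric]] x'(2) isub_in_L2 by blast
  ultimately have p: "mask i (place i w s) = mask i w" "isub i (place i w s) = s" using place_spec by blast+
  have "x' \<sim> (place i w s)" using canon_eq_mask[of i x' "place i w s"] sx p x'(2) u(3) by simp
  then show "canon c = c \<and> (\<exists>v v'. v \<sim> w \<and> v' \<sim> c \<and> R i v v')"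
    using cx x'(1) s(2) by auto
next
  assume "canon c = c \<and> (\<exists>v v'. v \<sim> w \<and> v' \<sim> c \<and> R i v v')"
  then obtain v v' where c: "canon c = c" and v: "v \<sim> w" "v' \<sim> c" "R i v v'" by blast
  note e = e1[OF v(3)]
  let ?s = "canon (isub i v')"
  have "(isub i v) \<sim> (isub i w)" using v(1) by (metis isub_canon)
  then have "op (isub i w) = Some ?s" using op[OF isub_in_L2[of i w], of ?s] e by auto
  moreover have "canon (place i w ?s) = c"
  proof -
    have "length (isub i v) = length (isub i w)" using \<open>(isub i v) \<sim> (isub i w)\<close> eqv_length by blast
    then have "length ?s = length (isub i w)" using e length_isub[of i v] length_isub[of i v'] by simp
    moreover have "set ?s \<subseteq> L2" using eqv_L2[of ?s "isub i v'"] isub_in_L2 by simp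
    ultimately have p: "mask i (place i w ?s) = mask i w" "isub i (place i w ?s) = ?s" using place_spec by blast+
    have "(place i w ?s) \<sim> v'"
    proof (rule mask_isub_eq)
      have "mask i (canon (place i w ?s)) = mask i (canon v)" using mask_canon[OF p(1)] v(1) by simp
      also have "\<dots> = mask i (canon v')" using e mask_canon by blast
      finally show "mask i (canon (place i w ?s)) = mask i (canon v')" .
      show "isub i (canon (place i w ?s)) = isub i (canon v')" using p(2) by (simp add: isub_canon)
    qed
    then show ?thesis using v(2) c by simp
  qed
  ultimately show "lift_op op i w = Some c" by (simp add: lift_op_place)
qed

lemma wxy_isub: "wx 1 (isub i w) = wx i w \<and> wy 1 (isub i w) = wy i w"
proof -
  have "iwalk 1 (isub i w) = iwalk i w" using walk_end_L2[OF isub_in_L2[of i w]] walk_end_isub[of i w] by simp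
  then show ?thesis by (simp add: wx_def wy_def)
qed

lemma Fp_rel_isub: "Fp_rel i v v' \<Longrightarrow> Fp_rel 1 (isub i v) (isub i v') \<and> mask i v = mask i v'"
proof (induction rule: Fp_rel.induct)
  case (base p) then show ?case using Fp_rel.base[of 1 "isub i p"] by (simp add: relabel_def numeral_2_eq_2)
next
  case (step w w' a)
  have "relabel i a \<noteq> (1, False)" "relabel i a \<noteq> (Suc 1, True)" if "fst a = i \<or> fst a = Suc i"
    using that step by (auto simp: relabel_def prod_eq_iff)
  then show ?case using step Fp_rel.step[of 1 "isub i w" "isub i w'" "relabel i a"] by auto
qed

lemma F_rel_isub: "F_rel i v v' \<Longrightarrow> F_rel 1 (isub i v) (isub i v') \<and> mask i v = mask i v'"
proof (induction rule: F_rel.induct)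
  case (type1 w w') then show ?case using F_rel.type1[of 1 "isub i w" "isub i w'"] Fp_rel_isub[OF type1(1)] wxy_isub[of i w] by (simp add: relabel_def numeral_2_eq_2)
next
  case (type2 w w') then show ?case using F_rel.type2[of 1 "isub i w" "isub i w'"] Fp_rel_isub[OF type2(1)] wxy_isub[of i w] by (simp add: relabel_def numeral_2_eq_2)
next
  case (type3 p) then show ?case using F_rel.type3[of 1 "isub i p"] wxy_isub[of i p] by (simp add: relabel_def numeral_2_eq_2)
next
  case (type4 p) then show ?case using F_rel.type4[of 1 "isub i p"] wxy_isub[of i p] by (simp add: relabel_def numeral_2_eq_2)
next
  case (step w w' a)
  have "wx 1 (isub i w) \<ge> 2 \<and> wy 1 (isub i w) \<ge> 1 \<or> relabel i a \<noteq> (1, False) \<and> relabel i a \<noteq> (Suc 1, True)"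
    if "fst a = i \<or> fst a = Suc i"
    using that step(2) wxy_isub[of i w] by (auto simp: relabel_def prod_eq_iff)
  then show ?case using step F_rel.step[of 1 "isub i w" "isub i w'" "relabel i a"] by auto
qed

lemma relabel_eq: "fst a = i \<or> fst a = Suc i \<Longrightarrow> relabel i a = (Suc 0, s) \<longleftrightarrow> a = (i, s)"
  "fst a = i \<or> fst a = Suc i \<Longrightarrow> relabel i a = (Suc (Suc 0), s) \<longleftrightarrow> a = (Suc i, s)"
  by (auto simp: relabel_def prod_eq_iff)

lemma Fp_rel_embed: "Fp_rel 1 (isub i v) s \<Longrightarrow> \<exists>v'. Fp_rel i v v' \<and> isub i v' = s"
proof (induction v arbitrary: s rule: rev_induct)
  case Nil then show ?case by (auto elim: Fp_rel.cases)
next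
  case (snoc a v)
  show ?case
  proof (cases "fst a = i \<or> fst a = Suc i")
    case False
    then obtain v' where v': "Fp_rel i v v'" "isub i v' = s" using snoc by auto
    then have "Fp_rel i (v @ [a]) (v' @ [a])" using False by (intro Fp_rel.step) auto
    then show ?thesis using v' False by (intro exI[of _ "v' @ [a]"]) simp
  next
    case True
    then have "Fp_rel 1 (isub i v @ [relabel i a]) s" using snoc.prems by simp
    then show ?thesis
    proof (cases rule: Fp_rel.cases)
      case (base p)
      then have "a = (i, False)" using relabel_eq[OF True] by simp
      then show ?thesis using Fp_rel.base[of i v] base by (intro exI[of _ "v @ [(Suc i, True)]"]) (simp add: relabel_def numeral_2_eq_2)
    next
      case (step w w' b)
      then obtain v' where v': "Fp_rel i v v'" "isub i v' = w'" using snoc.IH by auto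
      have "Fp_rel i (v @ [a]) (v' @ [a])" using step v' relabel_eq[OF True] by (intro Fp_rel.step) auto
      then show ?thesis using v' step True by (intro exI[of _ "v' @ [a]"]) simp
    qed
  qed
qed

lemma F_rel_embed: "F_rel 1 (isub i v) s \<Longrightarrow> \<exists>v'. F_rel i v v' \<and> isub i v' = s"
proof (induction v arbitrary: s rule: rev_induct)
  case Nil then show ?case by (auto elim: F_rel.cases)
next
  case (snoc a v)
  show ?case
  proof (cases "fst a = i \<or> fst a = Suc i")
    case False
    then obtain v' where v': "F_rel i v v'" "isub i v' = s" using snoc by auto
    then have "F_rel i (v @ [a]) (v' @ [a])" using False by (intro F_rel.step) auto
    then show ?thesis using v' False by (intro exI[of _ "v' @ [a]"]) simp
  next
    case True
    then have "F_rel 1 (isub i v @ [relabel i a]) s" using snoc.prems by simp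
    then show ?thesis
    proof (cases rule: F_rel.cases)
      case (type1 w w')
      then have a: "a = (Suc i, True)" using relabel_eq[OF True] by simp
      obtain v' where v': "Fp_rel i v v'" "isub i v' = w'" using Fp_rel_embed[of i v w'] type1 by auto
      then have "F_rel i (v @ [a]) (v' @ [(Suc i, False)])" unfolding a using type1 wxy_isub[of i v] by (intro F_rel.type1) auto
      then show ?thesis using v' type1 by (intro exI[of _ "v' @ [(Suc i, False)]"]) (simp add: relabel_def numeral_2_eq_2)
    next
      case (type2 w w')
      then have a: "a = (i, True)" using relabel_eq[OF True] by simp
      obtain v' where v': "Fp_rel i v v'" "isub i v' = w'" using Fp_rel_embed[of i v w'] type2 by auto
      then have "F_rel i (v @ [a]) (v' @ [(i, False)])" unfolding a using type2 wxy_isub[of i v] by (intro F_rel.type2) auto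
      then show ?thesis using v' type2 by (intro exI[of _ "v' @ [(i, False)]"]) (simp add: relabel_def numeral_2_eq_2)
    next
      case (type3 p)
      then have a: "a = (i, False)" using relabel_eq[OF True] by simp
      have "F_rel i (v @ [a]) (v @ [(Suc i, False)])" unfolding a using type3 wxy_isub[of i v] by (intro F_rel.type3) auto
      then show ?thesis using type3 by (intro exI[of _ "v @ [(Suc i, False)]"]) (simp add: relabel_def numeral_2_eq_2)
    next
      case (type4 p)
      then have a: "a = (i, True)" using relabel_eq[OF True] by simp
      have "F_rel i (v @ [a]) (v @ [(Suc i, True)])" unfolding a using type4 wxy_isub[of i v] by (intro F_rel.type4) auto
      then show ?thesis using type4 by (intro exI[of _ "v @ [(Suc i, True)]"]) (simp add: relabel_def numeral_2_eq_2)
    next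
      case (step w w' b)
      then obtain v' where v': "F_rel i v v'" "isub i v' = w'" using snoc.IH by auto
      have "F_rel i (v @ [a]) (v' @ [a])" using step v' relabel_eq[OF True] wxy_isub[of i v] by (intro F_rel.step) auto
      then show ?thesis using v' step True by (intro exI[of _ "v' @ [a]"]) simp
    qed
  qed
qed

lemma isub_flip: "isub i (flip i w) = flip 1 (isub i w)"
  by (induction w rule: rev_induct) (auto simp: flip1_def relabel_def)

text \<open>Reflection exchanges source and target, so lifting a preimage reduces to lifting an
  image.\<close>

lemma Fp_rel_embed': assumes "Fp_rel 1 s (isub i v')" shows "\<exists>v. Fp_rel i v v' \<and> isub i v = s"
proof -
  have "Fp_rel 1 (isub i (flip i v')) (flip 1 s)" using Fp_rel_flip[OF assms] by (simp add: isub_flip)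
  then obtain z where z: "Fp_rel i (flip i v') z" "isub i z = flip 1 s" using Fp_rel_embed by blast
  then have "Fp_rel i (flip i z) v'" "isub i (flip i z) = s" using Fp_rel_flip[OF z(1)] by (simp_all add: isub_flip)
  then show ?thesis by blast
qed

lemma F_rel_embed': assumes "F_rel 1 s (isub i v')" shows "\<exists>v. F_rel i v v' \<and> isub i v = s"
proof -
  have "F_rel 1 (isub i (flip i v')) (flip 1 s)" using F_rel_flip[OF assms] by (simp add: isub_flip)
  then obtain z where z: "F_rel i (flip i v') z" "isub i z = flip 1 s" using F_rel_embed by blast
  then have "F_rel i (flip i z) v'" "isub i (flip i z) = s" using F_rel_flip[OF z(1)] by (simp_all add: isub_flip)
  then show ?thesis by blast
qed

lemma F_i_iff: "F_i i w = Some c \<longleftrightarrow> canon c = c \<and> F_cls i w c"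
  unfolding F_i_def F_cls_def
  proof (rule lift_iff, goal_cases)
    case 1 then show ?case by (simp add: Fop_iff F_cls_def; blast)
  next
    case 2 then show ?case using F_rel_isub by force
  next
    case 3 then show ?case using F_rel_embed by blast
  qed

lemma Fp_i_iff: "Fp_i i w = Some c \<longleftrightarrow> canon c = c \<and> Fp_cls i w c"
  unfolding Fp_i_def Fp_cls_def
  proof (rule lift_iff, goal_cases)
    case 1 then show ?case by (simp add: Fpop_iff Fp_cls_def; blast)
  next
    case 2 then show ?case using Fp_rel_isub by force
  next
    case 3 then show ?case using Fp_rel_embed by blast
  qed

lemma E_i_iff: "E_i i w = Some c \<longleftrightarrow> canon c = c \<and> F_cls i c w"
proof -
  have "lift_op Eop i w = Some c \<longleftrightarrow> canon c = c \<and> (\<exists>v v'. v \<sim> w \<and> v' \<sim> c \<and> (\<lambda>i v v'. F_rel i v' v) i v v')"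
    proof (rule lift_iff, goal_cases)
    case 1 then show ?case by (simp add: Eop_iff F_cls_def; blast)
  next
    case 2 then show ?case using F_rel_isub by force
  next
    case 3 then show ?case using F_rel_embed' by blast
  qed
  then show ?thesis unfolding E_i_def F_cls_def by blast
qed

lemma Ep_i_iff: "Ep_i i w = Some c \<longleftrightarrow> canon c = c \<and> Fp_cls i c w"
proof -
  have "lift_op Epop i w = Some c \<longleftrightarrow> canon c = c \<and> (\<exists>v v'. v \<sim> w \<and> v' \<sim> c \<and> (\<lambda>i v v'. Fp_rel i v' v) i v v')"
    proof (rule lift_iff, goal_cases)
    case 1 then show ?case by (simp add: Epop_iff Fp_cls_def; blast)
  next
    case 2 then show ?case using Fp_rel_isub by force
  next
    case 3 then show ?case using Fp_rel_embed' by blast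
  qed
  then show ?thesis unfolding Ep_i_def Fp_cls_def by blast
qed

section \<open>Commutation of the four operators\<close>

lemmas op_iff = F_i_iff E_i_iff Fp_i_iff Ep_i_iff

text \<open>Both compositions return the class of \<open>w\<close>, by uniqueness of preimages and
  of images.\<close>

lemma comm_FE:
  "F_i i w = Some v \<Longrightarrow> E_i i v = Some b \<Longrightarrow> E_i i w = Some u \<Longrightarrow> F_i i u = Some a \<Longrightarrow> a = b"
  unfolding op_iff by (metis F_cls_unique F_cls_unique')

lemma comm_FpEp:
  "Fp_i i w = Some v \<Longrightarrow> Ep_i i v = Some b \<Longrightarrow> Ep_i i w = Some u \<Longrightarrow> Fp_i i u = Some a \<Longrightarrow> a = b"
  unfolding op_iff by (metis Fp_cls_unique Fp_cls_unique')

lemma comm_FFp: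
  "F_i i w = Some v \<Longrightarrow> Fp_i i v = Some b \<Longrightarrow> Fp_i i w = Some u \<Longrightarrow> F_i i u = Some a \<Longrightarrow> a = b"
  unfolding op_iff by (metis Fp_cls_unique Fp_cls_F_cls_comm)

lemma comm_EEp:
  "E_i i w = Some v \<Longrightarrow> Ep_i i v = Some b \<Longrightarrow> Ep_i i w = Some u \<Longrightarrow> E_i i u = Some a \<Longrightarrow> a = b"
  unfolding op_iff by (metis Fp_cls_unique' Fp_cls_F_cls_comm')

text \<open>The square entered at \<open>u\<close>: F' leads from \<open>u\<close> to
  \<open>w\<close>, F from \<open>u\<close> to \<open>a\<close> and from \<open>w\<close> to
  \<open>v\<close>. Hence F' leads from \<open>a\<close> to \<open>v\<close>, as it does from
  \<open>b\<close>.\<close>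

lemma comm_FEp:
  "F_i i w = Some v \<Longrightarrow> Ep_i i v = Some b \<Longrightarrow> Ep_i i w = Some u \<Longrightarrow> F_i i u = Some a \<Longrightarrow> a = b"
  unfolding op_iff by (metis Fp_cls_unique' Fp_cls_F_cls_comm)

lemma comm_EFp:
  "E_i i w = Some v \<Longrightarrow> Fp_i i v = Some b \<Longrightarrow> Fp_i i w = Some u \<Longrightarrow> E_i i u = Some a \<Longrightarrow> a = b"
  unfolding op_iff by (metis Fp_cls_unique Fp_cls_F_cls_comm')

lemma commute:
  assumes P: "P \<in> set [F_i i, E_i i, Fp_i i, Ep_i i]" and Q: "Q \<in> set [F_i i, E_i i, Fp_i i, Ep_i i]"
    and "Option.bind (Q w) P = Some a" "Option.bind (P w) Q = Some b"
  shows "a = b"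
proof -
  obtain u v where u: "Q w = Some u" "P u = Some a" and v: "P w = Some v" "Q v = Some b"
    using assms(3,4) by (auto split: Option.bind_splits)
  show ?thesis
  proof (cases "P = Q")
    case True
    then show ?thesis using u v by simp
  next
    case False
    then show ?thesis using P Q u v
      by (auto dest: comm_FE comm_FpEp comm_FFp comm_EEp comm_FEp comm_EFp)
  qed
qed

section \<open>Shifted tableaux\<close>

text \<open>For a left of b, and in \<open>colok\<close> for a above b, weak increase and the ban on
  repetition are merged: equal letters must be unprimed in a row and primed in a column.\<close>

definition rowok :: "letter \<Rightarrow> letter \<Rightarrow> bool" where
  "rowok a b \<longleftrightarrow> fst a < fst b \<or> fst a = fst b \<and> \<not> snd b"
definition colok :: "letter \<Rightarrow> letter \<Rightarrow> bool" where
  "colok a b \<longleftrightarrow> fst a < fst b \<or> fst a = fst b \<and> snd a"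

lemma rowok_trans: "rowok a b \<Longrightarrow> rowok b c \<Longrightarrow> rowok a c"
  by (auto simp: rowok_def)
lemma colok_trans: "colok a b \<Longrightarrow> colok b c \<Longrightarrow> colok a c"
  by (auto simp: colok_def)

lemma rowok_lkey: "fst a \<ge> 1 \<Longrightarrow> fst b \<ge> 1 \<Longrightarrow> rowok a b \<longleftrightarrow> lkey a \<le> lkey b \<and> (snd a \<longrightarrow> a \<noteq> b)"
  using lkey_less[of a b] lkey_eq[of a b] unfolding rowok_def le_less by (cases a; cases b) auto
lemma colok_lkey: "fst a \<ge> 1 \<Longrightarrow> fst b \<ge> 1 \<Longrightarrow> colok a b \<longleftrightarrow> lkey a \<le> lkey b \<and> (\<not> snd a \<longrightarrow> a \<noteq> b)"
  using lkey_less[of a b] lkey_eq[of a b] unfolding colok_def le_less by (cases a; cases b) auto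

definition bef :: "nat \<times> nat \<Rightarrow> nat \<times> nat \<Rightarrow> bool" where
  "bef p q \<longleftrightarrow> fst p > fst q \<or> fst p = fst q \<and> snd p < snd q"

lemma part_dec:
  assumes "strict_partition la" "1 \<le> r" "part la (Suc r) > 0"
  shows "part la (Suc r) < part la r"
proof -
  have "Suc r \<le> length la" using assms(3) by (auto simp: part_def split: if_splits)
  then have "la ! r < la ! (r - 1)"
    using assms(1,2) sorted_wrt_nth_less[of "(>)" la "r - 1" r] by (auto simp: strict_partition_def)
  then show ?thesis using assms(2) \<open>Suc r \<le> length la\<close> by (simp add: part_def)
qed

locale shape =
  fixes la mu :: "nat list"
  assumes sla: "strict_partition la" and smu: "strict_partition mu" and con: "part_contained mu la"
begin

abbreviation S where "S \<equiv> cells la mu"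

lemma in_S: "(r, c) \<in> S \<longleftrightarrow> 1 \<le> r \<and> r \<le> length la \<and> r + part mu r \<le> c \<and> c < r + part la r"
  by (auto simp: cells_def row_cols_def)

text \<open>Strictness of the partition pays for the indentation of the next row. For an empty row
  the formula for its end would be meaningless, hence the positivity assumption.\<close>

lemma row_end: "1 \<le> r \<Longrightarrow> part la (Suc r) > 0 \<Longrightarrow> Suc r + part la (Suc r) \<le> r + part la r"
  using part_dec[OF sla, of r] by simp

lemma row_end': "1 \<le> r \<Longrightarrow> r \<le> s \<Longrightarrow> part la s > 0 \<Longrightarrow> s + part la s \<le> r + part la r"
proof (induction "s - r" arbitrary: s)
  case (Suc m)
  then obtain s' where s: "s = Suc s'" "r \<le> s'" by (cases s) auto
  then have a: "s + part la s \<le> s' + part la s'" "part la s' > 0"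
    using row_end[of s'] part_dec[OF sla, of s'] Suc by auto
  moreover have "m = s' - r" using Suc(2) s by simp
  ultimately have "s' + part la s' \<le> r + part la r" using Suc(1)[of s'] s Suc by simp
  then show ?case using a by simp
qed simp

lemma row_start: "1 \<le> r \<Longrightarrow> part mu (Suc r) > 0 \<Longrightarrow> Suc r + part mu (Suc r) \<le> r + part mu r"
  using part_dec[OF smu, of r] by simp

lemma row_start': "1 \<le> r \<Longrightarrow> r \<le> s \<Longrightarrow> part mu s > 0 \<Longrightarrow> s + part mu s \<le> r + part mu r"
proof (induction "s - r" arbitrary: s)
  case (Suc m)
  then obtain s' where s: "s = Suc s'" "r \<le> s'" by (cases s) auto
  then have a: "s + part mu s \<le> s' + part mu s'" "part mu s' > 0"
    using row_start[of s'] part_dec[OF smu, of s'] Suc by auto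
  moreover have "m = s' - r" using Suc(2) s by simp
  ultimately have "s' + part mu s' \<le> r + part mu r" using Suc(1)[of s'] s Suc by simp
  then show ?case using a by simp
qed simp

lemma S_row: "(r, c) \<in> S \<Longrightarrow> (r, c'') \<in> S \<Longrightarrow> c \<le> c' \<Longrightarrow> c' \<le> c'' \<Longrightarrow> (r, c') \<in> S"
  by (auto simp: in_S)

lemma S_col: assumes "(r, c) \<in> S" "(r'', c) \<in> S" "r \<le> r'" "r' \<le> r''" shows "(r', c) \<in> S"
proof -
  have "part la r'' > 0" using assms by (auto simp: in_S)
  then have "r'' + part la r'' \<le> r' + part la r'" using row_end'[of r' r''] assms by (auto simp: in_S)
  moreover have "r' + part mu r' \<le> c"
    using row_start'[of r r'] assms by (cases "part mu r' = 0") (auto simp: in_S)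
  ultimately show ?thesis using assms by (auto simp: in_S)
qed

lemma S_above_right: assumes "(r, c) \<in> S" "(Suc r, c') \<in> S" "c \<le> c'" shows "(r, c') \<in> S"
proof -
  have "part la (Suc r) > 0" using assms by (auto simp: in_S)
  then show ?thesis using row_end[of r] assms by (auto simp: in_S)
qed

text \<open>If row r+1 of mu were nonempty, row r of the skew shape would start no further left than
  row r+1; so the missing cell lies left of the main diagonal. From row r+1 on nothing is removed,
  and in such a shape every cell has a cell of row r+1 in its column.\<close>

lemma S_diag:
  assumes "(r, c') \<in> S" "(Suc r, c) \<in> S" "c' < c" "(Suc r, c') \<notin> S"
  shows "c' = r" "(Suc r, Suc r) \<in> S" "\<And>s d. (s, d) \<in> S \<Longrightarrow> s > r \<Longrightarrow> s \<le> d \<and> (Suc r, d) \<in> S"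
proof -
  have n: "c' < Suc r + part mu (Suc r)" using assms by (auto simp: in_S)
  have m0: "part mu (Suc r) = 0"
  proof (rule ccontr)
    assume "part mu (Suc r) \<noteq> 0"
    then show False using row_start[of r] n assms(1) by (auto simp: in_S)
  qed
  then show "c' = r" "(Suc r, Suc r) \<in> S" using n assms by (auto simp: in_S)
  fix s d assume s: "(s, d) \<in> S" "s > r"
  then have "s + part la s \<le> Suc r + part la (Suc r)" using row_end'[of "Suc r" s] by (auto simp: in_S)
  then show "s \<le> d \<and> (Suc r, d) \<in> S" using s m0 assms(2) by (auto simp: in_S)
qed

section \<open>Cells in reading order\<close>

definition clist :: "(nat \<times> nat) list" where
  "clist = concat (map (\<lambda>r. map (Pair r) (row_cols la mu r)) (rev [1..<Suc (length la)]))"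

lemma reading_clist: "reading la mu t = map t clist"
  by (simp add: reading_def clist_def map_concat o_def del: upt_Suc)

lemma set_clist: "set clist = S"
proof -
  have "set clist = {(r, c). r \<in> {1..<Suc (length la)} \<and> c \<in> set (row_cols la mu r)}"
    unfolding clist_def by (simp del: upt_Suc add: set_eq_iff image_iff)
  then show ?thesis by (auto simp: cells_def)
qed

lemma sorted_clist: "sorted_wrt bef clist"
proof -
  have "sorted_wrt bef (concat (map (\<lambda>r. map (Pair r) (f r)) rs))"
    if "sorted_wrt (>) rs" "\<And>r. sorted_wrt (<) (f r)" for f and rs :: "nat list"
    using that
  proof (induction rs)
    case (Cons r rs)
    have "sorted_wrt bef (map (Pair r) (f r))" using Cons.prems(2)[of r] by (simp add: sorted_wrt_map bef_def)
    moreover have "sorted_wrt bef (concat (map (\<lambda>r. map (Pair r) (f r)) rs))" using Cons by simp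
    moreover have "bef x y" if "x \<in> set (map (Pair r) (f r))" "y \<in> set (concat (map (\<lambda>r. map (Pair r) (f r)) rs))" for x y
      using that Cons.prems(1) by (auto simp: bef_def)
    ultimately show ?case unfolding list.map concat.simps sorted_wrt_append by blast
  qed simp
  moreover have "sorted_wrt (>) (rev [1..<Suc (length la)])"
    by (simp add: sorted_wrt_rev del: upt_Suc)
  moreover have "sorted_wrt (<) (row_cols la mu r)" for r by (simp add: row_cols_def)
  ultimately show ?thesis unfolding clist_def by blast
qed

lemma bef_asym: "bef p q \<Longrightarrow> \<not> bef q p" by (auto simp: bef_def)
lemma nth_bef: "p < j \<Longrightarrow> j < length clist \<Longrightarrow> bef (clist ! p) (clist ! j)"
  using sorted_wrt_nth_less[OF sorted_clist] .

lemma nth_inj: "p < length clist \<Longrightarrow> j < length clist \<Longrightarrow> clist ! p = clist ! j \<Longrightarrow> p = j"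
  using nth_bef[of p j] nth_bef[of j p] bef_asym by (metis linorder_neqE_nat)

definition idx :: "nat \<times> nat \<Rightarrow> nat" where
  "idx z = (THE p. p < length clist \<and> clist ! p = z)"

lemma idx_nth: "p < length clist \<Longrightarrow> idx (clist ! p) = p"
  unfolding idx_def using nth_inj by blast

lemma idx_S: assumes "z \<in> S" shows "idx z < length clist" "clist ! idx z = z"
proof -
  obtain p where "p < length clist" "clist ! p = z" using assms set_clist by (metis in_set_conv_nth)
  then show "idx z < length clist" "clist ! idx z = z" using idx_nth by auto
qed

lemma nth_S: "p < length clist \<Longrightarrow> clist ! p \<in> S"
  using set_clist nth_mem by blast

lemma idx_less: "z \<in> S \<Longrightarrow> z' \<in> S \<Longrightarrow> idx z < idx z' \<longleftrightarrow> bef z z'"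
  using nth_bef[of "idx z" "idx z'"] nth_bef[of "idx z'" "idx z"] idx_S bef_asym
  by (metis linorder_neqE_nat)

lemma idx_eq: "z \<in> S \<Longrightarrow> z' \<in> S \<Longrightarrow> idx z = idx z' \<longleftrightarrow> z = z'"
  using idx_S by metis

lemma idx_Suc: assumes "(r, c) \<in> S" "(r, Suc c) \<in> S" shows "idx (r, Suc c) = Suc (idx (r, c))"
proof (rule ccontr)
  assume n: "idx (r, Suc c) \<noteq> Suc (idx (r, c))"
  have "idx (r, c) < idx (r, Suc c)" using idx_less assms by (simp add: bef_def)
  then have l: "Suc (idx (r, c)) < idx (r, Suc c)" using n by simp
  let ?q = "clist ! Suc (idx (r, c))"
  have len: "Suc (idx (r, c)) < length clist" using l idx_S(1)[OF assms(2)] by simp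
  have "bef (r, c) ?q" "bef ?q (r, Suc c)"
    using nth_bef[of "idx (r, c)" "Suc (idx (r, c))"] nth_bef[OF l idx_S(1)[OF assms(2)]] len idx_S(2)[OF assms(1)] idx_S(2)[OF assms(2)] by auto
  then show False by (cases ?q) (auto simp: bef_def)
qed

text \<open>Only neighbouring cells are compared: \<open>rowok\<close> and \<open>colok\<close> are
  transitive and the shape is convex along rows and columns, so all pairs are covered.\<close>

definition tableau :: "nat \<Rightarrow> (nat \<times> nat \<Rightarrow> letter) \<Rightarrow> bool" where
  "tableau n t \<longleftrightarrow> (\<forall>z\<in>S. 1 \<le> fst (t z) \<and> fst (t z) \<le> n) \<and>
     (\<forall>r c. (r, c) \<in> S \<longrightarrow> (r, Suc c) \<in> S \<longrightarrow> rowok (t (r, c)) (t (r, Suc c))) \<and>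
     (\<forall>r c. (r, c) \<in> S \<longrightarrow> (Suc r, c) \<in> S \<longrightarrow> colok (t (r, c)) (t (Suc r, c)))"

lemma tableau_row:
  assumes "tableau n t" "(r, c) \<in> S" "(r, c') \<in> S" "c < c'"
  shows "rowok (t (r, c)) (t (r, c'))"
proof -
  have "(r, Suc (c + m)) \<in> S \<Longrightarrow> rowok (t (r, c)) (t (r, Suc (c + m)))" for m
  proof (induction m)
    case 0 then show ?case using assms(1,2) by (auto simp: tableau_def)
  next
    case (Suc m)
    have i: "(r, Suc (c + m)) \<in> S" using S_row[OF assms(2) Suc.prems] by simp
    then have "rowok (t (r, Suc (c + m))) (t (r, Suc (Suc (c + m))))" using Suc.prems assms(1) by (auto simp: tableau_def)
    then show ?case using Suc.IH[OF i] rowok_trans by auto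
  qed
  from this[of "c' - Suc c"] show ?thesis using assms by simp
qed

lemma tableau_col:
  assumes "tableau n t" "(r, c) \<in> S" "(r', c) \<in> S" "r < r'"
  shows "colok (t (r, c)) (t (r', c))"
proof -
  have "(Suc (r + m), c) \<in> S \<Longrightarrow> colok (t (r, c)) (t (Suc (r + m), c))" for m
  proof (induction m)
    case 0 then show ?case using assms(1,2) by (auto simp: tableau_def)
  next
    case (Suc m)
    have i: "(Suc (r + m), c) \<in> S" using S_col[OF assms(2) Suc.prems] by simp
    then have "colok (t (Suc (r + m), c)) (t (Suc (Suc (r + m)), c))" using Suc.prems assms(1) by (auto simp: tableau_def)
    then show ?case using Suc.IH[OF i] colok_trans by auto
  qed
  from this[of "r' - Suc r"] show ?thesis using assms by simp
qed

lemma is_shst_tableau: "is_shst la mu n t \<longleftrightarrow> tableau n t"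
proof
  assume a: "is_shst la mu n t"
  then have f: "\<forall>z\<in>S. 1 \<le> fst (t z) \<and> fst (t z) \<le> n"
   and rl: "\<And>r c c'. (r, c) \<in> S \<Longrightarrow> (r, c') \<in> S \<Longrightarrow> c < c' \<Longrightarrow> lkey (t (r, c)) \<le> lkey (t (r, c'))"
   and clist: "\<And>r r' c. (r, c) \<in> S \<Longrightarrow> (r', c) \<in> S \<Longrightarrow> r < r' \<Longrightarrow> lkey (t (r, c)) \<le> lkey (t (r', c))"
   and cn: "\<And>r r' c. (r, c) \<in> S \<Longrightarrow> (r', c) \<in> S \<Longrightarrow> r \<noteq> r' \<Longrightarrow> \<not> snd (t (r, c)) \<Longrightarrow> t (r, c) \<noteq> t (r', c)"
   and rn: "\<And>r c c'. (r, c) \<in> S \<Longrightarrow> (r, c') \<in> S \<Longrightarrow> c \<noteq> c' \<Longrightarrow> snd (t (r, c)) \<Longrightarrow> t (r, c) \<noteq> t (r, c')"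
    unfolding is_shst_def by blast+
  show "tableau n t" unfolding tableau_def
  proof (intro conjI allI impI f)
    fix r c assume z: "(r, c) \<in> S" "(r, Suc c) \<in> S"
    show "rowok (t (r, c)) (t (r, Suc c))"
      using f z rl[OF z] rn[OF z] rowok_lkey[of "t (r, c)" "t (r, Suc c)"] by auto
  next
    fix r c assume z: "(r, c) \<in> S" "(Suc r, c) \<in> S"
    show "colok (t (r, c)) (t (Suc r, c))"
      using f z clist[OF z] cn[OF z] colok_lkey[of "t (r, c)" "t (Suc r, c)"] by auto
  qed
next
  assume a: "tableau n t"
  then have f: "1 \<le> fst (t z) \<and> fst (t z) \<le> n" if "z \<in> S" for z using that by (auto simp: tableau_def)
  have r: "lkey (t (r, c)) \<le> lkey (t (r, c')) \<and> (snd (t (r, c)) \<longrightarrow> t (r, c) \<noteq> t (r, c'))"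
    if "(r, c) \<in> S" "(r, c') \<in> S" "c < c'" for r c c'
    using tableau_row[OF a that] rowok_lkey[of "t (r, c)" "t (r, c')"] f that by auto
  have c: "lkey (t (r, c)) \<le> lkey (t (r', c)) \<and> (\<not> snd (t (r, c)) \<longrightarrow> t (r, c) \<noteq> t (r', c))"
    if "(r, c) \<in> S" "(r', c) \<in> S" "r < r'" for r r' c
    using tableau_col[OF a that] colok_lkey[of "t (r, c)" "t (r', c)"] f that by auto
  show "is_shst la mu n t" unfolding is_shst_def
  proof (intro conjI allI impI ballI; (elim conjE)?)
    fix p assume "p \<in> S" then show "1 \<le> fst (t p)" "fst (t p) \<le> n" using f by auto
  next
    fix x y z assume "(x, y) \<in> S" "(x, z) \<in> S" "y < z"
    then show "lkey (t (x, y)) \<le> lkey (t (x, z))" using r by blast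
  next
    fix x y z assume "(x, z) \<in> S" "(y, z) \<in> S" "x < y"
    then show "lkey (t (x, z)) \<le> lkey (t (y, z))" using c by blast
  next
    fix x y z assume "(x, z) \<in> S" "(y, z) \<in> S" "x \<noteq> y" "\<not> snd (t (x, z))"
    then show "t (x, z) \<noteq> t (y, z)" using c[of x z y] c[of y z x] by (cases "x < y") auto
  next
    fix x y z assume "(x, y) \<in> S" "(x, z) \<in> S" "y \<noteq> z" "snd (t (x, y))"
    then show "t (x, y) \<noteq> t (x, z)" using r[of x y z] r[of x z y] by (cases "y < z") auto
  qed
qed

lemma ShST_iff: "w \<in> ShST la mu n \<longleftrightarrow> (\<exists>t. tableau n t \<and> w = canon (map t clist))"
  unfolding ShST_def is_shst_tableau reading_clist by blast

lemma nth_map_idx: "z \<in> S \<Longrightarrow> map t clist ! idx z = t z"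
  using idx_S by simp

text \<open>Every representative is thus the reading word of some filling, which allows passing
  between representatives and tableaux.\<close>

lemma ex_fill: assumes "length v = length clist" shows "\<exists>t. map t clist = v"
proof
  show "map (\<lambda>z. v ! idx z) clist = v"
    using assms by (intro nth_equalityI) (auto simp: idx_nth)
qed

lemma cell_at: "k < length clist \<Longrightarrow> \<exists>r c. (r, c) \<in> S \<and> idx (r, c) = k \<and> map t clist ! k = t (r, c)"
  using nth_S[of k] idx_nth[of k] by (cases "clist ! k") auto

lemma map_upd: assumes "z \<in> S" shows "map (t(z := a)) clist = (map t clist)[idx z := a]"
proof (rule nth_equalityI)
  fix p assume "p < length (map (t(z := a)) clist)"
  then have p: "p < length clist" by simp
  have "clist ! p = z \<longleftrightarrow> p = idx z" using idx_nth[OF p] idx_S[OF assms] by metis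
  then show "map (t(z := a)) clist ! p = (map t clist)[idx z := a] ! p" using p by (simp add: nth_list_update)
qed simp

lemma row_std_lt: assumes "(r, c) \<in> S" "(r, Suc c) \<in> S"
  shows "rowok (t (r, c)) (t (r, Suc c)) \<longleftrightarrow> std_lt (map t clist) (idx (r, c)) (idx (r, Suc c))"
  using assms by (auto simp: rowok_def std_lt_def nth_map_idx)

text \<open>Ranks rise from left to right along rows and downwards along columns; the negation
  appears because the lower cell is read first.\<close>

lemma col_std_lt: assumes "(r, c) \<in> S" "(Suc r, c) \<in> S"
  shows "colok (t (r, c)) (t (Suc r, c)) \<longleftrightarrow> \<not> std_lt (map t clist) (idx (Suc r, c)) (idx (r, c))"
  unfolding colok_def std_lt_def nth_map_idx[OF assms(1)] nth_map_idx[OF assms(2)] by auto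

lemma tableau_std_lt:
  assumes ok: "tableau n t" and pl: "\<And>p j. p < j \<Longrightarrow> j < length clist \<Longrightarrow> std_lt (map t clist) p j = std_lt (map t' clist) p j"
    and rng: "\<And>z. z \<in> S \<Longrightarrow> 1 \<le> fst (t' z) \<and> fst (t' z) \<le> n"
  shows "tableau n t'"
  unfolding tableau_def
proof (intro conjI allI impI ballI)
  fix r c assume z: "(r, c) \<in> S" "(r, Suc c) \<in> S"
  have "idx (r, c) < idx (r, Suc c)" using z idx_less by (simp add: bef_def)
  then show "rowok (t' (r, c)) (t' (r, Suc c))"
    using pl[OF _ idx_S(1)[OF z(2)]] row_std_lt[OF z, of t] row_std_lt[OF z, of t'] ok z by (auto simp: tableau_def)
next
  fix r c assume z: "(r, c) \<in> S" "(Suc r, c) \<in> S"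
  have "idx (Suc r, c) < idx (r, c)" using z idx_less by (simp add: bef_def)
  then show "colok (t' (r, c)) (t' (Suc r, c))"
    using pl[OF _ idx_S(1)[OF z(1)]] col_std_lt[OF z, of t] col_std_lt[OF z, of t'] ok z by (auto simp: tableau_def)
qed (use rng in auto)

lemma tableau_eqv:
  assumes "tableau n t" "(map t clist) \<sim> (map t' clist)" shows "tableau n t'"
proof (rule tableau_std_lt[OF assms(1)])
  show "std_lt (map t clist) p j = std_lt (map t' clist) p j" if "p < j" "j < length clist" for p j
    using eqv_std_lt[OF assms(2)] that by simp
  show "1 \<le> fst (t' z) \<and> fst (t' z) \<le> n" if "z \<in> S" for z
    using eqv_fst_nth[OF assms(2), of "idx z"] idx_S[OF that] assms(1) that by (auto simp: tableau_def)
qed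

lemma Fp_rel_range:
  assumes "Fp_rel i (map t clist) (map t' clist) \<or> Fp_rel i (map t' clist) (map t clist)" "tableau n t" "1 \<le> i" "i < n" "z \<in> S"
  shows "1 \<le> fst (t' z) \<and> fst (t' z) \<le> n"
proof -
  have "map t' clist ! idx z = t' z" "map t clist ! idx z = t z" using nth_map_idx[OF assms(5)] by blast+
  moreover have "fst (v ! p) = fst (v' ! p) \<or> fst (v ! p) \<in> {i, Suc i} \<and> fst (v' ! p) \<in> {i, Suc i}"
    if "Fp_rel i v v'" "p < length v" for v v' p
    using Fp_rel_nth[OF that(1)] that(2) by (auto simp: nth_list_update split: if_splits)
  from this[of "map t clist" "map t' clist" "idx z"] this[of "map t' clist" "map t clist" "idx z"]
  have "fst (map t clist ! idx z) = fst (map t' clist ! idx z) \<or> fst (map t' clist ! idx z) \<in> {i, Suc i}"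
    using assms(1) idx_S(1)[OF assms(5)] unfolding length_map by metis
  ultimately show ?thesis using assms by (auto simp: tableau_def)
qed

lemma Fp_rel_closed:
  assumes "w \<in> ShST la mu n" "1 \<le> i" "i < n" "canon c = c" "Fp_cls i w c \<or> Fp_cls i c w"
  shows "c \<in> ShST la mu n"
proof -
  obtain t0 where t0: "tableau n t0" "w = canon (map t0 clist)" using assms(1) ShST_iff by blast
  obtain v v' where v: "v \<sim> w" "v' \<sim> c" "Fp_rel i v v' \<or> Fp_rel i v' v"
    using assms(5) unfolding Fp_cls_def by blast
  have len: "length v = length clist" "length v' = length clist"
    using eqv_length[OF v(1)] t0 v(3) Fp_rel_length by fastforce+
  obtain t t' where t: "map t clist = v" "map t' clist = v'" using ex_fill len by metis
  have "(map t0 clist) \<sim> (map t clist)" using t v t0 by simp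
  with t0(1) have ok: "tableau n t" by (rule tableau_eqv)
  have "tableau n t'"
  proof (rule tableau_std_lt[OF ok])
    show "std_lt (map t clist) p j = std_lt (map t' clist) p j" if "p < j" "j < length clist" for p j
      using v(3) Fp_rel_std_lt[of i _ _ p j] that t len by metis
    show "1 \<le> fst (t' z) \<and> fst (t' z) \<le> n" if "z \<in> S" for z
      using Fp_rel_range[OF _ ok assms(2,3) that] v(3) t by metis
  qed
  moreover have "c = canon (map t' clist)" using t v assms(4) by simp
  ultimately show ?thesis using ShST_iff by blast
qed

end

section \<open>F and E preserve tableaux\<close>

text \<open>Positional form of the run in type 1F. Letters of foreign kinds may now lie inside the
  run, hence \<open>off\<close>.\<close>

lemma Fp_rel_wy_0_desc:
  "Fp_rel i w w' \<Longrightarrow> wy i w = 0 \<Longrightarrow> \<exists>k<length w. w ! k = (i, False) \<and> w' = w[k := (Suc i, True)] \<and>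
     (\<forall>j. k < j \<longrightarrow> j < length w \<longrightarrow> off i (w ! j) \<or> w ! j = (i, True))"
proof (induction rule: Fp_rel.induct)
  case (base p) then show ?case by (intro exI[of _ "length p"]) auto
next
  case (step w w' a)
  have a: "a \<noteq> (Suc i, False)" using step.prems by (auto simp: wy_snoc)
  then have "wy i w = 0" using step by (auto simp: wy_snoc split: if_splits)
  then obtain k where k: "k < length w" "w ! k = (i, False)" "w' = w[k := (Suc i, True)]"
     "\<forall>j. k < j \<longrightarrow> j < length w \<longrightarrow> off i (w ! j) \<or> w ! j = (i, True)" using step.IH by blast
  have "off i a \<or> a = (i, True)" using a step(2,3) by (cases a) auto
  then show ?case using k
    by (intro exI[of _ k]) (auto simp: nth_append list_update_append less_Suc_eq)
qed

lemma Fp_rel_wx_1_desc: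
  "Fp_rel i w w' \<Longrightarrow> wx i w = 1 \<Longrightarrow> \<exists>k<length w. w ! k = (i, False) \<and> w' = w[k := (Suc i, True)] \<and>
     (wx i (take k w) = 0 \<or> wx i (take k w) = 1 \<and> wy i (take k w) \<ge> 1) \<and>
     (\<forall>j. k < j \<longrightarrow> j < length w \<longrightarrow> off i (w ! j) \<or> w ! j = (Suc i, False))"
proof (induction rule: Fp_rel.induct)
  case (base p) then show ?case by (intro exI[of _ "length p"]) (auto simp: wx_snoc split: if_splits)
next
  case (step w w' a)
  have "wx i w \<ge> 1" using Fp_rel_wxy[OF step(1)] by simp
  then have a: "a \<noteq> (i, True)" and "wx i w = 1" using step(2-5) by (auto simp: wx_snoc split: if_splits)
  then obtain k where k: "k < length w" "w ! k = (i, False)" "w' = w[k := (Suc i, True)]"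
     "wx i (take k w) = 0 \<or> wx i (take k w) = 1 \<and> wy i (take k w) \<ge> 1"
     "\<forall>j. k < j \<longrightarrow> j < length w \<longrightarrow> off i (w ! j) \<or> w ! j = (Suc i, False)" using step.IH by blast
  have "off i a \<or> a = (Suc i, False)" using a step(2,3) by (cases a) auto
  then show ?case using k
    by (intro exI[of _ k]) (auto simp: nth_append list_update_append less_Suc_eq)
qed

text \<open>The side condition of the \<open>step\<close> rule of \<open>F_rel\<close>, collected
  over all positions after \<open>l\<close>.\<close>

definition F_tail :: "nat \<Rightarrow> word \<Rightarrow> nat \<Rightarrow> bool" where
  "F_tail i v l \<longleftrightarrow> (\<forall>p. l < p \<longrightarrow> p < length v \<longrightarrow> v ! p = (i, False) \<or> v ! p = (Suc i, True) \<longrightarrow>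
      wx i (take p v) \<ge> 2 \<and> wy i (take p v) \<ge> 1)"

text \<open>The disjuncts are the critical types 1F-4F; k and l are the changed positions.\<close>

definition F_desc :: "nat \<Rightarrow> word \<Rightarrow> word \<Rightarrow> bool" where
  "F_desc i v v' \<longleftrightarrow>
    (\<exists>k l. k < l \<and> l < length v \<and> v ! k = (i, False) \<and> v ! l = (Suc i, True) \<and> v' = v[k := (Suc i, True), l := (Suc i, False)] \<and>
       (\<forall>j. k < j \<longrightarrow> j < l \<longrightarrow> off i (v ! j) \<or> v ! j = (i, True)) \<and> wy i (take l v) = 0 \<and> F_tail i v l) \<or>
    (\<exists>k l. k < l \<and> l < length v \<and> v ! k = (i, False) \<and> v ! l = (i, True) \<and> v' = v[k := (Suc i, True), l := (i, False)] \<and>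
       (\<forall>j. k < j \<longrightarrow> j < l \<longrightarrow> off i (v ! j) \<or> v ! j = (Suc i, False)) \<and>
       (wx i (take k v) = 0 \<or> wx i (take k v) = 1 \<and> wy i (take k v) \<ge> 1) \<and> F_tail i v l) \<or>
    (\<exists>k<length v. v ! k = (i, False) \<and> v' = v[k := (Suc i, False)] \<and> wy i (take k v) = 0 \<and> F_tail i v k) \<or>
    (\<exists>k<length v. v ! k = (i, True) \<and> v' = v[k := (Suc i, True)] \<and> wx i (take k v) = 0 \<and> F_tail i v k)"


lemma F_tail_snoc:
  assumes "F_tail i v l" "wx i v \<ge> 2 \<and> wy i v \<ge> 1 \<or> a \<noteq> (i, False) \<and> a \<noteq> (Suc i, True)"
  shows "F_tail i (v @ [a]) l"
  using assms unfolding F_tail_def by (auto simp: nth_append less_Suc_eq)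

lemma F_rel_F_desc: "F_rel i v v' \<Longrightarrow> F_desc i v v'"
proof (induction rule: F_rel.induct)
  case (type1 w w')
  then obtain k where k: "k < length w" "w ! k = (i, False)" "w' = w[k := (Suc i, True)]"
     "\<forall>j. k < j \<longrightarrow> j < length w \<longrightarrow> off i (w ! j) \<or> w ! j = (i, True)"
    using Fp_rel_wy_0_desc by blast
  show ?case unfolding F_desc_def
    by (rule disjI1, intro exI[of _ k] exI[of _ "length w"])
      (use k type1(2) in \<open>auto simp: nth_append list_update_append F_tail_def\<close>)
next
  case (type2 w w')
  then obtain k where k: "k < length w" "w ! k = (i, False)" "w' = w[k := (Suc i, True)]"
     "wx i (take k w) = 0 \<or> wx i (take k w) = 1 \<and> wy i (take k w) \<ge> 1"
     "\<forall>j. k < j \<longrightarrow> j < length w \<longrightarrow> off i (w ! j) \<or> w ! j = (Suc i, False)"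
    using Fp_rel_wx_1_desc by blast
  show ?case unfolding F_desc_def
    by (rule disjI2, rule disjI1, intro exI[of _ k] exI[of _ "length w"])
      (use k in \<open>auto simp: nth_append list_update_append F_tail_def\<close>)
next
  case (type3 p)
  show ?case unfolding F_desc_def
    by (rule disjI2, rule disjI2, rule disjI1, intro exI[of _ "length p"]) (use type3 in \<open>auto simp: F_tail_def\<close>)
next
  case (type4 p)
  show ?case unfolding F_desc_def
    by (rule disjI2, rule disjI2, rule disjI2, intro exI[of _ "length p"]) (use type4 in \<open>auto simp: F_tail_def\<close>)
next
  case (step w w' a)
  note t = F_tail_snoc[OF _ step(2)]
  from step(3) show ?case unfolding F_desc_def
  proof (elim disjE exE conjE, goal_cases)
    case (1 k l)
    show ?case
      by (rule disjI1, intro exI[of _ k] exI[of _ l]) (use 1 t[of l] in \<open>auto simp: nth_append list_update_append\<close>)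
  next
    case (2 k l)
    show ?case
      by (rule disjI2, rule disjI1, intro exI[of _ k] exI[of _ l]) (use 2 t[of l] in \<open>auto simp: nth_append list_update_append\<close>)
  next
    \<comment> \<open>The 2F disjunct again: its condition on x is itself a disjunction, which
      \<open>elim\<close> has split.\<close>
    case (3 k l)
    show ?case
      by (rule disjI2, rule disjI1, intro exI[of _ k] exI[of _ l]) (use 3 t[of l] in \<open>auto simp: nth_append list_update_append\<close>)
  next
    case (4 k)
    show ?case
      by (rule disjI2, rule disjI2, rule disjI1, intro exI[of _ k]) (use 4 t[of k] in \<open>auto simp: nth_append list_update_append\<close>)
  next
    case (5 k)
    show ?case
      by (rule disjI2, rule disjI2, rule disjI2, intro exI[of _ k]) (use 5 t[of k] in \<open>auto simp: nth_append list_update_append\<close>)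
  qed
qed

text \<open>\<open>F_tail\<close> reflected, so the bounds 2 and 1 change places.\<close>

definition E_tail :: "nat \<Rightarrow> word \<Rightarrow> nat \<Rightarrow> bool" where
  "E_tail i v l \<longleftrightarrow> (\<forall>p. l < p \<longrightarrow> p < length v \<longrightarrow> v ! p = (i, False) \<or> v ! p = (Suc i, True) \<longrightarrow>
      wx i (take p v) \<ge> 1 \<and> wy i (take p v) \<ge> 2)"

text \<open>The reflections of the disjuncts of \<open>F_desc\<close>, that is the types 1E to 4E;
  \<open>v\<close> is the word to which E is applied.\<close>

definition E_desc :: "nat \<Rightarrow> word \<Rightarrow> word \<Rightarrow> bool" where
  "E_desc i v v' \<longleftrightarrow>
    (\<exists>k l. k < l \<and> l < length v \<and> v ! k = (Suc i, True) \<and> v ! l = (i, False) \<and> v' = v[k := (i, False), l := (i, True)] \<and>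
       (\<forall>j. k < j \<longrightarrow> j < l \<longrightarrow> off i (v ! j) \<or> v ! j = (Suc i, False)) \<and> E_tail i v l) \<or>
    (\<exists>k l. k < l \<and> l < length v \<and> v ! k = (Suc i, True) \<and> v ! l = (Suc i, False) \<and> v' = v[k := (i, False), l := (Suc i, True)] \<and>
       (\<forall>j. k < j \<longrightarrow> j < l \<longrightarrow> off i (v ! j) \<or> v ! j = (i, True)) \<and>
       (wy i (take k v) = 0 \<or> wy i (take k v) = 1 \<and> wx i (take k v) \<ge> 1) \<and> E_tail i v l) \<or>
    (\<exists>k<length v. v ! k = (Suc i, True) \<and> v' = v[k := (i, True)] \<and> wx i (take k v) = 0 \<and> E_tail i v k) \<or>
    (\<exists>k<length v. v ! k = (Suc i, False) \<and> v' = v[k := (i, False)] \<and> wy i (take k v) = 0 \<and> E_tail i v k)"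

lemma F_tail_flip: "F_tail i (flip i v) l \<Longrightarrow> E_tail i v l"
  using wxy_flip[of i] unfolding F_tail_def E_tail_def by (auto simp: take_map flip1_iff)

lemma flip1_off: "off i (flip1 i a) \<longleftrightarrow> off i a"
  by (auto simp: fst_flip1)

lemma flip_swap: "flip i v = w \<longleftrightarrow> v = flip i w" by auto

lemma F_desc_flip: assumes "F_desc i (flip i v) (flip i v')" shows "E_desc i v v'"
proof -
  have m: "j < length v \<Longrightarrow> flip i v ! j = flip1 i (v ! j)" for j by simp
  have xy: "wx i (take k (flip i v)) = wy i (take k v)" "wy i (take k (flip i v)) = wx i (take k v)" for k
    using wxy_flip[of i "take k v"] by (simp_all add: take_map)
  from assms show ?thesis unfolding F_desc_def
  proof (elim disjE exE conjE, goal_cases)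
    case (1 k l)
    have bt: "\<forall>j. k < j \<longrightarrow> j < l \<longrightarrow> off i (v ! j) \<or> v ! j = (Suc i, False)"
    proof (intro allI impI)
      fix j assume j: "k < j" "j < l"
      then show "off i (v ! j) \<or> v ! j = (Suc i, False)"
        using 1(6)[rule_format, OF j] 1(2) flip1_off[of i "v ! j"] by (simp add: flip1_iff)
    qed
    show ?case unfolding E_desc_def
      by (rule disjI1, intro exI[of _ k] exI[of _ l]) (use 1 bt in \<open>auto simp: flip1_iff flip_swap map_update flip1_eq F_tail_flip\<close>)
  next
    case (2 k l)
    have bt: "\<forall>j. k < j \<longrightarrow> j < l \<longrightarrow> off i (v ! j) \<or> v ! j = (i, True)"
    proof (intro allI impI)
      fix j assume j: "k < j" "j < l"
      then show "off i (v ! j) \<or> v ! j = (i, True)"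
        using 2(6)[rule_format, OF j] 2(2) flip1_off[of i "v ! j"] by (simp add: flip1_iff)
    qed
    show ?case unfolding E_desc_def
      by (rule disjI2, rule disjI1, intro exI[of _ k] exI[of _ l]) (use 2 bt in \<open>auto simp: flip1_iff flip_swap map_update flip1_eq F_tail_flip xy\<close>)
  next
    case (3 k l)
    have bt: "\<forall>j. k < j \<longrightarrow> j < l \<longrightarrow> off i (v ! j) \<or> v ! j = (i, True)"
    proof (intro allI impI)
      fix j assume j: "k < j" "j < l"
      then show "off i (v ! j) \<or> v ! j = (i, True)"
        using 3(6)[rule_format, OF j] 3(2) flip1_off[of i "v ! j"] by (simp add: flip1_iff)
    qed
    show ?case unfolding E_desc_def
      by (rule disjI2, rule disjI1, intro exI[of _ k] exI[of _ l]) (use 3 bt in \<open>auto simp: flip1_iff flip_swap map_update flip1_eq F_tail_flip xy\<close>)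
  next
    case (4 k)
    show ?case unfolding E_desc_def
      by (rule disjI2, rule disjI2, rule disjI1, intro exI[of _ k]) (use 4 in \<open>auto simp: flip1_iff flip_swap map_update flip1_eq F_tail_flip xy\<close>)
  next
    case (5 k)
    show ?case unfolding E_desc_def
      by (rule disjI2, rule disjI2, rule disjI2, intro exI[of _ k]) (use 5 in \<open>auto simp: flip1_iff flip_swap map_update flip1_eq F_tail_flip xy\<close>)
  qed
qed

lemma F_rel_E_desc: "F_rel i v' v \<Longrightarrow> E_desc i v v'"
  using F_desc_flip F_rel_F_desc F_rel_flip by blast

lemma wx_take_Suc: "p < length v \<Longrightarrow> wx i (take (Suc p) v) = wx i (take p v @ [v ! p])"
  and wy_take_Suc: "p < length v \<Longrightarrow> wy i (take (Suc p) v) = wy i (take p v @ [v ! p])"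
  by (simp_all add: take_Suc_conv_app_nth)

text \<open>Only i lowers y and only letters of kind i+1 raise it; only (i+1)' lowers x and only
  letters of kind i raise it. Each of the four range lemmas rests on one of these facts.\<close>

lemma wy_range_up:
  "a \<le> b \<Longrightarrow> b \<le> length v \<Longrightarrow> (\<And>p. a \<le> p \<Longrightarrow> p < b \<Longrightarrow> v ! p \<noteq> (i, False)) \<Longrightarrow> wy i (take a v) \<le> wy i (take b v)"
proof (induction b rule: dec_induct)
  case (step m)
  then have "wy i (take a v) \<le> wy i (take m v)" by simp
  then show ?case using step by (auto simp: wy_take_Suc wy_snoc)
qed simp

lemma wy_range_down:
  "a \<le> b \<Longrightarrow> b \<le> length v \<Longrightarrow> (\<And>p. a \<le> p \<Longrightarrow> p < b \<Longrightarrow> fst (v ! p) \<noteq> Suc i) \<Longrightarrow> wy i (take b v) \<le> wy i (take a v)"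
proof (induction b rule: dec_induct)
  case (step m)
  then have "wy i (take m v) \<le> wy i (take a v)" by simp
  moreover have "fst (v ! m) \<noteq> Suc i" using step by simp
  then have "v ! m \<noteq> (Suc i, s)" for s by auto
  ultimately show ?case using step by (auto simp: wy_take_Suc wy_snoc)
qed simp

lemma wx_range_up:
  "a \<le> b \<Longrightarrow> b \<le> length v \<Longrightarrow> (\<And>p. a \<le> p \<Longrightarrow> p < b \<Longrightarrow> v ! p \<noteq> (Suc i, True)) \<Longrightarrow> wx i (take a v) \<le> wx i (take b v)"
proof (induction b rule: dec_induct)
  case (step m)
  then have "wx i (take a v) \<le> wx i (take m v)" by simp
  then show ?case using step by (auto simp: wx_take_Suc wx_snoc)
qed simp

lemma wx_range_down:
  "a \<le> b \<Longrightarrow> b \<le> length v \<Longrightarrow> (\<And>p. a \<le> p \<Longrightarrow> p < b \<Longrightarrow> fst (v ! p) \<noteq> i) \<Longrightarrow> wx i (take b v) \<le> wx i (take a v)"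
proof (induction b rule: dec_induct)
  case (step m)
  then have "wx i (take m v) \<le> wx i (take a v)" by simp
  moreover have "fst (v ! m) \<noteq> i" using step by simp
  then have "v ! m \<noteq> (i, s)" for s by auto
  ultimately show ?case using step by (auto simp: wx_take_Suc wx_snoc)
qed simp

context shape
begin

definition before :: "(nat \<times> nat \<Rightarrow> letter) \<Rightarrow> nat \<times> nat \<Rightarrow> word" where
  "before t z = take (idx z) (map t clist)"

definition through :: "(nat \<times> nat \<Rightarrow> letter) \<Rightarrow> nat \<times> nat \<Rightarrow> word" where
  "through t z = take (Suc (idx z)) (map t clist)"

lemma through_snoc: "z \<in> S \<Longrightarrow> through t z = before t z @ [t z]"
  using idx_S[of z] by (simp add: before_def through_def take_Suc_conv_app_nth)

lemma before_Suc: "(r, c) \<in> S \<Longrightarrow> (r, Suc c) \<in> S \<Longrightarrow> before t (r, Suc c) = through t (r, c)"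
  by (simp add: before_def through_def idx_Suc)

lemma cell_range:
  assumes "z1 \<in> S" "z2 \<in> S" "bef z1 z2" "\<And>q. q \<in> S \<Longrightarrow> bef z1 q \<Longrightarrow> bef q z2 \<Longrightarrow> P (t q)"
    and "Suc (idx z1) \<le> p" "p < idx z2"
  shows "P (map t clist ! p)"
proof -
  have p: "p < length clist" using assms(6) idx_S(1)[OF assms(2)] by simp
  have "bef z1 (clist ! p)" using nth_bef[of "idx z1" p] idx_S[OF assms(1)] p assms(5) by simp
  moreover have "bef (clist ! p) z2" using nth_bef[OF assms(6)] idx_S[OF assms(2)] by simp
  ultimately show ?thesis using assms(4)[OF nth_S[OF p]] p by simp
qed

lemma cell_ranges:
  assumes z: "z1 \<in> S" "z2 \<in> S" "bef z1 z2"
  shows "(\<And>q. q \<in> S \<Longrightarrow> bef z1 q \<Longrightarrow> bef q z2 \<Longrightarrow> t q \<noteq> (i, False)) \<Longrightarrow> wy i (through t z1) \<le> wy i (before t z2)"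
    "(\<And>q. q \<in> S \<Longrightarrow> bef z1 q \<Longrightarrow> bef q z2 \<Longrightarrow> fst (t q) \<noteq> Suc i) \<Longrightarrow> wy i (before t z2) \<le> wy i (through t z1)"
    "(\<And>q. q \<in> S \<Longrightarrow> bef z1 q \<Longrightarrow> bef q z2 \<Longrightarrow> t q \<noteq> (Suc i, True)) \<Longrightarrow> wx i (through t z1) \<le> wx i (before t z2)"
    "(\<And>q. q \<in> S \<Longrightarrow> bef z1 q \<Longrightarrow> bef q z2 \<Longrightarrow> fst (t q) \<noteq> i) \<Longrightarrow> wx i (before t z2) \<le> wx i (through t z1)"
proof -
  have l: "Suc (idx z1) \<le> idx z2" "idx z2 \<le> length (map t clist)"
    using idx_less[OF z(1,2)] z(3) idx_S(1)[OF z(2)] by auto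
  note c = cell_range[OF z, of _ t]
  show "(\<And>q. q \<in> S \<Longrightarrow> bef z1 q \<Longrightarrow> bef q z2 \<Longrightarrow> t q \<noteq> (i, False)) \<Longrightarrow> wy i (through t z1) \<le> wy i (before t z2)"
    unfolding before_def through_def using wy_range_up[OF l, of i] c[of "\<lambda>a. a \<noteq> (i, False)"] by blast
  show "(\<And>q. q \<in> S \<Longrightarrow> bef z1 q \<Longrightarrow> bef q z2 \<Longrightarrow> fst (t q) \<noteq> Suc i) \<Longrightarrow> wy i (before t z2) \<le> wy i (through t z1)"
    unfolding before_def through_def using wy_range_down[OF l, of i] c[of "\<lambda>a. fst a \<noteq> Suc i"] by blast
  show "(\<And>q. q \<in> S \<Longrightarrow> bef z1 q \<Longrightarrow> bef q z2 \<Longrightarrow> t q \<noteq> (Suc i, True)) \<Longrightarrow> wx i (through t z1) \<le> wx i (before t z2)"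
    unfolding before_def through_def using wx_range_up[OF l, of i] c[of "\<lambda>a. a \<noteq> (Suc i, True)"] by blast
  show "(\<And>q. q \<in> S \<Longrightarrow> bef z1 q \<Longrightarrow> bef q z2 \<Longrightarrow> fst (t q) \<noteq> i) \<Longrightarrow> wx i (before t z2) \<le> wx i (through t z1)"
    unfolding before_def through_def using wx_range_down[OF l, of i] c[of "\<lambda>a. fst a \<noteq> i"] by blast
qed

lemma bef_between: "bef (Suc r, e) q \<Longrightarrow> bef q (r, c) \<Longrightarrow> (\<exists>d>e. q = (Suc r, d)) \<or> (\<exists>d<c. q = (r, d))"
  by (cases q) (auto simp: bef_def)

lemma in_set_before: assumes "z \<in> S" "a \<in> set (before t z)" shows "\<exists>q\<in>S. bef q z \<and> a = t q"
proof -
  from assms(2) obtain p where p: "p < length (before t z)" "a = before t z ! p" by (metis in_set_conv_nth)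
  then have "p < idx z" "p < length clist" by (auto simp: before_def)
  then have "a = t (clist ! p)" "bef (clist ! p) z" using p nth_bef[of p "idx z"] idx_S[OF assms(1)] by (auto simp: before_def)
  then show ?thesis using nth_S[OF \<open>p < length clist\<close>] by blast
qed

lemma wx_0_cells: "z \<in> S \<Longrightarrow> (\<And>q. q \<in> S \<Longrightarrow> bef q z \<Longrightarrow> fst (t q) \<noteq> i) \<Longrightarrow> wx i (before t z) = 0"
  by (rule wx_0) (use in_set_before in fastforce)

lemma wy_0_cells: "z \<in> S \<Longrightarrow> (\<And>q. q \<in> S \<Longrightarrow> bef q z \<Longrightarrow> fst (t q) \<noteq> Suc i) \<Longrightarrow> wy i (before t z) = 0"
  by (rule wy_0) (use in_set_before in fastforce)

lemma row_le: "tableau n t \<Longrightarrow> (r, c) \<in> S \<Longrightarrow> (r, c') \<in> S \<Longrightarrow> c \<le> c' \<Longrightarrow> fst (t (r, c)) \<le> fst (t (r, c'))"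
  using tableau_row[of n t r c c'] by (cases "c = c'") (auto simp: rowok_def)

lemma col_le: "tableau n t \<Longrightarrow> (r, c) \<in> S \<Longrightarrow> (r', c) \<in> S \<Longrightarrow> r \<le> r' \<Longrightarrow> fst (t (r, c)) \<le> fst (t (r', c))"
  using tableau_col[of n t r c r'] by (cases "r = r'") (auto simp: colok_def)

lemma last_of_kind:
  assumes ok: "tableau n t" and z: "(r, c) \<in> S" "fst (t (r, c)) = k"
  shows "\<exists>m. (r, c + m) \<in> S \<and> fst (t (r, c + m)) = k \<and> (\<forall>d>c + m. (r, d) \<in> S \<longrightarrow> fst (t (r, d)) > k)"
proof -
  let ?M = "{m. (r, c + m) \<in> S \<and> fst (t (r, c + m)) = k}"
  have "?M \<subseteq> {..< r + part la r}" by (auto simp: in_S)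
  then have fin: "finite ?M" by (rule finite_subset) simp
  have "0 \<in> ?M" using z by simp
  then have m: "Max ?M \<in> ?M" using Max_in[OF fin] by blast
  have "fst (t (r, d)) > k" if "d > c + Max ?M" "(r, d) \<in> S" for d
  proof -
    have "fst (t (r, d)) \<noteq> k"
    proof
      assume "fst (t (r, d)) = k"
      then have "d - c \<in> ?M" using that by simp
      then have "d - c \<le> Max ?M" by (rule Max_ge[OF fin])
      then show False using that by simp
    qed
    moreover have "fst (t (r, c)) \<le> fst (t (r, d))" using row_le[OF ok z(1) that(2)] that(1) by simp
    ultimately show ?thesis using z(2) by simp
  qed
  then show ?thesis using m by blast
qed

text \<open>After the first cell, \<open>rowok\<close> forces the cells of kind i+1 to be unprimed,
  and each of them goes north. The lower bound serves F, the upper bound serves E.\<close>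

lemma wy_along_row:
  assumes ok: "tableau n t" and z: "(r, c) \<in> S" "fst (t (r, c)) = Suc i" and e: "(r, c + m) \<in> S" "fst (t (r, c + m)) = Suc i"
  shows "wy i (through t (r, c + m)) \<ge> Suc m \<and> (wy i (through t (r, c)) \<le> 1 \<longrightarrow> wy i (through t (r, c + m)) \<le> Suc m)"
  using e
proof (induction m)
  case 0
  obtain s where "t (r, c) = (Suc i, s)" using z(2) by (metis prod.collapse)
  then show ?case using through_snoc[OF z(1), of t] by (cases s) (auto simp: wy_snoc)
next
  case (Suc m)
  have i: "(r, c + m) \<in> S" using S_row[OF z(1) Suc.prems(1), of "c + m"] by simp
  have f: "fst (t (r, c + m)) = Suc i" using row_le[OF ok z(1) i] row_le[OF ok i Suc.prems(1)] z(2) Suc.prems(2) by simp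
  have S: "(r, Suc (c + m)) \<in> S" using Suc.prems by simp
  have "rowok (t (r, c + m)) (t (r, Suc (c + m)))" using tableau_row[OF ok i S] by simp
  then have "t (r, Suc (c + m)) = (Suc i, False)" using f Suc.prems(2) by (auto simp: rowok_def prod_eq_iff)
  then have "wy i (through t (r, c + Suc m)) = Suc (wy i (through t (r, c + m)))"
    using through_snoc[OF S, of t] before_Suc[OF i S, of t] by (simp add: wy_snoc)
  then show ?case using Suc.IH[OF i f] by simp
qed

text \<open>Reading row r+1 from column c on raises the height once for every cell of kind i+1. In row r only letters i
  lower it again; each lies above one of these cells, except possibly on the diagonal, where it is read at x = 0.\<close>

lemma wy_lower_aux:
  assumes ok: "tableau n t" and e: "(Suc r, e) \<in> S" "fst (t (Suc r, e)) = Suc i"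
    and later: "\<forall>d>e. (Suc r, d) \<in> S \<longrightarrow> fst (t (Suc r, d)) > Suc i"
  shows "(r, c) \<in> S \<Longrightarrow> (Suc r, c) \<in> S \<Longrightarrow> c \<le> e \<Longrightarrow> fst (t (Suc r, c)) = Suc i \<Longrightarrow>
    t (r, c) = (i, False) \<or> t (r, c) = (Suc i, True) \<Longrightarrow> Suc e - c \<le> wy i (before t (r, c))"
proof (induction c rule: less_induct)
  case (less c)
  have end_: "Suc e - c \<le> wy i (through t (Suc r, e))"
    using wy_along_row[OF ok less.prems(2,4), of "e - c"] e less.prems(3) by (simp add: Suc_diff_le)
  show ?case
  proof (cases "\<exists>c0. c = Suc c0 \<and> (r, c0) \<in> S \<and> t (r, c0) = (i, False)")
    case True
    then obtain c0 where c0: "c = Suc c0" "(r, c0) \<in> S" "t (r, c0) = (i, False)" by blast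
    have w: "before t (r, c) = before t (r, c0) @ [(i, False)]"
      using before_Suc[OF c0(2)] through_snoc[OF c0(2)] less.prems(1) c0 by simp
    show ?thesis
    proof (cases "(Suc r, c0) \<in> S")
      case True
      \<comment> \<open>The cell below (r, c0) has an i above it and kind i+1 on its right, so it
        has kind i+1 and the induction applies at \<open>c0\<close>.\<close>
      have "fst (t (Suc r, c0)) \<le> Suc i" using row_le[OF ok True less.prems(2)] c0 less.prems(4) by simp
      moreover have "colok (i, False) (t (Suc r, c0))" using tableau_col[OF ok c0(2) True] c0 by simp
      ultimately have "fst (t (Suc r, c0)) = Suc i" by (auto simp: colok_def)
      then have "Suc e - c0 \<le> wy i (before t (r, c0))" using less.IH[of c0] c0 True less.prems by simp
      then show ?thesis using w c0 less.prems(3) by (auto simp: wy_snoc)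
    next
      case False
      \<comment> \<open>The diagonal exception: nothing read before (r, r) has kind i, so x = 0
        there and this i steps east instead of south.\<close>
      note d = S_diag[OF c0(2) less.prems(2) _ False]
      have r0: "c0 = r" using d(1) c0 by simp
      have k: "fst (t q) \<noteq> i" if q: "q \<in> S" "bef q (r, c0)" for q
      proof -
        obtain s f where sf: "q = (s, f)" by force
        have s: "s > r" using q sf r0 by (auto simp: bef_def in_S)
        then have *: "s \<le> f" "(Suc r, f) \<in> S" using d(3)[of s f] q sf c0 by auto
        have "fst (t (Suc r, c)) \<le> fst (t (Suc r, f))" using row_le[OF ok less.prems(2) *(2)] * s c0 r0 by simp
        also have "\<dots> \<le> fst (t (s, f))" using col_le[OF ok *(2)] q sf s by simp
        finally show ?thesis using less.prems(4) sf by simp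
      qed
      have "wx i (before t (r, c0)) = 0" using wx_0_cells[OF c0(2), of t i] k by blast
      then have "wy i (before t (r, c)) = wy i (before t (r, c0))" using w by (simp add: wy_snoc)
      moreover have "wy i (through t (Suc r, e)) \<le> wy i (before t (r, c0))"
      proof (rule cell_ranges(1)[OF e(1) c0(2)])
        show "bef (Suc r, e) (r, c0)" by (simp add: bef_def)
        fix q assume q: "q \<in> S" "bef (Suc r, e) q" "bef q (r, c0)"
        then show "t q \<noteq> (i, False)" using k[OF q(1,3)] by auto
      qed
      ultimately show ?thesis using end_ by simp
    qed
  next
    case False
    have "wy i (through t (Suc r, e)) \<le> wy i (before t (r, c))"
    proof (rule cell_ranges(1)[OF e(1) less.prems(1)])
      show "bef (Suc r, e) (r, c)" by (simp add: bef_def)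
      fix q assume q: "q \<in> S" "bef (Suc r, e) q" "bef q (r, c)"
      from bef_between[OF q(2,3)] show "t q \<noteq> (i, False)"
      proof (elim disjE exE conjE)
        fix d assume "d > e" "q = (Suc r, d)"
        then have "fst (t q) > Suc i" using later q by blast
        then show ?thesis by auto
      next
        fix d assume d: "d < c" "q = (r, d)"
        show ?thesis
        proof
          \<comment> \<open>An i further left in row r would force the left neighbour of (r, c) to
            be i as well, against the case assumption.\<close>
          assume a: "t q = (i, False)"
          obtain c0 where c0: "c = Suc c0" using d by (cases c) auto
          have s0: "(r, c0) \<in> S" using S_row[of r d c c0] q d less.prems(1) c0 by simp
          then have n0: "t (r, c0) \<noteq> (i, False)" using False c0 by blast
          then have "d < c0" using d c0 a by (cases "d = c0") auto
          then have "rowok (i, False) (t (r, c0))" using tableau_row[OF ok _ s0, of d] q d a by simp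
          moreover have "rowok (t (r, c0)) (t (r, c))" using tableau_row[OF ok s0 less.prems(1)] c0 by simp
          ultimately show False using n0 less.prems(5) by (auto simp: rowok_def prod_eq_iff)
        qed
      qed
    qed
    then show ?thesis using end_ by simp
  qed
qed

text \<open>Used in contrapositive form: a letter read on y = 0 that F turns into i+1 has no letter
  of kind i+1 below it, so no column conflict arises.\<close>

lemma wy_pos_above:
  assumes ok: "tableau n t" and z: "(r, c) \<in> S" "(Suc r, c) \<in> S" "fst (t (Suc r, c)) = Suc i"
    "t (r, c) = (i, False) \<or> t (r, c) = (Suc i, True)"
  shows "wy i (before t (r, c)) \<ge> 1"
proof -
  obtain m where m: "(Suc r, c + m) \<in> S" "fst (t (Suc r, c + m)) = Suc i"
    "\<forall>d>c + m. (Suc r, d) \<in> S \<longrightarrow> fst (t (Suc r, d)) > Suc i" using last_of_kind[OF ok z(2,3)] by blast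
  show ?thesis using wy_lower_aux[OF ok m z(1,2) _ z(3,4)] by simp
qed

text \<open>Every i in row r above a cell of kind i+1 lowers the height by one, so the last cell of row r above such a
  cell is read at height at most 1.\<close>

lemma no_low_below:
  assumes ok: "tableau n t" and z: "(r, c) \<in> S" "(Suc r, c) \<in> S" "fst (t (Suc r, c)) = Suc i"
    and a: "t (r, c) = (i, False) \<or> t (r, c) = (Suc i, True)" and y: "wy i (through t (Suc r, c)) \<le> 1"
    and tail: "\<And>d. c \<le> d \<Longrightarrow> (r, d) \<in> S \<Longrightarrow> t (r, d) = (i, False) \<or> t (r, d) = (Suc i, True) \<Longrightarrow>
       wx i (before t (r, d)) \<ge> 1 \<and> wy i (before t (r, d)) \<ge> 2"
  shows False
proof -
  obtain m where m: "(Suc r, c + m) \<in> S" "fst (t (Suc r, c + m)) = Suc i"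
    "\<forall>d>c + m. (Suc r, d) \<in> S \<longrightarrow> fst (t (Suc r, d)) > Suc i" using last_of_kind[OF ok z(2,3)] by blast
  \<comment> \<open>Neither the rest of row r+1 nor the part of row r left of column c contains a
    letter of kind i+1, so y cannot grow there.\<close>
  have "wy i (before t (r, c)) \<le> wy i (through t (Suc r, c + m))"
  proof (rule cell_ranges(2)[OF m(1) z(1)])
    show "bef (Suc r, c + m) (r, c)" by (simp add: bef_def)
    fix q assume q: "q \<in> S" "bef (Suc r, c + m) q" "bef q (r, c)"
    from bef_between[OF q(2,3)] show "fst (t q) \<noteq> Suc i"
    proof (elim disjE exE conjE)
      fix d assume "d > c + m" "q = (Suc r, d)"
      then show ?thesis using m(3) q by auto
    next
      fix d assume d: "d < c" "q = (r, d)"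
      then have "rowok (t q) (t (r, c))" using tableau_row[OF ok _ z(1), of d] q by simp
      then show ?thesis using a by (auto simp: rowok_def)
    qed
  qed
  also have "\<dots> \<le> Suc m" using wy_along_row[OF ok z(2,3) m(1,2)] y by blast
  finally have y0: "wy i (before t (r, c)) \<le> Suc m" .
  \<comment> \<open>Over the run of kind i+1 the cells of row r are i or (i+1)', and all but the
    last are i; \<open>tail\<close> makes each of these read off the axes, so y drops by one per
    column.\<close>
  have "j \<le> m \<Longrightarrow> (r, c + j) \<in> S \<and> (t (r, c + j) = (i, False) \<or> t (r, c + j) = (Suc i, True)) \<and> wy i (before t (r, c + j)) \<le> Suc m - j" for j
  proof (induction j)
    case 0 then show ?case using z a y0 by simp
  next
    case (Suc j)
    then have IH: "(r, c + j) \<in> S" "t (r, c + j) = (i, False) \<or> t (r, c + j) = (Suc i, True)" "wy i (before t (r, c + j)) \<le> Suc m - j"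
      by auto
    have s1: "(Suc r, c + Suc j) \<in> S" using S_row[OF z(2) m(1)] Suc.prems by simp
    have s2: "(r, c + Suc j) \<in> S" using S_above_right[OF z(1) s1] by simp
    have f: "fst (t (Suc r, c + Suc j)) = Suc i"
      using row_le[OF ok z(2) s1] row_le[OF ok s1 m(1)] z(3) m(2) Suc.prems by simp
    have "rowok (t (Suc r, c)) (t (Suc r, c + Suc j))" using tableau_row[OF ok z(2) s1] by simp
    then have t1: "t (Suc r, c + Suc j) = (Suc i, False)" using z(3) f by (auto simp: rowok_def prod_eq_iff)
    have r: "rowok (t (r, c + j)) (t (r, c + Suc j))" using tableau_row[OF ok IH(1) s2] by simp
    have cc: "colok (t (r, c + Suc j)) (Suc i, False)" using tableau_col[OF ok s2 s1] t1 by simp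
    have l: "t (r, c + j) = (i, False)" "t (r, c + Suc j) = (i, False) \<or> t (r, c + Suc j) = (Suc i, True)"
      using r cc IH(2) by (auto simp: rowok_def colok_def prod_eq_iff)
    have "wx i (before t (r, c + j)) \<ge> 1 \<and> wy i (before t (r, c + j)) \<ge> 2" using tail[OF _ IH(1,2)] by simp
    moreover have "before t (r, c + Suc j) = before t (r, c + j) @ [(i, False)]"
      using before_Suc[OF IH(1)] through_snoc[OF IH(1), of t] s2 l by simp
    ultimately show ?case using IH(3) s2 l by (auto simp: wy_snoc)
  qed
  \<comment> \<open>At the end of the run y <= 1, whereas \<open>tail\<close> asks for y >=
    2.\<close>
  from this[of m] tail[of "c + m"] show False by auto
qed

text \<open>The column conflict of 4F. Reading the cell below brings x to at least 1, so an (i+1)'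
  must be read before x = 0 is reached again, and it lies in row r+1 right of column c. Then the
  right neighbour of (r, c) is i or (i+1)' and is read at x = 1, against
  \<open>F_tail\<close>.\<close>

lemma no_i_below:
  assumes ok: "tableau n t" and z: "(r, c) \<in> S" "t (r, c) = (i, True)" "(Suc r, c) \<in> S" "fst (t (Suc r, c)) = i"
    and x: "wx i (before t (r, c)) = 0" and tail: "F_tail i (map t clist) (idx (r, c))"
  shows False
proof -
  have "wx i (through t (Suc r, c)) \<le> wx i (before t (r, c))"
  proof (rule cell_ranges(3)[OF z(3,1)])
    show "bef (Suc r, c) (r, c)" by (simp add: bef_def)
    fix q assume q: "q \<in> S" "bef (Suc r, c) q" "bef q (r, c)"
    from bef_between[OF q(2,3)] show "t q \<noteq> (Suc i, True)"
    proof (elim disjE exE conjE)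
      fix d assume d: "d > c" "q = (Suc r, d)"
      show ?thesis
      proof
        assume a: "t q = (Suc i, True)"
        have s1: "(r, d) \<in> S" using S_above_right[OF z(1)] q d by simp
        have s2: "(r, Suc c) \<in> S" using S_row[OF z(1) s1] d by simp
        have "colok (t (r, d)) (Suc i, True)" using tableau_col[OF ok s1, of "Suc r"] q d a by simp
        moreover have "rowok (i, True) (t (r, Suc c))" using tableau_row[OF ok z(1) s2] z by simp
        moreover have "d = Suc c \<or> rowok (t (r, Suc c)) (t (r, d))" using tableau_row[OF ok s2 s1] d by (cases "d = Suc c") auto
        ultimately have "t (r, Suc c) = (i, False) \<or> t (r, Suc c) = (Suc i, True)"
          by (cases "t (r, Suc c)"; cases "t (r, d)") (auto simp: rowok_def colok_def)
        then have "wx i (before t (r, Suc c)) \<ge> 2"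
          using tail idx_S[OF s2] idx_Suc[OF z(1) s2] unfolding F_tail_def before_def by auto
        then show False using before_Suc[OF z(1) s2, of t] through_snoc[OF z(1), of t] z x by (simp add: wx_snoc)
      qed
    next
      fix d assume d: "d < c" "q = (r, d)"
      then have "rowok (t q) (i, True)" using tableau_row[OF ok _ z(1), of d] q z by simp
      then show ?thesis by (auto simp: rowok_def)
    qed
  qed
  moreover have "wx i (through t (Suc r, c)) \<ge> 1"
    using through_snoc[OF z(3), of t] z(4) by (cases "t (Suc r, c)"; cases "snd (t (Suc r, c))") (auto simp: wx_snoc)
  ultimately show False using x by simp
qed

text \<open>Every cell read earlier lies below some cell of row r+1 to the right of the diagonal.
  That cell is an unprimed i+1 or of larger kind, so everything below it has kind greater than i+1
  and the walk has not left the origin.\<close>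

lemma diag_first:
  assumes ok: "tableau n t" and z: "(r, r) \<in> S" "(Suc r, Suc r) \<in> S" "t (Suc r, Suc r) = (Suc i, True)" "(Suc r, r) \<notin> S"
  shows "wx i (before t (Suc r, Suc r)) = 0" "wy i (before t (Suc r, Suc r)) = 0"
proof -
  have k: "fst (t q) > Suc i" if q: "q \<in> S" "bef q (Suc r, Suc r)" for q
  proof -
    obtain s f where sf: "q = (s, f)" by force
    have s: "s > Suc r" using q sf by (auto simp: bef_def in_S)
    have *: "s \<le> f" "(Suc r, f) \<in> S" using S_diag(3)[OF z(1,2) _ z(4), of s f] q sf s by auto
    have s2: "(Suc (Suc r), f) \<in> S" using S_col[OF *(2), of s] q sf s by simp
    have "rowok (Suc i, True) (t (Suc r, f))" using tableau_row[OF ok z(2) *(2)] * s z by simp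
    moreover have "colok (t (Suc r, f)) (t (Suc (Suc r), f))" using tableau_col[OF ok *(2) s2] by simp
    ultimately have "fst (t (Suc (Suc r), f)) > Suc i" by (auto simp: rowok_def colok_def)
    also have "fst (t (Suc (Suc r), f)) \<le> fst (t (s, f))" using col_le[OF ok s2] q sf s by simp
    finally show ?thesis using sf by simp
  qed
  show "wx i (before t (Suc r, Suc r)) = 0" by (rule wx_0_cells[OF z(2)]) (use k in fastforce)
  show "wy i (before t (Suc r, Suc r)) = 0" by (rule wy_0_cells[OF z(2)]) (use k in fastforce)
qed

text \<open>Each neighbour condition may assume the old inequality, so replacing a letter by a close
  one leaves few real obligations.\<close>

lemma tableau_upd:
  assumes ok: "tableau n t" and z: "(r, c) \<in> S" and a: "1 \<le> fst a" "fst a \<le> n"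
    and left: "\<And>c'. c = Suc c' \<Longrightarrow> (r, c') \<in> S \<Longrightarrow> rowok (t (r, c')) (t (r, c)) \<Longrightarrow> rowok (t (r, c')) a"
    and right: "(r, Suc c) \<in> S \<Longrightarrow> rowok (t (r, c)) (t (r, Suc c)) \<Longrightarrow> rowok a (t (r, Suc c))"
    and above: "\<And>r'. r = Suc r' \<Longrightarrow> (r', c) \<in> S \<Longrightarrow> colok (t (r', c)) (t (r, c)) \<Longrightarrow> colok (t (r', c)) a"
    and below: "(Suc r, c) \<in> S \<Longrightarrow> colok (t (r, c)) (t (Suc r, c)) \<Longrightarrow> colok a (t (Suc r, c))"
  shows "tableau n (t((r, c) := a))"
proof -
  have row: "rowok (t (r, c)) (t (r, Suc c))" if "(r, c) \<in> S" "(r, Suc c) \<in> S" for r c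
    using ok that by (auto simp: tableau_def)
  have col: "colok (t (r, c)) (t (Suc r, c))" if "(r, c) \<in> S" "(Suc r, c) \<in> S" for r c
    using ok that by (auto simp: tableau_def)
  show ?thesis unfolding tableau_def
  proof (intro conjI allI impI ballI)
    fix r' c' assume s: "(r', c') \<in> S" "(r', Suc c') \<in> S"
    show "rowok ((t((r, c) := a)) (r', c')) ((t((r, c) := a)) (r', Suc c'))"
      using row[OF s] left[of c'] right s by auto
  next
    fix r' c' assume s: "(r', c') \<in> S" "(Suc r', c') \<in> S"
    show "colok ((t((r, c) := a)) (r', c')) ((t((r, c) := a)) (Suc r', c'))"
      using col[OF s] above[of r'] below s by auto
  qed (use ok a in \<open>auto simp: tableau_def\<close>)
qed

end

context shape
begin

text \<open>The letter is raised, so the left and upper neighbours are harmless. On the right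
  \<open>F_tail\<close> excludes i and (i+1)', since the next cell is read at y = 0 after 3F and at
  x = 1 after 4F. Below, \<open>wy_pos_above\<close> and \<open>no_i_below\<close> apply.\<close>

lemma F_single:
  assumes ok: "tableau n t" and i: "1 \<le> i" "i < n" and z: "(r, c) \<in> S" and tail: "F_tail i (map t clist) (idx (r, c))"
    and a: "t (r, c) = (i, False) \<and> wy i (before t (r, c)) = 0 \<and> a = (Suc i, False)
       \<or> t (r, c) = (i, True) \<and> wx i (before t (r, c)) = 0 \<and> a = (Suc i, True)"
  shows "tableau n (t((r, c) := a))"
proof (rule tableau_upd[OF ok z])
  show "1 \<le> fst a" "fst a \<le> n" using a i by auto
  show "rowok (t (r, c')) a" if "c = Suc c'" "(r, c') \<in> S" "rowok (t (r, c')) (t (r, c))" for c'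
    using that(3) a by (auto simp: rowok_def)
  show "colok (t (r', c)) a" if "r = Suc r'" "(r', c) \<in> S" "colok (t (r', c)) (t (r, c))" for r'
    using that(3) a by (auto simp: colok_def)
  show "rowok a (t (r, Suc c))" if s: "(r, Suc c) \<in> S" and ro: "rowok (t (r, c)) (t (r, Suc c))"
  proof -
    let ?b = "t (r, Suc c)"
    have w: "before t (r, Suc c) = before t (r, c) @ [t (r, c)]" using before_Suc[OF z s] through_snoc[OF z] by simp
    have "?b \<noteq> (i, False) \<and> ?b \<noteq> (Suc i, True)"
    proof (rule ccontr)
      assume "\<not> ?thesis"
      then have "wx i (before t (r, Suc c)) \<ge> 2 \<and> wy i (before t (r, Suc c)) \<ge> 1"
        using tail idx_S[OF s] idx_Suc[OF z s] unfolding F_tail_def before_def by auto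
      then show False using w a by (auto simp: wx_snoc wy_snoc)
    qed
    then show ?thesis using ro a by (cases ?b; cases "snd ?b") (auto simp: rowok_def)
  qed
  show "colok a (t (Suc r, c))" if s: "(Suc r, c) \<in> S" and co: "colok (t (r, c)) (t (Suc r, c))"
    using a
  proof (elim disjE conjE)
    assume f: "t (r, c) = (i, False)" "wy i (before t (r, c)) = 0" "a = (Suc i, False)"
    have "fst (t (Suc r, c)) \<noteq> Suc i" using wy_pos_above[OF ok z s, of i] f by auto
    then show ?thesis using co f by (auto simp: colok_def)
  next
    assume f: "t (r, c) = (i, True)" "wx i (before t (r, c)) = 0" "a = (Suc i, True)"
    have "fst (t (Suc r, c)) \<noteq> i" using no_i_below[OF ok z f(1) s _ f(2) tail] by blast
    then show ?thesis using co f by (auto simp: colok_def)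
  qed
qed

text \<open>The types with two changed cells are split into single replacements, ordered so that the
  filling in between is a tableau: right end first for 1F, left end first for 2F.\<close>

lemma F_closed_desc:
  assumes ok: "tableau n t" and i: "1 \<le> i" "i < n" and d: "F_desc i (map t clist) v'"
  shows "\<exists>t'. tableau n t' \<and> map t' clist = v'"
  using d unfolding F_desc_def
\<comment> \<open>The instances confine \<open>elim\<close> to the outer disjunctions, so the one
  inside the 2F condition stays intact.\<close>
proof (elim disjE[of "\<exists>k l. P k l" for P] disjE[of "\<exists>k<length (map t clist). P k" for P] exE conjE, goal_cases)
  case (1 k l)
  obtain r c r2 c2 where S: "(r, c) \<in> S" "(r2, c2) \<in> S" and p: "idx (r, c) = k" "idx (r2, c2) = l"
    and "map t clist ! k = t (r, c)" "map t clist ! l = t (r2, c2)"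
    using cell_at[of k t] cell_at[of l t] 1(1,2) by auto
  then have t: "t (r, c) = (i, False)" "t (r2, c2) = (Suc i, True)" using 1 by auto
  have y: "wy i (before t (r2, c2)) = 0" using 1 p by (simp add: before_def)
  let ?t1 = "t((r2, c2) := (Suc i, False))"
  have ok1: "tableau n ?t1"
  proof (rule tableau_upd[OF ok S(2)])
    show "1 \<le> fst (Suc i, False)" "fst (Suc i, False) \<le> n" using i by auto
    fix x assume "(Suc r2, c2) \<in> S" "colok (t (r2, c2)) (t (Suc r2, c2))"
    moreover from this have "fst (t (Suc r2, c2)) \<noteq> Suc i" using wy_pos_above[OF ok S(2), of i] t y by auto
    ultimately show "colok (Suc i, False) (t (Suc r2, c2))" using t by (auto simp: colok_def)
  qed (use t in \<open>auto simp: rowok_def colok_def\<close>)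
  have ne: "(r, c) \<noteq> (r2, c2)" using p 1 by auto
  then have t1: "?t1 (r, c) = (i, False)" using t by auto
  have "tableau n (?t1((r, c) := (Suc i, True)))"
  proof (rule tableau_upd[OF ok1 S(1)])
    show "1 \<le> fst (Suc i, True)" "fst (Suc i, True) \<le> n" using i by auto
    assume s: "(r, Suc c) \<in> S" and ro: "rowok (?t1 (r, c)) (?t1 (r, Suc c))"
    have ps: "idx (r, Suc c) = Suc k" using idx_Suc[OF S(1) s] p by simp
    show "rowok (Suc i, True) (?t1 (r, Suc c))"
    proof (cases "Suc k = l")
      case True
      then have "(r, Suc c) = (r2, c2)" using ps p idx_eq[OF s S(2)] by simp
      then show ?thesis by (simp add: rowok_def)
    next
      case False
      then have n: "(r, Suc c) \<noteq> (r2, c2)" using ps p by auto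
      have "off i (map t clist ! Suc k) \<or> map t clist ! Suc k = (i, True)"
        using 1 False by simp
      moreover have "map t clist ! Suc k = t (r, Suc c)" using nth_map_idx[OF s] ps by metis
      ultimately show ?thesis using ro n t1 by (auto simp: rowok_def)
    qed
  qed (use t1 in \<open>auto simp: rowok_def colok_def\<close>)
  moreover have "map (?t1((r, c) := (Suc i, True))) clist = v'"
    using 1 map_upd[OF S(1), of ?t1] map_upd[OF S(2), of t] p by (simp add: list_update_swap)
  ultimately show ?case by blast
next
  case (2 k l)
  obtain r c r2 c2 where S: "(r, c) \<in> S" "(r2, c2) \<in> S" and p: "idx (r, c) = k" "idx (r2, c2) = l"
    and "map t clist ! k = t (r, c)" "map t clist ! l = t (r2, c2)"
    using cell_at[of k t] cell_at[of l t] 2(1,2) by auto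
  then have t: "t (r, c) = (i, False)" "t (r2, c2) = (i, True)" using 2 by auto
  have bt: "off i (t q) \<or> t q = (Suc i, False)" if "q \<in> S" "k < idx q" "idx q < l" for q
    using 2(6)[rule_format, OF that(2,3)] nth_map_idx[OF that(1), of t] by simp
  let ?t1 = "t((r, c) := (Suc i, True))"
  have ok1: "tableau n ?t1"
  proof (rule tableau_upd[OF ok S(1)])
    show "1 \<le> fst (Suc i, True)" "fst (Suc i, True) \<le> n" using i by auto
    assume s: "(r, Suc c) \<in> S" and ro: "rowok (t (r, c)) (t (r, Suc c))"
    have ps: "idx (r, Suc c) = Suc k" using idx_Suc[OF S(1) s] p by simp
    show "rowok (Suc i, True) (t (r, Suc c))"
    proof (cases "Suc k = l")
      case True
      then have "(r, Suc c) = (r2, c2)" using ps p idx_eq[OF s S(2)] by simp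
      then show ?thesis using ro t by (simp add: rowok_def)
    next
      case False
      then have "off i (t (r, Suc c)) \<or> t (r, Suc c) = (Suc i, False)"
        using bt[OF s] ps 2 by simp
      then show ?thesis using ro t by (cases "t (r, Suc c)") (auto simp: rowok_def)
    qed
  qed (use t in \<open>auto simp: rowok_def colok_def\<close>)
  have ne: "(r2, c2) \<noteq> (r, c)" using p 2 by auto
  then have t1: "?t1 (r2, c2) = (i, True)" using t by auto
  have "tableau n (?t1((r2, c2) := (i, False)))"
  proof (rule tableau_upd[OF ok1 S(2)])
    show "1 \<le> fst (i, False)" "fst (i, False) \<le> n" using i by auto
    assume s: "(Suc r2, c2) \<in> S" and co: "colok (?t1 (r2, c2)) (?t1 (Suc r2, c2))"
    \<comment> \<open>A letter of kind i below position \<open>l\<close> would be read before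
      \<open>k\<close>, since only foreign letters and i+1 lie between. Then the i at
      \<open>k\<close> stands in the lower row further right, or in the same row left of the i' at
      \<open>l\<close>; the tableau \<open>t\<close> forbids both.\<close>
    have "fst (?t1 (Suc r2, c2)) \<noteq> i"
    proof
      assume f: "fst (?t1 (Suc r2, c2)) = i"
      then have nk: "(Suc r2, c2) \<noteq> (r, c)" and ft: "fst (t (Suc r2, c2)) = i" by (auto split: if_splits)
      have "bef (Suc r2, c2) (r2, c2)" by (simp add: bef_def)
      then have "idx (Suc r2, c2) < l" using idx_less[OF s S(2)] p by simp
      then have "\<not> k < idx (Suc r2, c2)" using bt[OF s] ft by (cases "t (Suc r2, c2)") auto
      then have "idx (Suc r2, c2) < idx (r, c)" using nk idx_eq[OF s S(1)] p by (metis linorder_neqE_nat)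
      then have "bef (Suc r2, c2) (r, c)" using idx_less[OF s S(1)] by simp
      moreover have "bef (r, c) (r2, c2)" using idx_less[OF S] p 2 by simp
      ultimately consider "r = Suc r2" "c > c2" | "r = r2" "c < c2" using bef_between by blast
      then show False
      proof cases
        case 1
        have s1: "(r2, c) \<in> S" using S_above_right[OF S(2), of c] S(1) 1 by simp
        have "colok (t (r2, c)) (i, False)" using tableau_col[OF ok s1 S(1)] 1 t by simp
        moreover have "rowok (i, True) (t (r2, c))" using tableau_row[OF ok S(2) s1] 1 t by simp
        ultimately show False by (auto simp: rowok_def colok_def)
      next
        case 2
        then show False using tableau_row[OF ok S(1), of c2] S(2) t by (simp add: rowok_def)
      qed
    qed
    then show "colok (i, False) (?t1 (Suc r2, c2))" using co t1 by (auto simp: colok_def)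
  qed (use t1 in \<open>auto simp: rowok_def colok_def\<close>)
  moreover have "map (?t1((r2, c2) := (i, False))) clist = v'"
    using 2 map_upd[OF S(2), of ?t1] map_upd[OF S(1), of t] p by simp
  ultimately show ?case by blast
next
  case (3 k)
  obtain r c where S: "(r, c) \<in> S" and p: "idx (r, c) = k" and t: "map t clist ! k = t (r, c)"
    using cell_at[of k t] 3(1) by auto
  have "tableau n (t((r, c) := (Suc i, False)))"
    using F_single[OF ok i S, of "(Suc i, False)"] 3 p t by (simp add: before_def)
  moreover have "map (t((r, c) := (Suc i, False))) clist = v'" using 3 map_upd[OF S, of t] p by simp
  ultimately show ?case by blast
next
  case (4 k)
  obtain r c where S: "(r, c) \<in> S" and p: "idx (r, c) = k" and t: "map t clist ! k = t (r, c)"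
    using cell_at[of k t] 4(1) by auto
  have "tableau n (t((r, c) := (Suc i, True)))"
    using F_single[OF ok i S, of "(Suc i, True)"] 4 p t by (simp add: before_def)
  moreover have "map (t((r, c) := (Suc i, True))) clist = v'" using 4 map_upd[OF S, of t] p by simp
  ultimately show ?case by blast
qed

lemma no_low_below_E_tail:
  assumes ok: "tableau n t" and z: "(r, c) \<in> S" "(Suc r, c) \<in> S" "fst (t (Suc r, c)) = Suc i"
    and a: "t (r, c) = (i, False) \<or> t (r, c) = (Suc i, True)" and y: "wy i (through t (Suc r, c)) \<le> 1"
    and l: "l < idx (r, c)" "E_tail i (map t clist) l"
  shows False
proof (rule no_low_below[OF ok z a y])
  fix d assume d: "c \<le> d" "(r, d) \<in> S" "t (r, d) = (i, False) \<or> t (r, d) = (Suc i, True)"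
  have "idx (r, c) \<le> idx (r, d)" using idx_less[OF z(1) d(2)] d(1) by (cases "c = d") (auto simp: bef_def)
  then have "l < idx (r, d)" using l by simp
  then show "wx i (before t (r, d)) \<ge> 1 \<and> wy i (before t (r, d)) \<ge> 2"
    using l(2) idx_S[OF d(2)] d(3) unfolding E_tail_def before_def by auto
qed

text \<open>By \<open>E_tail\<close>, an i or (i+1)' above would be read at x >= 1, so a letter of
  kind i is read in between, in the upper row left of column c. This is possible only next to the
  diagonal, where \<open>diag_first\<close> puts the walk at the origin before the changed cell and
  \<open>no_low_below\<close> gives the contradiction.\<close>

lemma E_single_primed:
  assumes ok: "tableau n t" and i: "1 \<le> i" "i < n" and z: "(r, c) \<in> S" and tail: "E_tail i (map t clist) (idx (r, c))"
    and a: "t (r, c) = (Suc i, True)" "wx i (before t (r, c)) = 0"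
  shows "tableau n (t((r, c) := (i, True)))"
proof -
  have left: "fst (t (r, c')) \<noteq> i" if c: "c = Suc c'" "(r, c') \<in> S" for c'
  proof
    assume "fst (t (r, c')) = i"
    then obtain s where s: "t (r, c') = (i, s)" by (metis prod.collapse)
    have "wx i (before t (r, c)) \<ge> 1" using before_Suc[OF c(2), of t] z c through_snoc[OF c(2), of t] s
      by (cases s) (auto simp: wx_snoc)
    then show False using a by simp
  qed
  have y1: "wy i (through t (r, c)) \<le> 1" if "wy i (before t (r, c)) = 0"
    using through_snoc[OF z, of t] a that by (simp add: wy_snoc)
  show ?thesis
  proof (rule tableau_upd[OF ok z])
    show "1 \<le> fst (i, True)" "fst (i, True) \<le> n" using i by auto
    show "rowok (t (r, c')) (i, True)" if "c = Suc c'" "(r, c') \<in> S" "rowok (t (r, c')) (t (r, c))" for c'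
      using left[OF that(1,2)] that(3) a by (auto simp: rowok_def)
    show "colok (t (r', c)) (i, True)" if r: "r = Suc r'" and s: "(r', c) \<in> S" and co: "colok (t (r', c)) (t (r, c))" for r'
    proof (rule ccontr)
      assume "\<not> ?thesis"
      then have b: "t (r', c) = (i, False) \<or> t (r', c) = (Suc i, True)"
        using co a by (cases "t (r', c)"; cases "snd (t (r', c))") (auto simp: colok_def)
      have bz: "bef (r, c) (r', c)" using r by (simp add: bef_def)
      then have lt: "idx (r, c) < idx (r', c)" using idx_less[OF z s] by simp
      then have "wx i (before t (r', c)) \<ge> 1"
        using tail idx_S[OF s] b unfolding E_tail_def before_def by auto
      moreover have "wx i (through t (r, c)) = 0" using through_snoc[OF z, of t] a by (simp add: wx_snoc)
      ultimately have "\<not> (\<forall>q\<in>S. bef (r, c) q \<longrightarrow> bef q (r', c) \<longrightarrow> fst (t q) \<noteq> i)"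
        using cell_ranges(4)[OF z s bz, of t i] by auto
      then obtain q where q: "q \<in> S" "bef (r, c) q" "bef q (r', c)" "fst (t q) = i" by blast
      from bef_between[OF q(2)[unfolded r] q(3)] show False
      proof (elim disjE exE conjE)
        fix d assume d: "d > c" "q = (Suc r', d)"
        then have "rowok (Suc i, True) (t q)" using tableau_row[OF ok z, of d] q r a by simp
        then show False using q by (simp add: rowok_def)
      next
        fix d assume d: "d < c" "q = (r', d)"
        obtain c0 where c0: "c = Suc c0" using d by (cases c) auto
        have s0: "(r', c0) \<in> S" using S_row[of r' d c c0] q d s c0 by simp
        have "fst (t (r', c0)) \<ge> i" using row_le[OF ok _ s0, of d] q d c0 by simp
        moreover have "rowok (t (r', c0)) (t (r', c))" using tableau_row[OF ok s0 s] c0 by simp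
        ultimately have f0: "fst (t (r', c0)) = i" using b by (auto simp: rowok_def)
        \<comment> \<open>A cell there would have kind i and be the left neighbour of the changed
          cell, which x = 0 forbids.\<close>
        have z0: "(Suc r', c0) \<notin> S"
        proof
          assume m: "(Suc r', c0) \<in> S"
          have "i \<le> fst (t (Suc r', c0))" using col_le[OF ok s0 m] f0 by simp
          moreover have "rowok (t (Suc r', c0)) (Suc i, True)" using tableau_row[OF ok m, of c] z r c0 a by simp
          ultimately have "fst (t (Suc r', c0)) = i" by (auto simp: rowok_def)
          then show False using left[of c0] m r c0 by simp
        qed
        have r0: "c0 = r'" using S_diag(1)[OF s0 _ _ z0] z r c0 by simp
        have "wy i (before t (r, c)) = 0" using diag_first(2)[OF ok, of r'] s0 z r c0 r0 a z0 by simp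
        then show False using no_low_below_E_tail[OF ok s _ _ b _ lt tail] y1 z a r by simp
      qed
    qed
  qed (use a in \<open>auto simp: rowok_def colok_def\<close>)
qed

text \<open>y = 0 before the cell rules out kind i+1 on its left and gives y <= 1 after it, the
  bound needed by \<open>no_low_below\<close> for the cell above.\<close>

lemma E_single_unprimed:
  assumes ok: "tableau n t" and i: "1 \<le> i" "i < n" and z: "(r, c) \<in> S" and tail: "E_tail i (map t clist) (idx (r, c))"
    and a: "t (r, c) = (Suc i, False)" "wy i (before t (r, c)) = 0"
  shows "tableau n (t((r, c) := (i, False)))"
proof (rule tableau_upd[OF ok z])
  show "1 \<le> fst (i, False)" "fst (i, False) \<le> n" using i by auto
  show "rowok (t (r, c')) (i, False)" if c: "c = Suc c'" "(r, c') \<in> S" and ro: "rowok (t (r, c')) (t (r, c))" for c'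
  proof -
    have "fst (t (r, c')) \<noteq> Suc i"
    proof
      assume "fst (t (r, c')) = Suc i"
      then obtain s where s: "t (r, c') = (Suc i, s)" by (metis prod.collapse)
      have "wy i (before t (r, c)) \<ge> 1" using before_Suc[OF c(2), of t] z c through_snoc[OF c(2), of t] s
        by (cases s) (auto simp: wy_snoc)
      then show False using a by simp
    qed
    then show ?thesis using ro a by (auto simp: rowok_def)
  qed
  show "colok (t (r', c)) (i, False)" if r: "r = Suc r'" and s: "(r', c) \<in> S" and co: "colok (t (r', c)) (t (r, c))" for r'
  proof (rule ccontr)
    assume "\<not> ?thesis"
    then have b: "t (r', c) = (i, False) \<or> t (r', c) = (Suc i, True)"
      using co a by (cases "t (r', c)"; cases "snd (t (r', c))") (auto simp: colok_def)
    have "bef (r, c) (r', c)" using r by (simp add: bef_def)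
    then have lt: "idx (r, c) < idx (r', c)" using idx_less[OF z s] by simp
    have "wy i (through t (r, c)) \<le> 1" using through_snoc[OF z, of t] a by (simp add: wy_snoc)
    then show False using no_low_below_E_tail[OF ok s _ _ b _ lt tail] z a r by simp
  qed
qed (use a in \<open>auto simp: rowok_def colok_def\<close>)

text \<open>The right end is replaced first for 1E, the left end first for 2E. The conflict to
  exclude is an i or (i+1)' above position \<open>k\<close>: it is not read between \<open>k\<close>
  and \<open>l\<close>, so it is read after \<open>l\<close>, and \<open>no_low_below\<close>
  applies once y <= 1 is known after \<open>k\<close>.\<close>

lemma E_closed_desc:
  assumes ok: "tableau n t" and i: "1 \<le> i" "i < n" and d: "E_desc i (map t clist) v'"
  shows "\<exists>t'. tableau n t' \<and> map t' clist = v'"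
  using d unfolding E_desc_def
proof (elim disjE[of "\<exists>k l. P k l" for P] disjE[of "\<exists>k<length (map t clist). P k" for P] exE conjE, goal_cases)
  case (1 k l)
  obtain r c r2 c2 where S: "(r, c) \<in> S" "(r2, c2) \<in> S" and p: "idx (r, c) = k" "idx (r2, c2) = l"
    and "map t clist ! k = t (r, c)" "map t clist ! l = t (r2, c2)"
    using cell_at[of k t] cell_at[of l t] 1(1,2) by auto
  then have t: "t (r, c) = (Suc i, True)" "t (r2, c2) = (i, False)" using 1 by auto
  have bt: "off i (t q) \<or> t q = (Suc i, False)" if "q \<in> S" "k < idx q" "idx q < l" for q
    using 1(6)[rule_format, OF that(2,3)] nth_map_idx[OF that(1), of t] by simp
  let ?t1 = "t((r2, c2) := (i, True))"
  have ok1: "tableau n ?t1"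
  proof (rule tableau_upd[OF ok S(2)])
    show "1 \<le> fst (i, True)" "fst (i, True) \<le> n" using i by auto
    fix c' assume c': "c2 = Suc c'" "(r2, c') \<in> S" and ro: "rowok (t (r2, c')) (t (r2, c2))"
    have ps: "Suc (idx (r2, c')) = l" using idx_Suc[OF c'(2)] S(2) c' p by simp
    have "fst (t (r2, c')) \<noteq> i"
    proof (cases "idx (r2, c') = k")
      case True
      then have "(r2, c') = (r, c)" using p idx_eq[OF c'(2) S(1)] by simp
      then show ?thesis using t by simp
    next
      case False
      then show ?thesis using bt[OF c'(2)] ps 1(1) by (cases "t (r2, c')") auto
    qed
    then show "rowok (t (r2, c')) (i, True)" using ro t by (auto simp: rowok_def)
  qed (use t in \<open>auto simp: rowok_def colok_def\<close>)
  have ne: "(r, c) \<noteq> (r2, c2)" using p 1 by auto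
  then have t1: "?t1 (r, c) = (Suc i, True)" using t by auto
  have "tableau n (?t1((r, c) := (i, False)))"
  proof (rule tableau_upd[OF ok1 S(1)])
    show "1 \<le> fst (i, False)" "fst (i, False) \<le> n" using i by auto
    fix r' assume r: "r = Suc r'" and s: "(r', c) \<in> S" and co: "colok (?t1 (r', c)) (?t1 (r, c))"
    show "colok (?t1 (r', c)) (i, False)"
    proof (rule ccontr)
      assume nc: "\<not> ?thesis"
      then have b1: "?t1 (r', c) = (i, False) \<or> ?t1 (r', c) = (Suc i, True)"
        using co t1 by (cases "?t1 (r', c)"; cases "snd (?t1 (r', c))") (auto simp: colok_def)
      then have nl: "(r', c) \<noteq> (r2, c2)" and b: "t (r', c) = (i, False) \<or> t (r', c) = (Suc i, True)"
        by (auto split: if_splits)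
      have "bef (r, c) (r', c)" using r by (simp add: bef_def)
      then have "k < idx (r', c)" using idx_less[OF S(1) s] p by simp
      then have "\<not> idx (r', c) < l" using bt[OF s] b by auto
      moreover have "idx (r', c) \<noteq> l" using nl idx_eq[OF s S(2)] p by simp
      ultimately have lt: "l < idx (r', c)" by simp
      then have "bef (r2, c2) (r', c)" using idx_less[OF S(2) s] p by simp
      moreover have "bef (Suc r', c) (r2, c2)" using idx_less[OF S] p 1(1) r by simp
      ultimately consider "r2 = Suc r'" "c2 > c" | "r2 = r'" "c2 < c" using bef_between by blast
      then show False
      proof cases
        assume "r2 = Suc r'" "c2 > c"
        then have "rowok (Suc i, True) (i, False)" using tableau_row[OF ok S(1), of c2] S(2) r t by simp
        then show False by (simp add: rowok_def)
      next
        \<comment> \<open>The i at \<open>l\<close> stands in the upper row left of column c. A cell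
          below it, left of the (i+1)' at \<open>k\<close>, would have no admissible letter, so it
          is missing; the diagonal geometry then places \<open>k\<close> at (r'+1, r'+1), with y = 0
          before it.\<close>
        assume e: "r2 = r'" "c2 < c"
        have left: "rowok (t (Suc r', d)) (Suc i, True)" if "(Suc r', d) \<in> S" "d < c" for d
          using tableau_row[OF ok that(1), of c] that S(1) r t by simp
        have z0: "(Suc r', c2) \<notin> S"
        proof
          assume m: "(Suc r', c2) \<in> S"
          have "colok (i, False) (t (Suc r', c2))" using tableau_col[OF ok S(2), of "Suc r'"] m e t by simp
          then show False using left[OF m e(2)] by (auto simp: rowok_def colok_def)
        qed
        have Sr: "(r', c2) \<in> S" "(Suc r', c) \<in> S" using S e r by auto
        note dg = S_diag[OF Sr e(2) z0]
        \<comment> \<open>Otherwise (r', r'+1) is a cell to the right of \<open>l\<close>, and the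
          diagonal cell below it would need kind at least i+1 because of the i at \<open>l\<close>,
          but at most i because of the (i+1)' at \<open>k\<close>.\<close>
        have c: "c = Suc r'"
        proof (rule ccontr)
          assume "c \<noteq> Suc r'"
          then have lt: "Suc r' < c" using Sr(2) by (auto simp: in_S)
          have m: "(r', Suc r') \<in> S" using S_row[OF Sr(1) s, of "Suc r'"] dg(1) lt by simp
          have "rowok (i, False) (t (r', Suc r'))" using tableau_row[OF ok Sr(1) m] dg(1) t e by simp
          moreover have "colok (t (r', Suc r')) (t (Suc r', Suc r'))" using tableau_col[OF ok m dg(2)] by simp
          ultimately show False using left[OF dg(2) lt] by (auto simp: rowok_def colok_def)
        qed
        have "wy i (before t (r, c)) = 0" using diag_first(2)[OF ok, of r'] Sr r c dg(1) t z0 by simp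
        then have "wy i (through t (r, c)) \<le> 1" using through_snoc[OF S(1), of t] t by (simp add: wy_snoc)
        then show False using no_low_below_E_tail[OF ok s Sr(2) _ b _ lt] 1(7) t r by simp
      qed
    qed
  qed (use t1 in \<open>auto simp: rowok_def colok_def\<close>)
  moreover have "map (?t1((r, c) := (i, False))) clist = v'"
    using 1 map_upd[OF S(1), of ?t1] map_upd[OF S(2), of t] p by (simp add: list_update_swap)
  ultimately show ?case by blast
next
  case (2 k l)
  obtain r c r2 c2 where S: "(r, c) \<in> S" "(r2, c2) \<in> S" and p: "idx (r, c) = k" "idx (r2, c2) = l"
    and "map t clist ! k = t (r, c)" "map t clist ! l = t (r2, c2)"
    using cell_at[of k t] cell_at[of l t] 2(1,2) by auto
  then have t: "t (r, c) = (Suc i, True)" "t (r2, c2) = (Suc i, False)" using 2 by auto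
  have bt: "off i (t q) \<or> t q = (i, True)" if "q \<in> S" "k < idx q" "idx q < l" for q
    using 2(6)[rule_format, OF that(2,3)] nth_map_idx[OF that(1), of t] by simp
  let ?t1 = "t((r, c) := (i, False))"
  have ok1: "tableau n ?t1"
  proof (rule tableau_upd[OF ok S(1)])
    show "1 \<le> fst (i, False)" "fst (i, False) \<le> n" using i by auto
    fix r' assume r: "r = Suc r'" and s: "(r', c) \<in> S" and co: "colok (t (r', c)) (t (r, c))"
    show "colok (t (r', c)) (i, False)"
    proof (rule ccontr)
      assume "\<not> ?thesis"
      then have b: "t (r', c) = (i, False) \<or> t (r', c) = (Suc i, True)"
        using co t by (cases "t (r', c)"; cases "snd (t (r', c))") (auto simp: colok_def)
      have "bef (r, c) (r', c)" using r by (simp add: bef_def)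
      then have "k < idx (r', c)" using idx_less[OF S(1) s] p by simp
      then have "\<not> idx (r', c) < l" using bt[OF s] b by auto
      moreover have "idx (r', c) \<noteq> l" using b t idx_eq[OF s S(2)] p by auto
      ultimately have lt: "l < idx (r', c)" by simp
      \<comment> \<open>The position condition of 2E gives y = 0, or y = 1 with x >= 1, where (i+1)'
        goes west; so y <= 1 after \<open>k\<close>.\<close>
      have "wy i (through t (r, c)) \<le> 1" using through_snoc[OF S(1), of t] t 2(7) p by (auto simp: wy_snoc before_def)
      then show False using no_low_below_E_tail[OF ok s _ _ b _ lt] 2(8) S(1) t r by simp
    qed
  qed (use t in \<open>auto simp: rowok_def colok_def\<close>)
  have ne: "(r2, c2) \<noteq> (r, c)" using p 2 by auto
  then have t1: "?t1 (r2, c2) = (Suc i, False)" using t by auto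
  have "tableau n (?t1((r2, c2) := (Suc i, True)))"
  proof (rule tableau_upd[OF ok1 S(2)])
    show "1 \<le> fst (Suc i, True)" "fst (Suc i, True) \<le> n" using i by auto
    fix c' assume c': "c2 = Suc c'" "(r2, c') \<in> S" and ro: "rowok (?t1 (r2, c')) (?t1 (r2, c2))"
    have ps: "Suc (idx (r2, c')) = l" using idx_Suc[OF c'(2)] S(2) c' p by simp
    have "fst (?t1 (r2, c')) \<noteq> Suc i"
    proof (cases "idx (r2, c') = k")
      case True
      then have "(r2, c') = (r, c)" using p idx_eq[OF c'(2) S(1)] by simp
      then show ?thesis by simp
    next
      case False
      then have "(r2, c') \<noteq> (r, c)" using p by auto
      then show ?thesis using bt[OF c'(2)] ps 2(1) False by auto
    qed
    then show "rowok (?t1 (r2, c')) (Suc i, True)" using ro t1 by (auto simp: rowok_def)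
  qed (use t1 in \<open>auto simp: rowok_def colok_def\<close>)
  moreover have "map (?t1((r2, c2) := (Suc i, True))) clist = v'"
    using 2 map_upd[OF S(2), of ?t1] map_upd[OF S(1), of t] p by simp
  ultimately show ?case by blast
next
  case (3 k)
  obtain r c where S: "(r, c) \<in> S" and p: "idx (r, c) = k" and t: "map t clist ! k = t (r, c)"
    using cell_at[of k t] 3(1) by auto
  have "tableau n (t((r, c) := (i, True)))"
    using E_single_primed[OF ok i S] 3 p t by (simp add: before_def)
  moreover have "map (t((r, c) := (i, True))) clist = v'" using 3 map_upd[OF S, of t] p by simp
  ultimately show ?case by blast
next
  case (4 k)
  obtain r c where S: "(r, c) \<in> S" and p: "idx (r, c) = k" and t: "map t clist ! k = t (r, c)"
    using cell_at[of k t] 4(1) by auto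
  have "tableau n (t((r, c) := (i, False)))"
    using E_single_unprimed[OF ok i S] 4 p t by (simp add: before_def)
  moreover have "map (t((r, c) := (i, False))) clist = v'" using 4 map_upd[OF S, of t] p by simp
  ultimately show ?case by blast
qed

lemma F_rel_closed:
  assumes "w \<in> ShST la mu n" "1 \<le> i" "i < n" "canon c = c" "F_cls i w c \<or> F_cls i c w"
  shows "c \<in> ShST la mu n"
proof -
  obtain t0 where t0: "tableau n t0" "w = canon (map t0 clist)" using assms(1) ShST_iff by blast
  obtain v v' where v: "v \<sim> w" "v' \<sim> c" "F_rel i v v' \<or> F_rel i v' v"
    using assms(5) unfolding F_cls_def by blast
  have "length v = length clist" using eqv_length[OF v(1)] t0 by simp
  then obtain t where t: "map t clist = v" using ex_fill by blast
  have "(map t0 clist) \<sim> (map t clist)" using t v t0 by simp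
  with t0(1) have ok: "tableau n t" by (rule tableau_eqv)
  have "\<exists>t'. tableau n t' \<and> map t' clist = v'"
    using v(3) F_closed_desc[OF ok assms(2,3), of v'] E_closed_desc[OF ok assms(2,3), of v'] F_rel_F_desc F_rel_E_desc t by blast
  then obtain t' where "tableau n t'" "map t' clist = v'" by blast
  moreover have "c = canon v'" using v assms(4) by simp
  ultimately show ?thesis using ShST_iff by blast
qed

lemma ShST_canon: "w \<in> ShST la mu n \<Longrightarrow> canon w = w"
  using ShST_iff by auto

end

section \<open>Weights and the Kashiwara axioms\<close>

lemma weight_shift:
  assumes "cnt i w = Suc (cnt i c) \<and> cnt (Suc i) c = Suc (cnt (Suc i) w) \<and> (\<forall>k. k \<noteq> i \<longrightarrow> k \<noteq> Suc i \<longrightarrow> cnt k w = cnt k c)"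
  shows "wt w = (\<lambda>j. wt c j + alpha i j)"
  using assms by (auto simp: wt_cnt alpha_def fun_eq_iff)

lemma F_cls_shift: "F_cls i w c \<Longrightarrow> wx i w = wx i c + 1 \<and> wy i c = wy i w + 1 \<and> wt w = (\<lambda>j. wt c j + alpha i j)"
proof -
  assume "F_cls i w c"
  then obtain v v' where v: "v \<sim> w" "v' \<sim> c" "F_rel i v v'" by (auto simp: F_cls_def)
  show ?thesis
    using F_rel_wxy[OF v(3)] weight_shift[of i w c] F_rel_cnt[OF v(3)] eqv_wx[OF v(1), of i] eqv_wy[OF v(1), of i] eqv_wx[OF v(2), of i] eqv_wy[OF v(2), of i]
    unfolding eqv_cnt[OF v(1)] eqv_cnt[OF v(2)] by simp
qed

lemma Fp_cls_shift: "Fp_cls i w c \<Longrightarrow> wx i w = wx i c + 1 \<and> wy i c = wy i w + 1 \<and> wt w = (\<lambda>j. wt c j + alpha i j)"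
proof -
  assume "Fp_cls i w c"
  then obtain v v' where v: "v \<sim> w" "v' \<sim> c" "Fp_rel i v v'" by (auto simp: Fp_cls_def)
  show ?thesis
    using Fp_rel_wxy[OF v(3)] weight_shift[of i w c] Fp_rel_cnt[OF v(3)] eqv_wx[OF v(1), of i] eqv_wy[OF v(1), of i] eqv_wx[OF v(2), of i] eqv_wy[OF v(2), of i]
    unfolding eqv_cnt[OF v(1)] eqv_cnt[OF v(2)] by simp
qed

lemma phi_wx: "phi_i i w = int (wx i w)" and eps_Y: "eps_i i w = int (wy i w)"
  by (simp_all add: phi_i_def eps_i_def walk_end_isub wx_def wy_def)

text \<open>A letter of kind i raises x - y by one whether it goes east or south, and a letter of
  kind i+1 lowers it by one. This is (K2).\<close>

lemma walk_balance: "int (wx i w) + int (cnt (Suc i) w) = int (cnt i w) + int (wy i w)"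
proof (induction w rule: rev_induct)
  case (snoc a w)
  obtain k s where a: "a = (k, s)" by force
  show ?case using snoc by (cases s; cases "k = i"; cases "k = Suc i") (auto simp: wx_snoc wy_snoc a)
qed simp

text \<open>f is given by a relation and e by its converse, so the inverse property in (K1) holds by
  construction; the relation is left open to serve both crystals.\<close>

lemma kashiwara_crystalI:
  assumes R: "\<And>i w c. R i w c \<Longrightarrow> wx i w = wx i c + 1 \<and> wy i c = wy i w + 1 \<and> wt w = (\<lambda>j. wt c j + alpha i j)"
    and f: "\<And>i w c. f i w = Some c \<longleftrightarrow> canon c = c \<and> R i w c" and e: "\<And>i w c. e i w = Some c \<longleftrightarrow> canon c = c \<and> R i c w"
    and B: "\<And>w. w \<in> B \<Longrightarrow> canon w = w"
    and clist: "\<And>i w c. w \<in> B \<Longrightarrow> 1 \<le> i \<Longrightarrow> i < n \<Longrightarrow> canon c = c \<Longrightarrow> R i w c \<or> R i c w \<Longrightarrow> c \<in> B"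
  shows "kashiwara_crystal B n e f eps_i phi_i wt"
  unfolding kashiwara_crystal_def
proof (intro allI impI conjI ballI)
  fix i x y assume i: "1 \<le> i \<and> i < n" and x: "x \<in> B"
  show "e i x = Some y \<Longrightarrow> y \<in> B" "f i x = Some y \<Longrightarrow> y \<in> B" using clist[OF x] i e f by blast+
  show "phi_i i x = wt x i - wt x (Suc i) + eps_i i x" using walk_balance[of i x] by (simp add: phi_wx eps_Y wt_cnt)
  assume y: "y \<in> B"
  show "(e i x = Some y) = (f i y = Some x)" using e f B x y by auto
  assume "e i x = Some y"
  then have "R i y x" using e by blast
  from R[OF this] show "eps_i i y = eps_i i x - 1" "phi_i i y = phi_i i x + 1" "wt y = (\<lambda>j. wt x j + alpha i j)"
    by (auto simp: phi_wx eps_Y)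
qed

theorem mainTheorem6:
  fixes la mu :: "nat list" and n :: nat
  assumes "strict_partition la" and "strict_partition mu" and "part_contained mu la"
  shows "(\<forall>i. 1 \<le> i \<and> i < n \<longrightarrow>
            (\<forall>T\<in>ShST la mu n. \<forall>X\<in>set [F_i i, E_i i, Fp_i i, Ep_i i].
               \<forall>Y\<in>set [F_i i, E_i i, Fp_i i, Ep_i i].
                 Option.bind (Y T) X \<noteq> None \<and> Option.bind (X T) Y \<noteq> None \<longrightarrow>
                 Option.bind (Y T) X = Option.bind (X T) Y))
       \<and> kashiwara_crystal (ShST la mu n) n E_i F_i eps_i phi_i wt
       \<and> kashiwara_crystal (ShST la mu n) n Ep_i Fp_i eps_i phi_i wt"
proof -
  interpret shape la mu using assms by unfold_locales
  show ?thesis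
  proof (intro conjI allI impI ballI; (elim conjE)?)
    fix i T P Q assume PQ: "P \<in> set [F_i i, E_i i, Fp_i i, Ep_i i]" "Q \<in> set [F_i i, E_i i, Fp_i i, Ep_i i]"
      and "Option.bind (Q T) P \<noteq> None" "Option.bind (P T) Q \<noteq> None"
    then obtain a b where "Option.bind (Q T) P = Some a" "Option.bind (P T) Q = Some b" by blast
    then show "Option.bind (Q T) P = Option.bind (P T) Q" using commute[OF PQ] by simp
  next
    show "kashiwara_crystal (ShST la mu n) n E_i F_i eps_i phi_i wt"
      by (rule kashiwara_crystalI[where R = F_cls]) (use F_cls_shift F_i_iff E_i_iff ShST_canon F_rel_closed in blast)+
  next
    show "kashiwara_crystal (ShST la mu n) n Ep_i Fp_i eps_i phi_i wt"
      by (rule kashiwara_crystalI[where R = Fp_cls]) (use Fp_cls_shift Fp_i_iff Ep_i_iff ShST_canon Fp_rel_closed in blast)+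
  qed
qed

end
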